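(* Let $W=(V,\mathsf{w})$ be a weighted digraph of positive spectral radius $\rho$, with residual matrix $\Theta$, and let $x_0$ be a vertex such that all vertices of $W$ are accessible from $x_0$. Let $\mathsf{U}(x_0)$ be the umbrella digraph spanned by $x_0$. Then the Boltzmann distributions $\theta_{x_0,s}$ converge weakly, when $s\to\rho^{-1}$ with $s\in(0,\rho^{-1})$, toward (the component $\theta_{x_0}$ starting from $x_0$ of) the complete cocycle measure $\theta=(\theta_x)_x$ on $\mathsf{U}(x_0)$ whose cocycle transition kernel is given on $\mathsf{U}(x_0)$ by $$q(x,y)=\rho^{-1}\mathsf{w}(x,y)\Gamma(x,y),\qquad \Gamma(x,y)=\frac{[\Theta\cdot 1]_y}{[\Theta\cdot 1]_x},$$ where $1$ denotes the column vector filled with $1$s.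
   Context: A weighted digraph is a pair $W=(V,\mathsf{w})$ with $V$ a finite set of vertices and $\mathsf{w}:V\times V\to\mathbb{R}_{\ge0}$; its edges are the pairs $(x,y)$ with $\mathsf{w}(x,y)>0$. Its adjacency matrix $F$ is given by $[F]_{x,y}=\mathsf{w}(x,y)$, and its spectral radius is that of $F$. A subset of $V$ is seen as a sub-digraph by restricting $\mathsf{w}$. A finite path is a sequence $u=(x_0,\dots,x_k)$ of vertices with each $(x_i,x_{i+1})$ an edge; its length is $\ell(u)=k$, its final vertex $\kappa(u)=x_k$, its weight $\mathsf{w}(u)=\prod_{i<k}\mathsf{w}(x_i,x_{i+1})$ ($=1$ if $k=0$). $O_x$ is the set of finite paths starting at $x$; $\Omega_x$ is the set of infinite paths starting at $x$; $\overline{O}_x=O_x\cup\Omega_x$ is equipped with the (compact metrizable) product topology, finite paths being viewed as infinite sequences by padding with an extra symbol $\dagger\notin V$. For $u\in O_x$, $\uparrow u$ is the set of infinite paths with prefix $u$. Weak convergence is weak convergence of probability measures on $\overline{O}_x$, measures on $\Omega_x$ being viewed as measures on $\overline{O}_x$. Access: $x\Rightarrow y$ ($y$ accessible from $x$) means there is a finite path (possibly of length $0$) from $x$ to $y$; access classes are the equivalence classes of "$x\Rightarrow y$ and $y\Rightarrow x$", partially ordered by the induced relation $\Rightarrow$. The spectral radius of a class is that of the corresponding block of $F$; a class is basic if its spectral radius is that of the whole digraph, and final if it has access to no other class. A dominant chain is a chain $L_1\Rightarrow L_2\Rightarrow\cdots$ of distinct basic classes of maximal length (number of classes); the height is the length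 of the dominant chains. An umbrella digraph is a digraph of positive spectral radius whose basic classes coincide with its final classes. For a vertex $x$, $V(x)=\{y\in V: x\Rightarrow y\}$, seen as a sub-digraph, with spectral radius $\gamma(x)$ and height $h(x)$. If $\gamma(x)>0$, the umbrella digraph spanned by $x$, denoted $\mathsf{U}(x)$, is the sub-digraph of $V(x)$ whose vertices are the $y\in V(x)$ such that $y\Rightarrow L_1$ for some dominant chain $(L_1,\dots,L_{h(x)})$ of $V(x)$. (It is an umbrella digraph of spectral radius $\gamma(x)$.) Boltzmann distributions: if $\gamma(x)>0$, for $0<s<\gamma(x)^{-1}$, $\theta_{x,s}=\frac1{G_x(s)}\sum_{u\in O_x}\mathsf{w}(u)s^{\ell(u)}\delta_{\{u\}}$ with $G_x(s)=\sum_{u\in O_x}\mathsf{w}(u)s^{\ell(u)}$. Residual matrix: with $\mathsf{H}(z)=\sum_{k\ge0}F^kz^k$ and $\rho>0$ the spectral radius, there are a unique positive integer $h$ and a unique nonnegative nonzero matrix $\Theta$ with $\lim_{s\to\rho^{-1},\,s\in(0,\rho^{-1})}(1-\rho s)^h\mathsf{H}(s)=\Theta$; $\Theta$ is the residual matrix. A cocycle on a digraph is a function $\Gamma:\{(x,y):x\Rightarrow y\}\to\mathbb{R}_{\ge0}$ with $\Gamma(x,z)=\Gamma(x,y)\Gamma(y,z)$ whenever $x\Rightarrow y\Rightarrow z$. A cocycle measure is a family $\mu=(\mu_x)_x$ of probability measures, $\mu_x$ on the space of infinite paths of the digraph starting at $x$, such that for some real $\rho>0$ and some cocycle $\Gamma$,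 $\mu_x(\uparrow u)=\rho^{-\ell(u)}\mathsf{w}(u)\Gamma(x,\kappa(u))$ for all vertices $x$ and all finite paths $u$ of the digraph starting at $x$. It is complete if $\Gamma$ is positive everywhere on its domain. Under $\mu_x$ the sequence of visited vertices is a Markov chain started at $x$ with transition kernel $q(x,y)=\rho^{-1}\mathsf{w}(x,y)\Gamma(x,y)$, called the cocycle (transition) kernel; cocycle measures and cocycle kernels determine each other. *)

theory Defs
  imports "HOL-Probability.Probability" "Jordan_Normal_Form.Spectral_Radius"
begin

section \<open>Weighted digraphs and their paths\<close>

text \<open>
  A weighted digraph is given by a finite vertex set \<open>V\<close> and a weight function \<open>w\<close> of which only the
  values on \<open>V \<times> V\<close> matter.  The sub-digraph on \<open>S \<subseteq> V\<close> is the pair \<open>S\<close>, \<open>w\<close>, so all notions below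
  take the vertex set as an explicit argument.
\<close>

definition weighted_digraph :: "'a set \<Rightarrow> ('a \<Rightarrow> 'a \<Rightarrow> real) \<Rightarrow> bool" where
  "weighted_digraph V w \<longleftrightarrow> finite V \<and> (\<forall>x\<in>V. \<forall>y\<in>V. 0 \<le> w x y)"

text \<open>The path \<open>(x\<^sub>0, \<dots>, x\<^sub>k)\<close> is a list with \<open>k + 1\<close> entries; its final vertex is \<^const>\<open>last\<close>.\<close>

definition finite_paths :: "'a set \<Rightarrow> ('a \<Rightarrow> 'a \<Rightarrow> real) \<Rightarrow> 'a \<Rightarrow> 'a list set" where
  "finite_paths V w x =
     {u. u \<noteq> [] \<and> hd u = x \<and> set u \<subseteq> V \<and> successively (\<lambda>y z. 0 < w y z) u}"

definition path_length :: "'a list \<Rightarrow> nat" where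
  "path_length u = length u - 1"

definition path_weight :: "('a \<Rightarrow> 'a \<Rightarrow> real) \<Rightarrow> 'a list \<Rightarrow> real" where
  "path_weight w u = (\<Prod>i<path_length u. w (u ! i) (u ! Suc i))"

definition infinite_paths :: "'a set \<Rightarrow> ('a \<Rightarrow> 'a \<Rightarrow> real) \<Rightarrow> 'a \<Rightarrow> (nat \<Rightarrow> 'a) set" where
  "infinite_paths V w x = {\<omega>. \<omega> 0 = x \<and> (\<forall>i. \<omega> i \<in> V \<and> 0 < w (\<omega> i) (\<omega> (Suc i)))}"

definition cylinder :: "'a set \<Rightarrow> ('a \<Rightarrow> 'a \<Rightarrow> real) \<Rightarrow> 'a \<Rightarrow> 'a list \<Rightarrow> (nat \<Rightarrow> 'a) set" where
  "cylinder V w x u = {\<omega> \<in> infinite_paths V w x. \<forall>i<length u. \<omega> i = u ! i}"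


section \<open>Adjacency matrix, spectral radius and residual matrix\<close>

text \<open>
  Matrices are indexed by \<open>0, \<dots>, card V - 1\<close> through the fixed enumeration \<^term>\<open>from_nat_into V\<close>
  of \<open>V\<close>, whose inverse is \<^term>\<open>to_nat_on V\<close>.
\<close>

definition adjacency_matrix :: "'a set \<Rightarrow> ('a \<Rightarrow> 'a \<Rightarrow> real) \<Rightarrow> real Matrix.mat" where
  "adjacency_matrix V w =
     Matrix.mat (card V) (card V) (\<lambda>(i, j). w (from_nat_into V i) (from_nat_into V j))"

definition digraph_radius :: "'a set \<Rightarrow> ('a \<Rightarrow> 'a \<Rightarrow> real) \<Rightarrow> real" where
  "digraph_radius V w = spectral_radius (map_mat complex_of_real (adjacency_matrix V w))"

definition path_series :: "'a set \<Rightarrow> ('a \<Rightarrow> 'a \<Rightarrow> real) \<Rightarrow> real \<Rightarrow> real Matrix.mat" where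
  "path_series V w s = Matrix.mat (card V) (card V)
     (\<lambda>ij. \<Sum>k. (adjacency_matrix V w ^\<^sub>m k) $$ ij * s ^ k)"

definition is_residual_matrix :: "'a set \<Rightarrow> ('a \<Rightarrow> 'a \<Rightarrow> real) \<Rightarrow> real Matrix.mat \<Rightarrow> bool" where
  "is_residual_matrix V w \<Theta> \<longleftrightarrow>
     \<Theta> \<in> carrier_mat (card V) (card V) \<and>
     \<Theta> \<noteq> 0\<^sub>m (card V) (card V) \<and>
     (\<forall>i<card V. \<forall>j<card V. 0 \<le> \<Theta> $$ (i, j)) \<and>
     (\<exists>h::nat. 0 < h \<and>
       (\<forall>i<card V. \<forall>j<card V.
         ((\<lambda>s. (1 - digraph_radius V w * s) ^ h * path_series V w s $$ (i, j)) \<longlongrightarrow> \<Theta> $$ (i, j))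
           (at (1 / digraph_radius V w) within {0<..<1 / digraph_radius V w})))"

text \<open>\<open>[\<Theta> \<cdot> 1]\<^sub>x\<close>\<close>

definition row_total :: "'a set \<Rightarrow> real Matrix.mat \<Rightarrow> 'a \<Rightarrow> real" where
  "row_total V \<Theta> x = vec_index (\<Theta> *\<^sub>v Matrix.vec (card V) (\<lambda>_. 1)) (to_nat_on V x)"


section \<open>Access classes, dominant chains and the spanned umbrella digraph\<close>

definition accessible :: "'a set \<Rightarrow> ('a \<Rightarrow> 'a \<Rightarrow> real) \<Rightarrow> 'a \<Rightarrow> 'a \<Rightarrow> bool" where
  "accessible V w x y \<longleftrightarrow> (\<exists>u\<in>finite_paths V w x. last u = y)"

definition access_classes :: "'a set \<Rightarrow> ('a \<Rightarrow> 'a \<Rightarrow> real) \<Rightarrow> 'a set set" where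
  "access_classes V w = V // {(x, y). accessible V w x y \<and> accessible V w y x}"

definition class_access :: "'a set \<Rightarrow> ('a \<Rightarrow> 'a \<Rightarrow> real) \<Rightarrow> 'a set \<Rightarrow> 'a set \<Rightarrow> bool" where
  "class_access V w C D \<longleftrightarrow> (\<exists>x\<in>C. \<exists>y\<in>D. accessible V w x y)"

definition basic_classes :: "'a set \<Rightarrow> ('a \<Rightarrow> 'a \<Rightarrow> real) \<Rightarrow> 'a set set" where
  "basic_classes V w = {C \<in> access_classes V w. digraph_radius C w = digraph_radius V w}"

definition basic_chain :: "'a set \<Rightarrow> ('a \<Rightarrow> 'a \<Rightarrow> real) \<Rightarrow> 'a set list \<Rightarrow> bool" where
  "basic_chain V w Ls \<longleftrightarrow>
     Ls \<noteq> [] \<and> distinct Ls \<and> set Ls \<subseteq> basic_classes V w \<and> successively (class_access V w) Ls"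

definition dominant_chain :: "'a set \<Rightarrow> ('a \<Rightarrow> 'a \<Rightarrow> real) \<Rightarrow> 'a set list \<Rightarrow> bool" where
  "dominant_chain V w Ls \<longleftrightarrow>
     basic_chain V w Ls \<and> (\<forall>Ms. basic_chain V w Ms \<longrightarrow> length Ms \<le> length Ls)"

definition accessible_from :: "'a set \<Rightarrow> ('a \<Rightarrow> 'a \<Rightarrow> real) \<Rightarrow> 'a \<Rightarrow> 'a set" where
  "accessible_from V w x = {y \<in> V. accessible V w x y}"

definition spanned_umbrella :: "'a set \<Rightarrow> ('a \<Rightarrow> 'a \<Rightarrow> real) \<Rightarrow> 'a \<Rightarrow> 'a set" where
  "spanned_umbrella V w x =
     {y \<in> accessible_from V w x.
        \<exists>Ls. dominant_chain (accessible_from V w x) w Ls \<and>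
             (\<exists>z\<in>hd Ls. accessible (accessible_from V w x) w y z)}"


section \<open>Path spaces and weak convergence\<close>

definition borel_of :: "'b topology \<Rightarrow> 'b measure" where
  "borel_of X = sigma (topspace X) {A. openin X A}"

text \<open>Finite paths are padded with the extra symbol \<^const>\<open>None\<close>.\<close>

definition pad_path :: "'a list \<Rightarrow> nat \<Rightarrow> 'a option" where
  "pad_path u i = (if i < length u then Some (u ! i) else None)"

definition embed_path :: "(nat \<Rightarrow> 'a) \<Rightarrow> nat \<Rightarrow> 'a option" where
  "embed_path \<omega> i = Some (\<omega> i)"

definition infinite_path_topology ::
    "'a set \<Rightarrow> ('a \<Rightarrow> 'a \<Rightarrow> real) \<Rightarrow> 'a \<Rightarrow> (nat \<Rightarrow> 'a) topology" where
  "infinite_path_topology V w x =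
     subtopology (product_topology (\<lambda>_. discrete_topology V) UNIV) (infinite_paths V w x)"

definition path_topology ::
    "'a set \<Rightarrow> ('a \<Rightarrow> 'a \<Rightarrow> real) \<Rightarrow> 'a \<Rightarrow> (nat \<Rightarrow> 'a option) topology" where
  "path_topology V w x =
     subtopology (product_topology (\<lambda>_. discrete_topology (insert None (Some ` V))) UNIV)
       (pad_path ` finite_paths V w x \<union> embed_path ` infinite_paths V w x)"

definition borel_prob_on :: "'b topology \<Rightarrow> 'b measure \<Rightarrow> bool" where
  "borel_prob_on X M \<longleftrightarrow> prob_space M \<and> space M = topspace X \<and> sets M = sets (borel_of X)"

definition weakly_converges ::
    "'b topology \<Rightarrow> ('i \<Rightarrow> 'b measure) \<Rightarrow> 'b measure \<Rightarrow> 'i filter \<Rightarrow> bool" where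
  "weakly_converges X M N F \<longleftrightarrow>
     (\<forall>\<^sub>F s in F. borel_prob_on X (M s)) \<and> borel_prob_on X N \<and>
     (\<forall>f. continuous_map X euclideanreal f \<and> bounded (f ` topspace X) \<longrightarrow>
        ((\<lambda>s. \<integral>\<omega>. f \<omega> \<partial>M s) \<longlongrightarrow> (\<integral>\<omega>. f \<omega> \<partial>N)) F)"

definition on_all_paths ::
    "'a set \<Rightarrow> ('a \<Rightarrow> 'a \<Rightarrow> real) \<Rightarrow> 'a \<Rightarrow> (nat \<Rightarrow> 'a) measure \<Rightarrow> (nat \<Rightarrow> 'a option) measure" where
  "on_all_paths V w x M = distr M (borel_of (path_topology V w x)) embed_path"


section \<open>Boltzmann distributions and cocycle measures\<close>

definition boltzmann_partition :: "'a set \<Rightarrow> ('a \<Rightarrow> 'a \<Rightarrow> real) \<Rightarrow> 'a \<Rightarrow> real \<Rightarrow> real" where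
  "boltzmann_partition V w x s =
     (\<Sum>\<^sub>\<infinity>u\<in>finite_paths V w x. path_weight w u * s ^ path_length u)"

definition boltzmann ::
    "'a set \<Rightarrow> ('a \<Rightarrow> 'a \<Rightarrow> real) \<Rightarrow> 'a \<Rightarrow> real \<Rightarrow> (nat \<Rightarrow> 'a option) measure" where
  "boltzmann V w x s =
     distr
       (density (count_space (finite_paths V w x))
         (\<lambda>u. ennreal (path_weight w u * s ^ path_length u / boltzmann_partition V w x s)))
       (borel_of (path_topology V w x)) pad_path"

text \<open>Only the values \<open>\<Gamma> x y\<close> with \<open>y\<close> accessible from \<open>x\<close> are relevant.\<close>

definition cocycle :: "'a set \<Rightarrow> ('a \<Rightarrow> 'a \<Rightarrow> real) \<Rightarrow> ('a \<Rightarrow> 'a \<Rightarrow> real) \<Rightarrow> bool" where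
  "cocycle V w \<Gamma> \<longleftrightarrow>
     (\<forall>x y. accessible V w x y \<longrightarrow> 0 \<le> \<Gamma> x y) \<and>
     (\<forall>x y z. accessible V w x y \<and> accessible V w y z \<longrightarrow> \<Gamma> x z = \<Gamma> x y * \<Gamma> y z)"

definition cocycle_measure ::
    "'a set \<Rightarrow> ('a \<Rightarrow> 'a \<Rightarrow> real) \<Rightarrow> real \<Rightarrow> ('a \<Rightarrow> 'a \<Rightarrow> real) \<Rightarrow> ('a \<Rightarrow> (nat \<Rightarrow> 'a) measure) \<Rightarrow> bool"
  where
  "cocycle_measure V w r \<Gamma> \<mu> \<longleftrightarrow>
     0 < r \<and> cocycle V w \<Gamma> \<and>
     (\<forall>x\<in>V. borel_prob_on (infinite_path_topology V w x) (\<mu> x) \<and>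
        (\<forall>u\<in>finite_paths V w x.
           measure (\<mu> x) (cylinder V w x u) = inverse r ^ path_length u * path_weight w u * \<Gamma> x (last u)))"

definition complete_cocycle_measure ::
    "'a set \<Rightarrow> ('a \<Rightarrow> 'a \<Rightarrow> real) \<Rightarrow> real \<Rightarrow> ('a \<Rightarrow> 'a \<Rightarrow> real) \<Rightarrow> ('a \<Rightarrow> (nat \<Rightarrow> 'a) measure) \<Rightarrow> bool"
  where
  "complete_cocycle_measure V w r \<Gamma> \<mu> \<longleftrightarrow>
     cocycle_measure V w r \<Gamma> \<mu> \<and> (\<forall>x y. accessible V w x y \<longrightarrow> 0 < \<Gamma> x y)"

definition cocycle_kernel ::
    "('a \<Rightarrow> 'a \<Rightarrow> real) \<Rightarrow> real \<Rightarrow> ('a \<Rightarrow> 'a \<Rightarrow> real) \<Rightarrow> 'a \<Rightarrow> 'a \<Rightarrow> real" where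
  "cocycle_kernel w r \<Gamma> x y = inverse r * w x y * \<Gamma> x y"

end

theory Submission
  imports Defs
begin

text \<open>
  Let \<open>G\<^sub>x(s)\<close> be the generating function of the weights of the paths from \<open>x\<close>.  On an access class \<open>C\<close> of
  spectral radius \<open>r\<close>, pairing \<open>G = 1 + s F G\<close> with the positive left eigenvector of the block of \<open>C\<close> shows
  that \<open>(1 - r s) G\<close> is comparable on \<open>C\<close> with \<open>1\<close> plus the values of \<open>G\<close> at the exits of \<open>C\<close>.  Hence
  \<open>G\<^sub>x(s)\<close> grows like \<open>(1 - \<rho> s)\<close> to the power \<open>- n\<close>, where \<open>n\<close> is the maximal length of a chain of basic
  classes reached from \<open>x\<close>, and \<open>g = \<Theta> \<cdot> 1\<close> is positive exactly on the umbrella of \<open>x\<^sub>0\<close>.  As \<open>F g = \<rho> g\<close>, the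
  kernel \<open>q\<close> is stochastic there.  The Boltzmann mass of a cylinder with prefix \<open>u\<close> from \<open>x\<close> to \<open>y\<close>, of length
  \<open>k\<close>, is \<open>w(u) s\<^sup>k G\<^sub>y(s) / G\<^sub>x(s)\<close>, which tends to the mass that the cocycle measure gives to it; a single finite
  path has mass tending to \<open>0\<close>.  Convergence on all cells of the path space is weak convergence.
\<close>

section \<open>Transfer operator and adjacency matrix\<close>

text \<open>The limits of \<open>(1 - \<rho> s)^h G\<close> are given with the residual matrix, so
  bounds on \<open>G\<close> up to constants suffice to decide where such a limit vanishes. The
  order \<open>h\<close> is only asserted to exist; it is pinned down as the maximal chain length
  because smaller growth would make every limit zero and larger growth would leave no finite limit.
  The same comparison yields that a basic class exists at all. The lower bound must compare the
  values of \<open>G\<close> at different vertices of a class, which costs a factor \<open>s\<close>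
  per edge; hence \<open>s\<close> is kept above \<open>1/(2 \<rho>)\<close> there. The positive
  left eigenvector is built from the moduli of a complex one: the triangle inequality gives a
  subinvariant vector, and irreducibility turns it into a positive eigenvector. The limit lives on
  the umbrella alone because the set where \<open>g > 0\<close> is closed under predecessors: a path
  that ends in it never left it, and a path that ends outside has limit mass zero.\<close>

definition transfer :: "'a set \<Rightarrow> ('a \<Rightarrow> 'a \<Rightarrow> real) \<Rightarrow> ('a \<Rightarrow> real) \<Rightarrow> 'a \<Rightarrow> real" where
  "transfer V w f x = (\<Sum>y\<in>V. w x y * f y)"

text \<open>This is \<open>[F^k 1]_x\<close>; \<open>paths_of_length\<close> identifies it with the
  total weight of the paths of length \<open>k\<close> from \<open>x\<close>.\<close>

definition path_total :: "'a set \<Rightarrow> ('a \<Rightarrow> 'a \<Rightarrow> real) \<Rightarrow> nat \<Rightarrow> 'a \<Rightarrow> real" where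
  "path_total V w k = (transfer V w ^^ k) (\<lambda>_. 1)"

text \<open>The row sum \<open>[H(s) 1]_x\<close>. Convergence is established when \<open>s\<close>
  times the radius is below 1; where the series diverges, \<open>suminf\<close> carries no
  information.\<close>

definition path_gf :: "'a set \<Rightarrow> ('a \<Rightarrow> 'a \<Rightarrow> real) \<Rightarrow> real \<Rightarrow> 'a \<Rightarrow> real" where
  "path_gf V w s x = (\<Sum>k. path_total V w k x * s ^ k)"

lemma path_total_0 [simp]: "path_total V w 0 x = 1"
  by (simp add: path_total_def)

lemma path_total_Suc: "path_total V w (Suc k) x = (\<Sum>y\<in>V. w x y * path_total V w k y)"
  by (simp add: path_total_def transfer_def)

lemma path_total_nonneg:
  assumes "weighted_digraph V w" "x \<in> V"
  shows "0 \<le> path_total V w k x"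
  using assms(2)
proof (induction k arbitrary: x)
  case (Suc k)
  then show ?case
    using assms(1) by (auto simp: path_total_Suc weighted_digraph_def intro!: sum_nonneg)
qed simp

lemma from_nat_into_mem: "finite V \<Longrightarrow> i < card V \<Longrightarrow> from_nat_into V i \<in> V"
  by (metis card.empty from_nat_into less_nat_zero_code)

lemma to_nat_on_from_nat_into_card:
  "finite V \<Longrightarrow> i < card V \<Longrightarrow> to_nat_on V (from_nat_into V i) = i"
  using to_nat_on_finite[of V] by (simp add: bij_betw_def)

lemma vertex_index:
  assumes "finite V" "x \<in> V"
  obtains i where "i < card V" "x = from_nat_into V i"
  using bij_betw_from_nat_into_finite[OF assms(1)] assms(2) by (auto simp: bij_betw_def)

lemma sum_from_nat_into:
  "finite V \<Longrightarrow> (\<Sum>i<card V. f (from_nat_into V i)) = (\<Sum>x\<in>V. f x)"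
  by (rule sum.reindex_bij_betw[OF bij_betw_from_nat_into_finite])

lemma adjacency_matrix_carrier: "adjacency_matrix V w \<in> carrier_mat (card V) (card V)"
  by (simp add: adjacency_matrix_def)

text \<open>Carries matrix powers over to functions on vertices, so that the enumeration of
  \<open>V\<close> stays confined to a few lemmas. The function \<open>f\<close> is generalised
  because \<open>F^(k+1) f\<close> is computed as \<open>F^k (F f)\<close>.\<close>

lemma adjacency_power_mult_vec:
  assumes "finite V"
  shows "adjacency_matrix V w ^\<^sub>m k *\<^sub>v Matrix.vec (card V) (\<lambda>i. f (from_nat_into V i))
    = Matrix.vec (card V) (\<lambda>i. (transfer V w ^^ k) f (from_nat_into V i))"
proof (induction k arbitrary: f)
  case 0
  then show ?case by (simp add: adjacency_matrix_def)
next
  case (Suc k)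
  let ?A = "adjacency_matrix V w" and ?n = "card V"
  have 1: "?A *\<^sub>v Matrix.vec ?n (\<lambda>i. f (from_nat_into V i))
      = Matrix.vec ?n (\<lambda>i. transfer V w f (from_nat_into V i))"
    by (rule eq_vecI)
       (auto simp: adjacency_matrix_def transfer_def scalar_prod_def atLeast0LessThan
          sum_from_nat_into[OF assms, symmetric])
  have "?A ^\<^sub>m Suc k *\<^sub>v Matrix.vec ?n (\<lambda>i. f (from_nat_into V i))
      = ?A ^\<^sub>m k *\<^sub>v (?A *\<^sub>v Matrix.vec ?n (\<lambda>i. f (from_nat_into V i)))"
    unfolding pow_mat.simps
    by (rule assoc_mult_mat_vec[where ?n\<^sub>1.0 = ?n and ?n\<^sub>2.0 = ?n and ?n\<^sub>3.0 = ?n])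
       (auto simp: adjacency_matrix_def)
  also have "\<dots> = Matrix.vec ?n (\<lambda>i. (transfer V w ^^ k) (transfer V w f) (from_nat_into V i))"
    by (simp add: 1 Suc)
  finally show ?case by (simp add: funpow_swap1)
qed

lemma adjacency_power_row_sum:
  assumes "finite V" "i < card V"
  shows "(transfer V w ^^ k) f (from_nat_into V i)
    = (\<Sum>j<card V. (adjacency_matrix V w ^\<^sub>m k) $$ (i, j) * f (from_nat_into V j))"
proof -
  have "(transfer V w ^^ k) f (from_nat_into V i)
      = vec_index (adjacency_matrix V w ^\<^sub>m k *\<^sub>v
          Matrix.vec (card V) (\<lambda>i. f (from_nat_into V i))) i"
    using assms by (simp add: adjacency_power_mult_vec)
  also have "\<dots> = (\<Sum>j<card V. (adjacency_matrix V w ^\<^sub>m k) $$ (i, j) * f (from_nat_into V j))"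
    using assms adjacency_matrix_carrier[of V w]
    by (simp add: scalar_prod_def atLeast0LessThan)
  finally show ?thesis .
qed

section \<open>Eigenvalues of maximal modulus and convergence of the path series\<close>

lemma digraph_radius_attained:
  assumes "finite V" "V \<noteq> {}"
  shows "\<exists>ev. eigenvalue (map_mat complex_of_real (adjacency_matrix V w)) ev
    \<and> norm ev = digraph_radius V w"
proof -
  have "map_mat complex_of_real (adjacency_matrix V w) \<in> carrier_mat (card V) (card V)"
    by (simp add: adjacency_matrix_def)
  moreover have "card V > 0" using assms by (simp add: card_gt_0_iff)
  ultimately have "digraph_radius V w \<in> norm ` spectrum (map_mat complex_of_real (adjacency_matrix V w))"
    unfolding digraph_radius_def by (rule spectral_radius_mem_max)
  then show ?thesis by (auto simp: spectrum_def)
qed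

lemma digraph_radius_nonneg:
  "finite V \<Longrightarrow> V \<noteq> {} \<Longrightarrow> 0 \<le> digraph_radius V w"
  using digraph_radius_attained[of V w] norm_ge_zero by metis

text \<open>Take an eigenvector of the transpose for an eigenvalue of maximal modulus; the transpose
  has the same characteristic polynomial, hence the same eigenvalues. Taking moduli coordinatewise
  turns the eigenvector equation into an inequality by the triangle inequality.\<close>

lemma left_subinvariant_vector:
  assumes "weighted_digraph V w" "V \<noteq> {}"
  shows "\<exists>q. (\<forall>x\<in>V. 0 \<le> q x) \<and> (\<exists>x\<in>V. 0 < q x)
    \<and> (\<forall>y\<in>V. digraph_radius V w * q y \<le> (\<Sum>x\<in>V. q x * w x y))"
proof -
  have fin: "finite V" and w0: "\<And>x y. x \<in> V \<Longrightarrow> y \<in> V \<Longrightarrow> 0 \<le> w x y"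
    using assms by (auto simp: weighted_digraph_def)
  let ?n = "card V"
  let ?A = "map_mat complex_of_real (adjacency_matrix V w)"
  obtain ev where ev: "eigenvalue ?A ev" "norm ev = digraph_radius V w"
    using digraph_radius_attained[OF fin assms(2)] by blast
  have A: "?A \<in> carrier_mat ?n ?n" by (simp add: adjacency_matrix_def)
  have "eigenvalue (transpose_mat ?A) ev"
    using ev(1) A by (simp add: eigenvalue_root_char_poly[of _ ?n])
  then obtain v where v: "eigenvector (transpose_mat ?A) v ev"
    by (auto simp: eigenvalue_def)
  have vc: "v \<in> carrier_vec ?n" "v \<noteq> 0\<^sub>v ?n" "transpose_mat ?A *\<^sub>v v = ev \<cdot>\<^sub>v v"
    using v by (auto simp: eigenvector_def adjacency_matrix_def)
  define q where "q x = norm (vec_index v (to_nat_on V x))" for x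
  have q: "norm (vec_index v i) = q (from_nat_into V i)" if "i < ?n" for i
    using that fin by (simp add: q_def to_nat_on_from_nat_into_card)
  have "\<exists>i<?n. vec_index v i \<noteq> 0"
    using vc(1,2) by (metis carrier_vecD eq_vecI index_zero_vec)
  then have pos: "\<exists>x\<in>V. 0 < q x"
    using q from_nat_into_mem[OF fin] by (metis zero_less_norm_iff)
  have "digraph_radius V w * q y \<le> (\<Sum>x\<in>V. q x * w x y)" if "y \<in> V" for y
  proof -
    obtain j where j: "j < ?n" "y = from_nat_into V j"
      using vertex_index[OF fin \<open>y \<in> V\<close>] .
    have "ev * vec_index v j = (\<Sum>i<?n. complex_of_real (w (from_nat_into V i) y) * vec_index v i)"
      using arg_cong[OF vc(3), of "\<lambda>u. vec_index u j"] j vc(1)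
      by (simp add: scalar_prod_def atLeast0LessThan adjacency_matrix_def)
    then have "norm (ev * vec_index v j)
        \<le> (\<Sum>i<?n. norm (complex_of_real (w (from_nat_into V i) y) * vec_index v i))"
      by (metis norm_sum)
    also have "\<dots> = (\<Sum>i<?n. q (from_nat_into V i) * w (from_nat_into V i) y)"
      using w0 that fin by (intro sum.cong) (auto simp: norm_mult q from_nat_into_mem)
    also have "\<dots> = (\<Sum>x\<in>V. q x * w x y)"
      by (rule sum_from_nat_into[OF fin])
    finally show ?thesis using ev(2) q j by (simp add: norm_mult)
  qed
  then show ?thesis using pos by (intro exI[of _ q]) (auto simp: q_def)
qed

lemma transfer_power_scale:
  "(transfer V (\<lambda>x y. t * w x y) ^^ k) f x = t ^ k * (transfer V w ^^ k) f x"
  by (induction k arbitrary: x)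
     (auto simp: transfer_def sum_distrib_left ac_simps)

lemma adjacency_power_complex:
  "map_mat complex_of_real (adjacency_matrix V w ^\<^sub>m k)
    = map_mat complex_of_real (adjacency_matrix V w) ^\<^sub>m k"
  by (rule of_real_hom.mat_hom_pow[OF adjacency_matrix_carrier])

text \<open>An eigenvector of \<open>t F\<close> for \<open>ev\<close> is an eigenvector of
  \<open>F\<close> for \<open>ev / t\<close>. This permits rescaling the weights until the radius
  drops below 1, where matrix powers stay bounded.\<close>

lemma digraph_radius_scale:
  assumes "finite V" "V \<noteq> {}" "0 < t"
  shows "digraph_radius V (\<lambda>x y. t * w x y) \<le> t * digraph_radius V w"
proof -
  let ?n = "card V"
  let ?A = "map_mat complex_of_real (adjacency_matrix V w)"
  let ?B = "map_mat complex_of_real (adjacency_matrix V (\<lambda>x y. t * w x y))"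
  have A: "?A \<in> carrier_mat ?n ?n" by (simp add: adjacency_matrix_def)
  have n: "?n > 0" using assms by (simp add: card_gt_0_iff)
  have B: "?B = complex_of_real t \<cdot>\<^sub>m ?A"
    by (rule eq_matI) (auto simp: adjacency_matrix_def)
  obtain ev where ev: "eigenvalue ?B ev" "norm ev = digraph_radius V (\<lambda>x y. t * w x y)"
    using digraph_radius_attained[OF assms(1,2)] by blast
  obtain v where v: "eigenvector ?B v ev" using ev(1) by (auto simp: eigenvalue_def)
  then have vc: "v \<in> carrier_vec ?n" "v \<noteq> 0\<^sub>v ?n" "?B *\<^sub>v v = ev \<cdot>\<^sub>v v"
    by (auto simp: eigenvector_def adjacency_matrix_def)
  have "vec_index (?A *\<^sub>v v) i = vec_index ((ev / t) \<cdot>\<^sub>v v) i" if i: "i < ?n" for i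
  proof -
    have "complex_of_real t * vec_index (?A *\<^sub>v v) i = vec_index (?B *\<^sub>v v) i"
      unfolding B using i A vc(1) by simp
    then show ?thesis using i vc assms(3) by (simp add: field_simps)
  qed
  then have "?A *\<^sub>v v = (ev / t) \<cdot>\<^sub>v v"
    using A vc(1) by (intro eq_vecI) auto
  then have "eigenvalue ?A (ev / t)"
    using vc A by (auto simp: eigenvalue_def eigenvector_def)
  then have "norm (ev / t) \<le> digraph_radius V w"
    unfolding digraph_radius_def by (intro spectral_radius_mem_max(2)[OF A n]) (auto simp: spectrum_def)
  then show ?thesis using ev(2) assms(3) by (simp add: norm_divide field_simps)
qed

text \<open>The factor \<open>t^k\<close> is absorbed into the weights; the scaled matrix has radius
  below 1, so the entries of its powers have a common bound.\<close>

lemma transfer_power_bound: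
  assumes "finite V" "V \<noteq> {}" "0 < t" "t * digraph_radius V w < 1"
  shows "\<exists>c. \<forall>k. \<forall>x\<in>V. \<bar>t ^ k * (transfer V w ^^ k) f x\<bar> \<le> c"
proof -
  let ?n = "card V" and ?w = "\<lambda>x y. t * w x y"
  have "digraph_radius V ?w < 1"
    using digraph_radius_scale[OF assms(1-3), of w] assms(4) by linarith
  then obtain c where c: "\<And>k. norm_bound (map_mat complex_of_real (adjacency_matrix V ?w) ^\<^sub>m k) c"
    using spectral_radius_jnf_norm_bound_less_1_upper_triangular
      [of "map_mat complex_of_real (adjacency_matrix V ?w)" ?n]
    by (auto simp: digraph_radius_def adjacency_matrix_def)
  have c': "\<bar>(adjacency_matrix V ?w ^\<^sub>m k) $$ (i, j)\<bar> \<le> c" if "i < ?n" "j < ?n" for i j k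
    using c[of k] that adjacency_matrix_carrier[of V ?w]
    unfolding adjacency_power_complex[symmetric] norm_bound_def by auto
  have "\<bar>t ^ k * (transfer V w ^^ k) f x\<bar> \<le> (\<Sum>j<?n. c * \<bar>f (from_nat_into V j)\<bar>)" if "x \<in> V" for k x
  proof -
    obtain i where i: "i < ?n" "x = from_nat_into V i"
      using vertex_index[OF assms(1) \<open>x \<in> V\<close>] .
    have "t ^ k * (transfer V w ^^ k) f x = (transfer V ?w ^^ k) f x"
      by (simp add: transfer_power_scale)
    also have "\<bar>\<dots>\<bar> \<le> (\<Sum>j<?n. \<bar>(adjacency_matrix V ?w ^\<^sub>m k) $$ (i, j) * f (from_nat_into V j)\<bar>)"
      unfolding i(2) adjacency_power_row_sum[OF assms(1) i(1)] by (rule sum_abs)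
    also have "\<dots> \<le> (\<Sum>j<?n. c * \<bar>f (from_nat_into V j)\<bar>)"
      using c' i by (intro sum_mono) (auto simp: abs_mult intro!: mult_right_mono)
    finally show ?thesis by simp
  qed
  then show ?thesis by blast
qed

lemma transfer_power_summable:
  assumes "finite V" "x \<in> V" "0 \<le> s" "s * digraph_radius V w < 1"
  shows "summable (\<lambda>k. (transfer V w ^^ k) f x * s ^ k)"
proof -
  have ne: "V \<noteq> {}" using assms(2) by auto
  define r where "r = digraph_radius V w"
  have r: "0 \<le> r" using digraph_radius_nonneg[OF assms(1) ne] by (simp add: r_def)
  \<comment> \<open>The room between \<open>s\<close> and \<open>t\<close> gives the geometric
    majorant of ratio \<open>s / t\<close>. For radius 0 every \<open>t > s\<close> is allowed, but
    \<open>1 / r\<close> would be 0, so this case is separate.\<close>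
  obtain t where t: "s < t" "t * r < 1"
  proof (cases "r = 0")
    case True
    then show ?thesis using that[of "s + 1"] by simp
  next
    case False
    then have "s < 1 / r" using assms(4) r by (simp add: field_simps r_def)
    then obtain t where "s < t" "t < 1 / r" using dense by blast
    then show ?thesis using that[of t] False r by (simp add: field_simps)
  qed
  obtain c where c: "\<And>k. \<bar>t ^ k * (transfer V w ^^ k) f x\<bar> \<le> c"
    using transfer_power_bound[OF assms(1) ne, of t w f] t assms(2,3) by (auto simp: r_def)
  show ?thesis
  proof (rule summable_comparison_test')
    show "summable (\<lambda>k. c * (s / t) ^ k)"
      using t assms(3) by (intro summable_mult summable_geometric) auto
    show "norm ((transfer V w ^^ k) f x * s ^ k) \<le> c * (s / t) ^ k" for k
    proof -
      have "norm ((transfer V w ^^ k) f x * s ^ k) = \<bar>t ^ k * (transfer V w ^^ k) f x\<bar> * (s / t) ^ k"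
        using t assms(3) by (simp add: abs_mult power_divide)
      also have "\<dots> \<le> c * (s / t) ^ k"
        using c t assms(3) by (intro mult_right_mono) auto
      finally show ?thesis .
    qed
  qed
qed

lemma path_total_summable:
  "finite V \<Longrightarrow> x \<in> V \<Longrightarrow> 0 \<le> s \<Longrightarrow> s * digraph_radius V w < 1
    \<Longrightarrow> summable (\<lambda>k. path_total V w k x * s ^ k)"
  unfolding path_total_def by (rule transfer_power_summable)

text \<open>A path is a single vertex or an edge followed by a path: the term \<open>k = 0\<close>
  is split off and the series is exchanged with the finite sum over \<open>V\<close>.\<close>

lemma path_gf_eq:
  assumes "finite V" "x \<in> V" "0 \<le> s" "s * digraph_radius V w < 1"
  shows "path_gf V w s x = 1 + s * (\<Sum>y\<in>V. w x y * path_gf V w s y)"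
proof -
  have sm: "summable (\<lambda>k. path_total V w k y * s ^ k)" if "y \<in> V" for y
    using path_total_summable[OF assms(1) that assms(3,4)] .
  have "path_gf V w s x = 1 + (\<Sum>k. path_total V w (Suc k) x * s ^ Suc k)"
    using suminf_split_head[OF sm[OF assms(2)]] by (simp add: path_gf_def)
  also have "(\<lambda>k. path_total V w (Suc k) x * s ^ Suc k)
      = (\<lambda>k. s * (\<Sum>y\<in>V. w x y * (path_total V w k y * s ^ k)))"
    by (auto simp: path_total_Suc sum_distrib_left sum_distrib_right ac_simps)
  also have "(\<Sum>k. s * (\<Sum>y\<in>V. w x y * (path_total V w k y * s ^ k)))
      = s * (\<Sum>y\<in>V. w x y * path_gf V w s y)"
    using sm by (subst suminf_mult) (auto simp: path_gf_def suminf_sum suminf_mult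
        intro!: summable_sum summable_mult)
  finally show ?thesis .
qed

lemma path_gf_ge_1:
  assumes "weighted_digraph V w" "x \<in> V" "0 \<le> s" "s * digraph_radius V w < 1"
  shows "1 \<le> path_gf V w s x"
proof -
  have "(\<Sum>k<1. path_total V w k x * s ^ k) \<le> path_gf V w s x"
    unfolding path_gf_def using assms path_total_nonneg[OF assms(1,2)]
    by (intro sum_le_suminf path_total_summable) (auto simp: weighted_digraph_def)
  then show ?thesis by simp
qed

text \<open>Multiplying \<open>\<Theta>\<close> by the column of ones sums the entrywise limits
  along a row. The point is the exchange of the sum over columns with the series in
  \<open>k\<close>, for which each entry series is shown to converge.\<close>

lemma residual_row_total_tendsto:
  assumes "finite V" "0 < digraph_radius V w" "is_residual_matrix V w \<Theta>"
  shows "\<exists>h>0. \<forall>x\<in>V. ((\<lambda>s. (1 - digraph_radius V w * s) ^ h * path_gf V w s x) \<longlongrightarrow> row_total V \<Theta> x)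
    (at (1 / digraph_radius V w) within {0<..<1 / digraph_radius V w})"
proof -
  define r where "r = digraph_radius V w"
  let ?n = "card V" and ?F = "at (1 / r) within {0<..<1 / r}"
  have r: "0 < r" using assms by (simp add: r_def)
  obtain h where h: "0 < h" and lim: "\<And>i j. i < ?n \<Longrightarrow> j < ?n \<Longrightarrow>
      ((\<lambda>s. (1 - r * s) ^ h * path_series V w s $$ (i, j)) \<longlongrightarrow> \<Theta> $$ (i, j)) ?F"
    and \<Theta>: "\<Theta> \<in> carrier_mat ?n ?n"
    using assms(3) unfolding is_residual_matrix_def r_def by blast
  have "((\<lambda>s. (1 - r * s) ^ h * path_gf V w s x) \<longlongrightarrow> row_total V \<Theta> x) ?F" if x: "x \<in> V" for x
  proof -
    obtain i where i: "i < ?n" "x = from_nat_into V i"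
      using vertex_index[OF assms(1) \<open>x \<in> V\<close>] .
    have idx: "to_nat_on V x = i" using i assms(1) by (simp add: to_nat_on_from_nat_into_card)
    have rt: "row_total V \<Theta> x = (\<Sum>j<?n. \<Theta> $$ (i, j))"
      using \<Theta> i(1) by (simp add: row_total_def idx scalar_prod_def atLeast0LessThan)
    have gf: "path_gf V w s x = (\<Sum>j<?n. path_series V w s $$ (i, j))" if s: "0 < s" "s < 1 / r" for s
    proof -
      have sr: "s * digraph_radius V w < 1" using s r by (simp add: r_def field_simps)
      \<comment> \<open>Column \<open>j\<close> of \<open>F^k\<close> is \<open>F^k\<close> applied
        to the indicator of vertex \<open>j\<close>, so the summability of transfer powers covers
        single entries.\<close>
      have sm: "summable (\<lambda>k. (adjacency_matrix V w ^\<^sub>m k) $$ (i, j) * s ^ k)" if "j < ?n" for j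
      proof -
        have "(transfer V w ^^ k) (\<lambda>z. if z = from_nat_into V j then 1 else 0) x
            = (adjacency_matrix V w ^\<^sub>m k) $$ (i, j)" for k
        proof -
          have "(transfer V w ^^ k) (\<lambda>z. if z = from_nat_into V j then 1 else 0) x
            = (\<Sum>l<?n. (adjacency_matrix V w ^\<^sub>m k) $$ (i, l) *
                (if from_nat_into V l = from_nat_into V j then 1 else 0))"
            unfolding i(2) using adjacency_power_row_sum[OF assms(1) i(1)] by blast
          also have "\<dots> = (\<Sum>l<?n. if l = j then (adjacency_matrix V w ^\<^sub>m k) $$ (i, l) else 0)"
            using that assms(1)
            by (intro sum.cong) (auto dest: arg_cong[of _ _ "to_nat_on V"] simp: to_nat_on_from_nat_into_card)
          finally show ?thesis using that by simp
        qed
        then show ?thesis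
          using transfer_power_summable[OF assms(1) x _ sr, of "\<lambda>z. if z = from_nat_into V j then 1 else 0"] s
          by simp
      qed
      have "path_gf V w s x = (\<Sum>k. \<Sum>j<?n. (adjacency_matrix V w ^\<^sub>m k) $$ (i, j) * s ^ k)"
        unfolding path_gf_def path_total_def i(2) adjacency_power_row_sum[OF assms(1) i(1)]
        by (simp add: sum_distrib_right)
      also have "\<dots> = (\<Sum>j<?n. path_series V w s $$ (i, j))"
        using sm i(1) by (subst suminf_sum) (auto simp: path_series_def)
      finally show ?thesis .
    qed
    have "((\<lambda>s. \<Sum>j<?n. (1 - r * s) ^ h * path_series V w s $$ (i, j)) \<longlongrightarrow> (\<Sum>j<?n. \<Theta> $$ (i, j))) ?F"
      using lim i(1) by (intro tendsto_sum) auto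
    moreover have "\<forall>\<^sub>F s in ?F. (\<Sum>j<?n. (1 - r * s) ^ h * path_series V w s $$ (i, j))
        = (1 - r * s) ^ h * path_gf V w s x"
      using gf by (auto simp: eventually_at_filter sum_distrib_left intro!: always_eventually)
    ultimately show ?thesis unfolding rt by (rule Lim_transform_eventually)
  qed
  then show ?thesis using h unfolding r_def by blast
qed

section \<open>Left Perron vectors\<close>

text \<open>Irreducibility as the absence of proper nonempty successor-closed subsets: the form in
  which it is applied to the support of a vector and to the set of strict inequalities.\<close>

definition irreducible_on :: "'a set \<Rightarrow> ('a \<Rightarrow> 'a \<Rightarrow> real) \<Rightarrow> bool" where
  "irreducible_on C w \<longleftrightarrow> C \<noteq> {} \<and>
    (\<forall>S\<subseteq>C. S \<noteq> {} \<and> (\<forall>x\<in>S. \<forall>y\<in>C. 0 < w x y \<longrightarrow> y \<in> S) \<longrightarrow> S = C)"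

text \<open>Pairing \<open>q\<close> with \<open>F^k 1\<close> and iterating the inequality shows
  growth at least like \<open>t^k\<close>. If \<open>t\<close> exceeded the radius, the series of
  \<open>F^k 1 / t^k\<close> would converge and its terms would tend to zero, which is incompatible
  with the positive total of \<open>q\<close>.\<close>

lemma left_subinvariant_growth_le_radius:
  assumes wd: "weighted_digraph C w"
    and q: "\<And>x. x \<in> C \<Longrightarrow> 0 \<le> q x" "a \<in> C" "0 < q a"
    and sub: "\<And>y. y \<in> C \<Longrightarrow> t * q y \<le> (\<Sum>x\<in>C. q x * w x y)"
  shows "t \<le> digraph_radius C w"
proof (rule ccontr)
  have fin: "finite C" using wd by (simp add: weighted_digraph_def)
  define r where "r = digraph_radius C w"
  have r0: "0 \<le> r" using digraph_radius_nonneg[OF fin] q(2) by (auto simp: r_def)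
  assume "\<not> t \<le> digraph_radius C w"
  then have t: "r < t" "0 < t" using r0 by (auto simp: r_def)
  let ?a = "path_total C w"
  have growth: "t ^ k * (\<Sum>x\<in>C. q x) \<le> (\<Sum>x\<in>C. q x * ?a k x)" for k
  proof (induction k)
    case (Suc k)
    have "t ^ Suc k * (\<Sum>x\<in>C. q x) \<le> t * (\<Sum>x\<in>C. q x * ?a k x)"
      using Suc t by simp
    also have "\<dots> = (\<Sum>y\<in>C. (t * q y) * ?a k y)"
      by (simp add: sum_distrib_left ac_simps)
    also have "\<dots> \<le> (\<Sum>y\<in>C. (\<Sum>x\<in>C. q x * w x y) * ?a k y)"
      using sub path_total_nonneg[OF wd] by (intro sum_mono mult_right_mono) auto
    also have "\<dots> = (\<Sum>x\<in>C. \<Sum>y\<in>C. q x * (w x y * ?a k y))"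
      unfolding sum_distrib_right by (subst sum.swap) (simp add: ac_simps)
    also have "\<dots> = (\<Sum>x\<in>C. q x * ?a (Suc k) x)"
      by (simp add: path_total_Suc sum_distrib_left)
    finally show ?case .
  qed simp
  have "(\<lambda>k. \<Sum>x\<in>C. q x * (?a k x * (1 / t) ^ k)) \<longlonglongrightarrow> (\<Sum>x\<in>C. q x * 0)"
    using t fin by (intro tendsto_sum tendsto_mult_left summable_LIMSEQ_zero path_total_summable)
      (auto simp: r_def)
  moreover have "(\<Sum>x\<in>C. q x) \<le> (\<Sum>x\<in>C. q x * (?a k x * (1 / t) ^ k))" for k
  proof -
    have "(\<Sum>x\<in>C. q x) = t ^ k * (\<Sum>x\<in>C. q x) * (1 / t) ^ k"
      using t by (simp add: power_divide)
    also have "\<dots> \<le> (\<Sum>x\<in>C. q x * ?a k x) * (1 / t) ^ k"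
      using growth[of k] t by (intro mult_right_mono) auto
    finally show ?thesis by (simp add: sum_distrib_right sum_distrib_left ac_simps)
  qed
  ultimately have "(\<Sum>x\<in>C. q x) \<le> 0"
    using LIMSEQ_le_const by fastforce
  moreover have "q a \<le> (\<Sum>x\<in>C. q x)"
    using q fin by (intro member_le_sum) auto
  ultimately show False using q(3) by linarith
qed

text \<open>If \<open>q F \<ge> r q\<close> were strict somewhere, replacing \<open>q\<close> by \<open>q + q F\<close> would spread strictness along the
  edges, until \<open>q F \<ge> (r + e) q\<close> for some \<open>e > 0\<close>.\<close>

lemma left_subinvariant_imp_invariant:
  assumes wd: "weighted_digraph C w" and irr: "irreducible_on C w"
    and q: "\<And>x. x \<in> C \<Longrightarrow> 0 \<le> q x" "a \<in> C" "0 < q a"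
    and sub: "\<And>y. y \<in> C \<Longrightarrow> digraph_radius C w * q y \<le> (\<Sum>x\<in>C. q x * w x y)"
    and y: "y \<in> C"
  shows "(\<Sum>x\<in>C. q x * w x y) = digraph_radius C w * q y"
  using q(1,3) sub y
\<comment> \<open>The induction counts the vertices where equality holds; each replacement of
  \<open>q\<close> lowers this number, since strict vertices stay strict and \<open>c\<close> joins
  them.\<close>
proof (induction "card {z \<in> C. (\<Sum>x\<in>C. q x * w x z) = digraph_radius C w * q z}"
    arbitrary: q y rule: less_induct)
  case less
  have fin: "finite C" and w0: "\<And>x y. x \<in> C \<Longrightarrow> y \<in> C \<Longrightarrow> 0 \<le> w x y"
    using wd by (auto simp: weighted_digraph_def)
  let ?r = "digraph_radius C w"
  let ?L = "\<lambda>p y. \<Sum>x\<in>C. p x * w x y"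
  note q0 = less.prems(1) and qa = less.prems(2) and sub = less.prems(3)
  define D where "D = {z \<in> C. ?r * q z < ?L q z}"
  show ?case
  proof (rule ccontr)
    assume "?L q y \<noteq> ?r * q y"
    then have "y \<in> D" using sub[of y] less.prems(4) by (auto simp: D_def)
    then have ne: "D \<noteq> {}" by auto
    show False
    proof (cases "D = C")
      case True
      \<comment> \<open>The least slack, scaled so that \<open>e\<close> times
        \<open>q z + 1\<close> fits under it. Dividing by \<open>q z + 1\<close> rather than
        \<open>q z\<close> keeps the denominator positive where \<open>q\<close> vanishes.\<close>
      define e where "e = Min ((\<lambda>z. (?L q z - ?r * q z) / (q z + 1)) ` C)"
      have pos: "0 < (?L q z - ?r * q z) / (q z + 1)" if "z \<in> C" for z
      proof -
        have "z \<in> D" using that True by simp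
        then show ?thesis using q0[OF that] by (simp add: D_def)
      qed
      have e: "0 < e" unfolding e_def using fin pos q(2) by (subst Min_gr_iff) auto
      have "(?r + e) * q z \<le> ?L q z" if "z \<in> C" for z
      proof -
        have "e \<le> (?L q z - ?r * q z) / (q z + 1)" unfolding e_def using fin that by simp
        then have "e * (q z + 1) \<le> ?L q z - ?r * q z"
          using q0[OF that] by (simp add: field_simps)
        then show ?thesis using e by (simp add: algebra_simps)
      qed
      then have "?r + e \<le> ?r"
        using left_subinvariant_growth_le_radius[where t = "?r + e" and q = q, OF wd q0 q(2) qa]
        by simp
      then show False using e by simp
    next
      case False
      have "D \<subseteq> C" by (auto simp: D_def)
      then obtain b c where bc: "b \<in> D" "c \<in> C" "0 < w b c" "c \<notin> D"
        using irr ne False unfolding irreducible_on_def by blast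
      define q' where "q' z = q z + ?L q z" for z
      have L': "?L q' z = ?L q z + ?L (?L q) z" for z
        by (simp add: q'_def sum.distrib distrib_right)
      have LL: "?r * ?L q z = (\<Sum>x\<in>C. (?r * q x) * w x z)" for z
        by (simp add: sum_distrib_left ac_simps)
      have sub2: "?r * ?L q z \<le> ?L (?L q) z" if "z \<in> C" for z
        unfolding LL using sub that w0 by (intro sum_mono mult_right_mono) auto
      have q'0: "0 \<le> q' z" if "z \<in> C" for z
        using q0 w0 that by (auto simp: q'_def intro!: add_nonneg_nonneg sum_nonneg)
      have q'a: "0 < q' a"
        using qa q0 w0 q(2) by (auto simp: q'_def intro!: add_pos_nonneg sum_nonneg)
      have sub': "?r * q' z \<le> ?L q' z" if "z \<in> C" for z
        using sub[OF that] sub2[OF that] unfolding L' by (simp add: q'_def distrib_left)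
      have "?r * ?L q c < ?L (?L q) c"
        unfolding LL
      proof (rule sum_strict_mono_ex1[OF fin])
        show "\<forall>x\<in>C. ?r * q x * w x c \<le> ?L q x * w x c"
          using sub w0 bc(2) by (intro ballI mult_right_mono) simp_all
        show "\<exists>x\<in>C. ?r * q x * w x c < ?L q x * w x c"
          using bc(1,3) by (intro bexI[of _ b] mult_strict_right_mono) (simp_all add: D_def)
      qed
      then have c': "?L q' c \<noteq> ?r * q' c"
        using sub[OF bc(2)] unfolding L' by (simp add: q'_def distrib_left)
      have "{z \<in> C. ?L q' z = ?r * q' z} \<subset> {z \<in> C. ?L q z = ?r * q z}"
      proof
        show "{z \<in> C. ?L q' z = ?r * q' z} \<subseteq> {z \<in> C. ?L q z = ?r * q z}"
        proof safe
          fix z assume z: "z \<in> C" "?L q' z = ?r * q' z"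
          then show "?L q z = ?r * q z"
            using sub[OF z(1)] sub2[OF z(1)] unfolding L' by (simp add: q'_def distrib_left)
        qed
        have "?L q c = ?r * q c" using bc(2,4) sub[OF bc(2)] by (auto simp: D_def)
        then show "{z \<in> C. ?L q' z = ?r * q' z} \<noteq> {z \<in> C. ?L q z = ?r * q z}"
          using bc(2) c' by blast
      qed
      then have "card {z \<in> C. ?L q' z = ?r * q' z} < card {z \<in> C. ?L q z = ?r * q z}"
        using fin by (intro psubset_card_mono) auto
      from less.hyps[OF this q'0 q'a sub' bc(2)] c' show False by blast
    qed
  qed
qed

text \<open>The modulus vector satisfies the eigenvector equation by the rigidity just shown. Its
  support is then closed under successors within \<open>C\<close>, since a positive
  \<open>q x * w x y\<close> forces \<open>r q y\<close> to be positive, and irreducibility makes it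
  all of \<open>C\<close>.\<close>

lemma left_perron_vector:
  assumes wd: "weighted_digraph C w" and irr: "irreducible_on C w"
  obtains q where "\<And>x. x \<in> C \<Longrightarrow> 0 < q x"
    "\<And>y. y \<in> C \<Longrightarrow> (\<Sum>x\<in>C. q x * w x y) = digraph_radius C w * q y"
proof -
  have fin: "finite C" and w0: "\<And>x y. x \<in> C \<Longrightarrow> y \<in> C \<Longrightarrow> 0 \<le> w x y"
    using wd by (auto simp: weighted_digraph_def)
  have "C \<noteq> {}" using irr by (simp add: irreducible_on_def)
  from left_subinvariant_vector[OF wd this] obtain q where
    q0: "\<forall>x\<in>C. 0 \<le> q x" and qa: "\<exists>x\<in>C. 0 < q x"
    and sub0: "\<forall>y\<in>C. digraph_radius C w * q y \<le> (\<Sum>x\<in>C. q x * w x y)"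
    by auto
  from qa obtain a where a: "a \<in> C" "0 < q a" by auto
  note q = bspec[OF q0] a and sub = bspec[OF sub0]
  note inv = left_subinvariant_imp_invariant[OF wd irr q sub]
  define S where "S = {x \<in> C. 0 < q x}"
  have closed: "y \<in> S" if "x \<in> S" "y \<in> C" "0 < w x y" for x y
  proof -
    have "0 < q x * w x y" using that by (simp add: S_def)
    also have "\<dots> \<le> (\<Sum>x\<in>C. q x * w x y)"
      using that q w0 fin by (intro member_le_sum) (auto simp: S_def)
    also have "\<dots> = digraph_radius C w * q y" using inv that by simp
    finally show ?thesis using q(1)[OF that(2)] that(2) by (cases "q y = 0") (auto simp: S_def)
  qed
  have "S \<noteq> {}" "S \<subseteq> C" using q by (auto simp: S_def)
  then have "S = C" using irr closed unfolding irreducible_on_def by (metis (no_types))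
  then show ?thesis using that[of q] inv by (auto simp: S_def)
qed


section \<open>Accessibility and access classes\<close>

lemma finite_paths_single: "x \<in> V \<Longrightarrow> [x] \<in> finite_paths V w x"
  by (simp add: finite_paths_def)

lemma finite_paths_Cons_iff:
  "x # u \<in> finite_paths V w y \<longleftrightarrow> x = y \<and> x \<in> V \<and>
    (u = [] \<or> (\<exists>z. u \<in> finite_paths V w z \<and> 0 < w x z))"
  by (cases u) (auto simp: finite_paths_def)

lemma finite_paths_not_Nil: "u \<in> finite_paths V w x \<Longrightarrow> u \<noteq> []"
  by (simp add: finite_paths_def)

lemma accessible_refl: "x \<in> V \<Longrightarrow> accessible V w x x"
  unfolding accessible_def using finite_paths_single by force

lemma accessible_Cons:
  assumes "x \<in> V" "0 < w x y" "accessible V w y z"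
  shows "accessible V w x z"
proof -
  obtain u where u: "u \<in> finite_paths V w y" "last u = z"
    using assms(3) by (auto simp: accessible_def)
  then show ?thesis
    using assms unfolding accessible_def
    by (intro bexI[of _ "x # u"]) (auto simp: finite_paths_Cons_iff finite_paths_not_Nil)
qed

text \<open>Peels the first edge with the target held fixed, so that facts about access can be
  proved without unfolding paths.\<close>

lemma accessible_induct [consumes 1, case_names refl step]:
  assumes "accessible V w x y"
    and "\<And>x. x \<in> V \<Longrightarrow> x = y \<Longrightarrow> P x"
    and "\<And>x x'. x \<in> V \<Longrightarrow> 0 < w x x' \<Longrightarrow> accessible V w x' y \<Longrightarrow> P x' \<Longrightarrow> P x"
  shows "P x"
proof -
  have "P x" if "u \<in> finite_paths V w x" "last u = y" for u x
    using that
  proof (induction u arbitrary: x)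
    case (Cons a u)
    show ?case
    proof (cases "u = []")
      case True
      then show ?thesis using Cons.prems assms(2) by (auto simp: finite_paths_Cons_iff)
    next
      case False
      then obtain z where z: "u \<in> finite_paths V w z" "0 < w x z" "x \<in> V" "last u = y"
        using Cons.prems by (auto simp: finite_paths_Cons_iff)
      then show ?thesis using Cons.IH[of z] assms(3)[of x z] by (auto simp: accessible_def)
    qed
  qed (simp add: finite_paths_def)
  then show ?thesis using assms(1) by (auto simp: accessible_def)
qed

lemma accessible_source: "accessible V w x y \<Longrightarrow> x \<in> V"
  by (induction rule: accessible_induct)

lemma accessible_target: "accessible V w x y \<Longrightarrow> y \<in> V"
  by (induction rule: accessible_induct) auto

lemma accessible_trans:
  "accessible V w x y \<Longrightarrow> accessible V w y z \<Longrightarrow> accessible V w x z"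
proof (induction rule: accessible_induct)
  case (step x x')
  then show ?case using accessible_Cons[of x V w x' z] by simp
qed simp

lemma accessible_edge: "x \<in> V \<Longrightarrow> y \<in> V \<Longrightarrow> 0 < w x y \<Longrightarrow> accessible V w x y"
  using accessible_Cons[OF _ _ accessible_refl] by metis

definition access_class :: "'a set \<Rightarrow> ('a \<Rightarrow> 'a \<Rightarrow> real) \<Rightarrow> 'a \<Rightarrow> 'a set" where
  "access_class V w x = {y. accessible V w x y \<and> accessible V w y x}"

lemma access_classes_eq: "access_classes V w = access_class V w ` V"
  by (auto simp: access_classes_def quotient_def access_class_def)

lemma access_class_self: "x \<in> V \<Longrightarrow> x \<in> access_class V w x"
  by (simp add: access_class_def accessible_refl)

lemma access_class_subset: "access_class V w x \<subseteq> V"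
  by (auto simp: access_class_def dest: accessible_target)

lemma access_class_eq: "y \<in> access_class V w x \<Longrightarrow> access_class V w y = access_class V w x"
  unfolding access_class_def by (simp add: set_eq_iff) (meson accessible_trans)

text \<open>The required edge is the first one of the path that leaves the class.\<close>

lemma access_class_exit:
  assumes "accessible V w x y" "x \<in> access_class V w a" "y \<notin> access_class V w a"
  shows "\<exists>b\<in>access_class V w a. \<exists>z\<in>V - access_class V w a. 0 < w b z \<and> accessible V w z y"
  using assms
proof (induction rule: accessible_induct)
  case (step x x')
  then show ?case
    by (cases "x' \<in> access_class V w a") (auto dest: accessible_source)
qed auto

text \<open>A path joining two members of the class visits only members, since each vertex on it is
  accessible from \<open>a\<close> and leads back to \<open>a\<close>; a successor-closed subset
  therefore absorbs the whole path.\<close>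

lemma irreducible_access_class:
  assumes "a \<in> V"
  shows "irreducible_on (access_class V w a) w"
  unfolding irreducible_on_def
proof (intro conjI allI impI)
  let ?C = "access_class V w a"
  show "?C \<noteq> {}" using access_class_self[OF assms] by blast
  fix S assume S: "S \<subseteq> ?C" "S \<noteq> {} \<and> (\<forall>x\<in>S. \<forall>y\<in>?C. 0 < w x y \<longrightarrow> y \<in> S)"
  then have S_sub: "z \<in> ?C" if "z \<in> S" for z using that by auto
  have step_closed: "z \<in> S" if "x \<in> S" "z \<in> ?C" "0 < w x z" for x z
    using S(2) that by simp
  have closed: "x \<in> S \<longrightarrow> y \<in> S" if "accessible V w x y" "y \<in> ?C" for x y
    using that
  proof (induction rule: accessible_induct)
    case (step x x')
    show ?case
    proof
      assume x: "x \<in> S"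
      have "accessible V w a x" using S_sub[OF x] by (simp add: access_class_def)
      moreover have "accessible V w x x'"
        using step.hyps by (intro accessible_edge accessible_source[OF step.hyps(3)])
      moreover have "accessible V w x' a"
        using step.hyps(3) step.prems accessible_trans by (fastforce simp: access_class_def)
      ultimately have "x' \<in> ?C"
        using accessible_trans by (fastforce simp: access_class_def)
      then have "x' \<in> S" using step_closed x step.hyps(2) by simp
      then show "y \<in> S" using step.IH step.prems by simp
    qed
  qed simp
  obtain x where x: "x \<in> S" using S(2) by auto
  have "y \<in> S" if "y \<in> ?C" for y
  proof -
    have "accessible V w x a" "accessible V w a y"
      using S_sub[OF x] that by (simp_all add: access_class_def)
    then show ?thesis using closed[OF accessible_trans that] x by simp
  qed
  then show "S = ?C" using S_sub by auto
qed

lemma weighted_digraph_subset: "weighted_digraph V w \<Longrightarrow> C \<subseteq> V \<Longrightarrow> weighted_digraph C w"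
  by (auto simp: weighted_digraph_def intro: finite_subset)

section \<open>Growth of path generating functions\<close>

locale positive_digraph =
  fixes V :: "'a set" and w :: "'a \<Rightarrow> 'a \<Rightarrow> real" and \<rho> :: real
  assumes wd: "weighted_digraph V w"
    and rho: "\<rho> = digraph_radius V w"
    and rho_pos: "0 < \<rho>"
begin

abbreviation G :: "real \<Rightarrow> 'a \<Rightarrow> real" where
  "G \<equiv> path_gf V w"

abbreviation critical :: "real filter" where
  "critical \<equiv> at (1 / \<rho>) within {0<..<1 / \<rho>}"

lemma finite_V: "finite V"
  using wd by (simp add: weighted_digraph_def)

lemma weight_nonneg: "x \<in> V \<Longrightarrow> y \<in> V \<Longrightarrow> 0 \<le> w x y"
  using wd by (simp add: weighted_digraph_def)

lemma subcritical:
  assumes "s \<in> {0<..<1 / \<rho>}"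
  shows "0 < s" "s * digraph_radius V w < 1" "0 < 1 - \<rho> * s" "1 - \<rho> * s < 1"
  using assms rho_pos by (auto simp: field_simps rho[symmetric])

lemma eventually_critical: "(\<And>s. s \<in> {0<..<1 / \<rho>} \<Longrightarrow> P s) \<Longrightarrow> eventually P critical"
  by (auto simp: eventually_at_filter)

text \<open>Lower bounds on \<open>G\<close> lose a factor \<open>s\<close> per edge and are stated
  for \<open>s\<close> bounded away from 0; discarding the lower half of the interval does not
  affect the limit at \<open>1 / \<rho>\<close>.\<close>

lemma eventually_critical_upper:
  "(\<And>s. s \<in> {1 / (2 * \<rho>)<..<1 / \<rho>} \<Longrightarrow> P s) \<Longrightarrow> eventually P critical"
  unfolding eventually_at using rho_pos
  by (intro exI[of _ "1 / (2 * \<rho>)"]) (auto simp: dist_real_def field_simps)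

lemma upper_half_subset: "s \<in> {1 / (2 * \<rho>)<..<1 / \<rho>} \<Longrightarrow> s \<in> {0<..<1 / \<rho>}"
  using rho_pos by (auto intro: less_trans[of 0 "1 / (2 * \<rho>)" s])

lemma critical_neq_bot: "critical \<noteq> bot"
proof -
  have "{0<..<1 / \<rho>} \<noteq> {}" "0 < 1 / \<rho>" using rho_pos by auto
  then have "1 / \<rho> islimpt {0<..<1 / \<rho>}"
    by (intro islimpt_greaterThanLessThan2)
  then show ?thesis by (simp add: trivial_limit_within)
qed

lemma tendsto_gap: "((\<lambda>s. 1 - \<rho> * s) \<longlongrightarrow> 0) critical"
proof -
  have "((\<lambda>s. 1 - \<rho> * s) \<longlongrightarrow> 1 - \<rho> * (1 / \<rho>)) critical"
    by (intro tendsto_diff tendsto_const tendsto_mult_left tendsto_ident_at)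
  then show ?thesis using rho_pos by simp
qed

lemma tendsto_ident_critical: "((\<lambda>s. s) \<longlongrightarrow> 1 / \<rho>) critical"
  by (rule tendsto_ident_at)

lemma G_eq: "s \<in> {0<..<1 / \<rho>} \<Longrightarrow> x \<in> V \<Longrightarrow> G s x = 1 + s * (\<Sum>y\<in>V. w x y * G s y)"
  by (rule path_gf_eq[OF finite_V _ less_imp_le[OF subcritical(1)] subcritical(2)])

lemma G_ge_1: "s \<in> {0<..<1 / \<rho>} \<Longrightarrow> x \<in> V \<Longrightarrow> 1 \<le> G s x"
  by (rule path_gf_ge_1[OF wd _ less_imp_le[OF subcritical(1)] subcritical(2)])

lemma G_pos: "s \<in> {0<..<1 / \<rho>} \<Longrightarrow> x \<in> V \<Longrightarrow> 0 < G s x"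
  using G_ge_1[of s x] by linarith

lemma weight_G_nonneg: "s \<in> {0<..<1 / \<rho>} \<Longrightarrow> x \<in> V \<Longrightarrow> y \<in> V \<Longrightarrow> 0 \<le> w x y * G s y"
  by (intro mult_nonneg_nonneg weight_nonneg less_imp_le[OF G_pos])

text \<open>Pairing the equation \<open>G = 1 + s F G\<close>, restricted to \<open>C\<close>, with a left eigenvector of the block
  of \<open>C\<close> isolates the factor \<open>1 - r s\<close> that the class \<open>C\<close> contributes to the growth.\<close>

lemma left_eigenvector_identity:
  assumes C: "C \<subseteq> V" and s: "s \<in> {0<..<1 / \<rho>}"
    and q: "\<And>y. y \<in> C \<Longrightarrow> (\<Sum>x\<in>C. q x * w x y) = r * q y"
  shows "(1 - r * s) * (\<Sum>x\<in>C. q x * G s x)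
    = (\<Sum>x\<in>C. q x * (1 + s * (\<Sum>z\<in>V - C. w x z * G s z)))"
proof -
  have "(\<Sum>x\<in>C. q x * G s x)
      = (\<Sum>x\<in>C. q x * (1 + s * (\<Sum>z\<in>V - C. w x z * G s z)) + s * (\<Sum>y\<in>C. q x * w x y * G s y))"
  proof (rule sum.cong)
    fix x assume x: "x \<in> C"
    have "(\<Sum>y\<in>V. w x y * G s y) = (\<Sum>z\<in>V - C. w x z * G s z) + (\<Sum>y\<in>C. w x y * G s y)"
      by (rule sum.subset_diff[OF C finite_V])
    then show "q x * G s x
        = q x * (1 + s * (\<Sum>z\<in>V - C. w x z * G s z)) + s * (\<Sum>y\<in>C. q x * w x y * G s y)"
      using G_eq[OF s subsetD[OF C x]]
      by (simp only: sum_distrib_left[symmetric] distrib_left mult.assoc mult.left_commute mult_1_right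
          add.assoc)
  qed simp
  also have "\<dots> = (\<Sum>x\<in>C. q x * (1 + s * (\<Sum>z\<in>V - C. w x z * G s z)))
      + s * (\<Sum>x\<in>C. \<Sum>y\<in>C. q x * w x y * G s y)"
    by (simp add: sum.distrib sum_distrib_left)
  also have "(\<Sum>x\<in>C. \<Sum>y\<in>C. q x * w x y * G s y) = (\<Sum>y\<in>C. (\<Sum>x\<in>C. q x * w x y) * G s y)"
    by (subst sum.swap) (simp add: sum_distrib_right)
  also have "\<dots> = (\<Sum>y\<in>C. r * q y * G s y)"
    by (rule sum.cong) (simp_all only: q)
  also have "\<dots> = r * (\<Sum>y\<in>C. q y * G s y)"
    by (simp only: sum_distrib_left mult.assoc)
  finally show ?thesis
    unfolding left_diff_distrib mult_1_left mult.assoc mult.left_commute[of s] by linarith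
qed

lemma class_perron_vector:
  assumes "a \<in> V" "C = access_class V w a" "r = digraph_radius C w"
  shows "\<exists>q. (\<forall>x\<in>C. 0 < q x) \<and> (\<forall>y\<in>C. (\<Sum>x\<in>C. q x * w x y) = r * q y)"
proof -
  obtain q where "\<And>x. x \<in> C \<Longrightarrow> 0 < q x"
    "\<And>y. y \<in> C \<Longrightarrow> (\<Sum>x\<in>C. q x * w x y) = r * q y"
    using left_perron_vector[OF weighted_digraph_subset[OF wd access_class_subset]
        irreducible_access_class[OF assms(1)]] unfolding assms(2,3) by metis
  then show ?thesis by (intro exI[of _ q]) simp
qed

lemma outer_term_nonneg:
  assumes "C \<subseteq> V" "s \<in> {0<..<1 / \<rho>}" "x \<in> C"
  shows "0 \<le> s * (\<Sum>z\<in>V - C. w x z * G s z)"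
proof -
  have "0 \<le> w x z * G s z" if "z \<in> V - C" for z
    using that assms by (intro weight_G_nonneg) auto
  then show ?thesis
    using sum_nonneg[of "V - C" "\<lambda>z. w x z * G s z"] subcritical(1)[OF assms(2)] by simp
qed

text \<open>If the radius \<open>r\<close> of a class exceeded \<open>\<rho>\<close>, then
  \<open>s = 1 / r\<close> would be subcritical, and at this \<open>s\<close> the eigenvector
  identity would equate 0 with a positive sum.\<close>

lemma radius_class_le:
  assumes "a \<in> V"
  shows "digraph_radius (access_class V w a) w \<le> \<rho>"
proof (rule ccontr)
  let ?C = "access_class V w a"
  define r where "r = digraph_radius ?C w"
  assume "\<not> digraph_radius ?C w \<le> \<rho>"
  then have r: "\<rho> < r" by (simp add: r_def)
  obtain q where q': "\<forall>x\<in>?C. 0 < q x" "\<forall>y\<in>?C. (\<Sum>x\<in>?C. q x * w x y) = r * q y"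
    using class_perron_vector[OF assms refl r_def] by auto
  note q = bspec[OF q'(1)] bspec[OF q'(2)]
  have s: "1 / r \<in> {0<..<1 / \<rho>}" using r rho_pos by (auto simp: field_simps)
  have C: "?C \<subseteq> V" by (rule access_class_subset)
  have "0 < (\<Sum>x\<in>?C. q x * (1 + 1 / r * (\<Sum>z\<in>V - ?C. w x z * G (1 / r) z)))"
  proof (rule sum_pos)
    show "finite ?C" using finite_subset[OF C finite_V] .
    show "?C \<noteq> {}" using access_class_self[OF assms] by auto
    show "0 < q x * (1 + 1 / r * (\<Sum>z\<in>V - ?C. w x z * G (1 / r) z))" if "x \<in> ?C" for x
      using outer_term_nonneg[OF C s that] q(1)[OF that] by (intro mult_pos_pos) linarith+
  qed
  then show False using left_eigenvector_identity[OF C s q(2)] r rho_pos by simp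
qed

section \<open>Chains of basic classes and the vertices that reach them\<close>

lemma basic_class_eq: "L \<in> basic_classes V w \<Longrightarrow> x \<in> L \<Longrightarrow> x \<in> V \<and> L = access_class V w x"
  unfolding basic_classes_def access_classes_eq
  using access_class_eq access_class_subset by fastforce

lemma basic_class_nonempty: "L \<in> basic_classes V w \<Longrightarrow> \<exists>x. x \<in> L"
  unfolding basic_classes_def access_classes_eq
  using access_class_self by fastforce

lemma basic_chain_Cons:
  "basic_chain V w (L # Ls) \<longleftrightarrow> L \<in> basic_classes V w \<and>
    (Ls = [] \<or> L \<notin> set Ls \<and> class_access V w L (hd Ls) \<and> basic_chain V w Ls)"
  by (cases Ls) (auto simp: basic_chain_def)

lemma basic_chain_hd: "basic_chain V w Ls \<Longrightarrow> hd Ls \<in> basic_classes V w"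
  by (cases Ls) (auto simp: basic_chain_def)

definition reaches_chain :: "'a \<Rightarrow> 'a set list \<Rightarrow> bool" where
  "reaches_chain x Ls \<longleftrightarrow> basic_chain V w Ls \<and> (\<exists>z\<in>hd Ls. accessible V w x z)"

text \<open>Since the members of a class are mutually accessible, reaching one vertex of the first
  class gives the whole class and then the next one. This is what excludes a return to a class when
  a chain is prolonged.\<close>

lemma reaches_chain_member:
  "reaches_chain x Ls \<Longrightarrow> L \<in> set Ls \<Longrightarrow> y \<in> L \<Longrightarrow> accessible V w x y"
proof (induction Ls arbitrary: x)
  case (Cons M Ls)
  have M: "M \<in> basic_classes V w" and chain: "basic_chain V w (M # Ls)"
    using Cons.prems(1) by (auto simp: reaches_chain_def basic_chain_Cons)
  obtain z where z: "z \<in> M" "accessible V w x z"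
    using Cons.prems(1) by (auto simp: reaches_chain_def)
  have all: "accessible V w x b" if "b \<in> M" for b
  proof -
    have "b \<in> access_class V w z" using that basic_class_eq[OF M z(1)] by simp
    then have "accessible V w z b" by (simp add: access_class_def)
    then show ?thesis using z(2) by (rule accessible_trans[rotated])
  qed
  show ?case
  proof (cases "L = M")
    case True
    then show ?thesis using all Cons.prems(3) by simp
  next
    case False
    then have L: "L \<in> set Ls" using Cons.prems(2) by simp
    then have c: "class_access V w M (hd Ls)" "basic_chain V w Ls"
      using chain by (auto simp: basic_chain_Cons)
    then obtain b d where bd: "b \<in> M" "d \<in> hd Ls" "accessible V w b d"
      by (auto simp: class_access_def)
    then have "accessible V w x d" using all[OF bd(1)] by (metis accessible_trans)
    then have "reaches_chain x Ls" using c bd by (auto simp: reaches_chain_def)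
    then show ?thesis using Cons.IH L Cons.prems(3) by simp
  qed
qed simp

lemma reaches_chain_trans:
  "accessible V w x y \<Longrightarrow> reaches_chain y Ls \<Longrightarrow> reaches_chain x Ls"
  unfolding reaches_chain_def by (metis accessible_trans)

text \<open>The new class is distinct from the others: were it on the chain, \<open>z\<close> would
  lead back to \<open>x\<close> and would belong to the class of \<open>x\<close>.\<close>

lemma reaches_chain_Cons:
  assumes "x \<in> V" "access_class V w x \<in> basic_classes V w"
    and "accessible V w x z" "z \<notin> access_class V w x" "reaches_chain z Ls"
  shows "reaches_chain x (access_class V w x # Ls)"
proof -
  let ?C = "access_class V w x"
  have "?C \<notin> set Ls"
  proof
    assume "?C \<in> set Ls"
    then have "accessible V w z x"
      using reaches_chain_member[OF assms(5)] access_class_self[OF assms(1)] by metis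
    then show False using assms(3,4) by (simp add: access_class_def)
  qed
  moreover have "\<exists>y\<in>hd Ls. accessible V w x y"
    using reaches_chain_trans[OF assms(3,5)] by (simp add: reaches_chain_def)
  then have "class_access V w ?C (hd Ls)"
    using access_class_self[OF assms(1)] by (auto simp: class_access_def)
  ultimately have "basic_chain V w (?C # Ls)"
    using assms by (simp add: basic_chain_Cons reaches_chain_def)
  then show ?thesis
    using accessible_refl[OF assms(1)] access_class_self[OF assms(1)]
    by (auto simp: reaches_chain_def)
qed

text \<open>Induction on the number of accessible vertices: an exit \<open>z\<close> of the class of
  \<open>x\<close> cannot return, so it reaches fewer vertices. The growth of \<open>G\<close> at
  the exits bounds the right side of the eigenvector identity, and dividing by
  \<open>1 - r s\<close> costs one more power of the gap only when the class is basic.\<close>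

lemma growth_upper_bound:
  assumes "x \<in> V" "\<And>Ls. reaches_chain x Ls \<Longrightarrow> length Ls \<le> N"
  shows "\<exists>d. \<forall>s\<in>{0<..<1 / \<rho>}. G s x \<le> d / (1 - \<rho> * s) ^ N"
  using assms
proof (induction "card {y. accessible V w x y}" arbitrary: x N rule: less_induct)
  case less
  note x = less.prems(1) and bound = less.prems(2)
  let ?C = "access_class V w x"
  define r where "r = digraph_radius ?C w"
  \<comment> \<open>The exponent left for the exits: a basic class uses up one unit of
    \<open>N\<close>. Truncated subtraction is harmless because \<open>N1\<close> gives
    \<open>N \<ge> 1\<close> in that case.\<close>
  define m where "m = (if ?C \<in> basic_classes V w then N - 1 else N)"
  have C: "?C \<subseteq> V" by (rule access_class_subset)
  have finC: "finite ?C" using finite_subset[OF C finite_V] .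
  have N1: "1 \<le> N" if "?C \<in> basic_classes V w"
  proof -
    have "reaches_chain x [?C]"
      using that accessible_refl[OF x] access_class_self[OF x]
      by (auto simp: reaches_chain_def basic_chain_Cons)
    then show ?thesis using bound by fastforce
  qed
  have exit: "\<exists>d. \<forall>s\<in>{0<..<1 / \<rho>}. w b z * G s z \<le> w b z * (d / (1 - \<rho> * s) ^ m)"
    if b: "b \<in> ?C" and z: "z \<in> V - ?C" for b z
  proof (cases "0 < w b z")
    case True
    have bV: "b \<in> V" using b C by auto
    have "accessible V w x b" using b by (simp add: access_class_def)
    moreover have "accessible V w b z" using True bV z by (simp add: accessible_edge)
    ultimately have xz: "accessible V w x z" by (rule accessible_trans)
    then have nzx: "\<not> accessible V w z x" using z by (auto simp: access_class_def)
    have "{y. accessible V w z y} \<subseteq> {y. accessible V w x y}"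
      using accessible_trans[OF xz] by auto
    moreover have "x \<in> {y. accessible V w x y}" "x \<notin> {y. accessible V w z y}"
      using nzx accessible_refl[OF x] by auto
    ultimately have "{y. accessible V w z y} \<subset> {y. accessible V w x y}" by blast
    moreover have "finite {y. accessible V w x y}"
      by (rule finite_subset[OF _ finite_V]) (auto dest: accessible_target)
    ultimately have smaller: "card {y. accessible V w z y} < card {y. accessible V w x y}"
      by (simp add: psubset_card_mono)
    have "length Ls \<le> m" if Ls: "reaches_chain z Ls" for Ls
    proof (cases "?C \<in> basic_classes V w")
      case True
      have "reaches_chain x (?C # Ls)"
        using reaches_chain_Cons[OF x True xz _ Ls] z by simp
      then show ?thesis using bound[of "?C # Ls"] True by (simp add: m_def)
    next
      case False
      then show ?thesis using bound[OF reaches_chain_trans[OF xz Ls]] by (simp add: m_def)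
    qed
    then obtain d where "\<forall>s\<in>{0<..<1 / \<rho>}. G s z \<le> d / (1 - \<rho> * s) ^ m"
      using less.hyps[OF smaller] z by blast
    then have "\<forall>s\<in>{0<..<1 / \<rho>}. w b z * G s z \<le> w b z * (d / (1 - \<rho> * s) ^ m)"
      using True by (simp only: mult_le_cancel_left_pos)
    then show ?thesis by (rule exI)
  next
    case False
    then have "w b z = 0" using weight_nonneg[of b z] b z C by auto
    then show ?thesis by auto
  qed
  then obtain d where d: "\<And>b z s. b \<in> ?C \<Longrightarrow> z \<in> V - ?C \<Longrightarrow> s \<in> {0<..<1 / \<rho>} \<Longrightarrow>
      w b z * G s z \<le> w b z * (d b z / (1 - \<rho> * s) ^ m)"
    by metis
  obtain q where q': "\<forall>x\<in>?C. 0 < q x" "\<forall>y\<in>?C. (\<Sum>x\<in>?C. q x * w x y) = r * q y"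
    using class_perron_vector[OF x refl r_def] by auto
  note q = bspec[OF q'(1)] bspec[OF q'(2)]
  \<comment> \<open>Here \<open>s\<close> is replaced by its bound \<open>1 / \<rho>\<close> and
    \<open>d b z\<close> by its modulus, since nothing is known of its sign.\<close>
  define K where "K = (\<Sum>b\<in>?C. q b * (1 + 1 / \<rho> * (\<Sum>z\<in>V - ?C. w b z * \<bar>d b z\<bar>)))"
  have xC: "x \<in> ?C" by (rule access_class_self[OF x])
  have main: "(1 - r * s) * (q x * G s x) \<le> K / (1 - \<rho> * s) ^ m" and gap: "0 \<le> 1 - r * s"
    if s: "s \<in> {0<..<1 / \<rho>}" for s
  proof -
    note sub = subcritical[OF s]
    have "r * s \<le> \<rho> * s" using radius_class_le[OF x] sub by (simp add: r_def)
    then show gap: "0 \<le> 1 - r * s" using sub by linarith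
    have le1: "(1 - \<rho> * s) ^ m \<le> 1" using sub by (intro power_le_one) auto
    have pos: "0 < (1 - \<rho> * s) ^ m" using sub by simp
    have "q x * G s x \<le> (\<Sum>b\<in>?C. q b * G s b)"
      using finC xC q(1) G_pos[OF s] C by (intro member_le_sum) (auto intro!: mult_nonneg_nonneg less_imp_le)
    then have "(1 - r * s) * (q x * G s x) \<le> (1 - r * s) * (\<Sum>b\<in>?C. q b * G s b)"
      using gap by (rule mult_left_mono)
    also have "\<dots> = (\<Sum>b\<in>?C. q b * (1 + s * (\<Sum>z\<in>V - ?C. w b z * G s z)))"
      by (rule left_eigenvector_identity[OF C s q(2)])
    also have "\<dots> \<le> (\<Sum>b\<in>?C. q b * ((1 + 1 / \<rho> * (\<Sum>z\<in>V - ?C. w b z * \<bar>d b z\<bar>)) / (1 - \<rho> * s) ^ m))"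
    proof (intro sum_mono mult_left_mono)
      fix b assume b: "b \<in> ?C"
      show "0 \<le> q b" using q(1)[OF b] by simp
      have w0: "0 \<le> w b z" if "z \<in> V - ?C" for z using weight_nonneg b that C by auto
      have "(\<Sum>z\<in>V - ?C. w b z * G s z) \<le> (\<Sum>z\<in>V - ?C. w b z * \<bar>d b z\<bar> / (1 - \<rho> * s) ^ m)"
      proof (rule sum_mono)
        fix z assume z: "z \<in> V - ?C"
        have "w b z * G s z \<le> w b z * (d b z / (1 - \<rho> * s) ^ m)" by (rule d[OF b z s])
        also have "\<dots> \<le> w b z * (\<bar>d b z\<bar> / (1 - \<rho> * s) ^ m)"
          using w0[OF z] pos by (intro mult_left_mono divide_right_mono) auto
        finally show "w b z * G s z \<le> w b z * \<bar>d b z\<bar> / (1 - \<rho> * s) ^ m" by simp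
      qed
      also have "\<dots> = (\<Sum>z\<in>V - ?C. w b z * \<bar>d b z\<bar>) / (1 - \<rho> * s) ^ m"
        by (simp add: sum_divide_distrib)
      finally have "s * (\<Sum>z\<in>V - ?C. w b z * G s z)
          \<le> s * ((\<Sum>z\<in>V - ?C. w b z * \<bar>d b z\<bar>) / (1 - \<rho> * s) ^ m)"
        using sub by (intro mult_left_mono) auto
      also have "\<dots> \<le> 1 / \<rho> * ((\<Sum>z\<in>V - ?C. w b z * \<bar>d b z\<bar>) / (1 - \<rho> * s) ^ m)"
        using s pos w0 by (intro mult_right_mono divide_nonneg_pos sum_nonneg) auto
      finally have "s * (\<Sum>z\<in>V - ?C. w b z * G s z)
          \<le> 1 / \<rho> * (\<Sum>z\<in>V - ?C. w b z * \<bar>d b z\<bar>) / (1 - \<rho> * s) ^ m" by simp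
      \<comment> \<open>The constant 1 coming from the path of length 0 is absorbed into the same
        power of the gap.\<close>
      moreover have "1 \<le> 1 / (1 - \<rho> * s) ^ m" using le1 pos by simp
      ultimately show "1 + s * (\<Sum>z\<in>V - ?C. w b z * G s z)
          \<le> (1 + 1 / \<rho> * (\<Sum>z\<in>V - ?C. w b z * \<bar>d b z\<bar>)) / (1 - \<rho> * s) ^ m"
        by (simp only: add_divide_distrib)
    qed
    also have "\<dots> = K / (1 - \<rho> * s) ^ m"
      by (simp add: K_def sum_divide_distrib)
    finally show "(1 - r * s) * (q x * G s x) \<le> K / (1 - \<rho> * s) ^ m" .
  qed
  have qx: "0 < q x" by (rule q(1)[OF xC])
  show ?case
  proof (cases "?C \<in> basic_classes V w")
    case True
    then have r: "r = \<rho>" by (simp add: r_def rho basic_classes_def)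
    obtain N' where N': "N = Suc N'" "m = N'" using N1[OF True] True by (cases N) (auto simp: m_def)
    have "G s x \<le> (K / q x) / (1 - \<rho> * s) ^ N" if s: "s \<in> {0<..<1 / \<rho>}" for s
      using main[OF s] subcritical[OF s] qx unfolding r N' by (simp add: field_simps)
    then show ?thesis by blast
  next
    case False
    have "?C \<in> access_classes V w" using x by (auto simp: access_classes_eq)
    then have "r < \<rho>" using False radius_class_le[OF x] by (auto simp: r_def rho basic_classes_def)
    \<comment> \<open>Below \<open>1 / \<rho>\<close> the factor \<open>1 - r * s\<close> of a
      non-basic class stays above this positive constant, so that no power of the gap is
      lost.\<close>
    then have r: "0 < 1 - r / \<rho>" using rho_pos by (simp add: field_simps)
    have "G s x \<le> (K / (q x * (1 - r / \<rho>))) / (1 - \<rho> * s) ^ N" if s: "s \<in> {0<..<1 / \<rho>}" for s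
    proof -
      have r0: "0 \<le> r" unfolding r_def using finC xC by (intro digraph_radius_nonneg) auto
      have "r * s \<le> r * (1 / \<rho>)" using s r0 by (intro mult_left_mono) auto
      then have "(1 - r / \<rho>) * (q x * G s x) \<le> (1 - r * s) * (q x * G s x)"
        using qx G_pos[OF s x] by (intro mult_right_mono) auto
      also have "\<dots> \<le> K / (1 - \<rho> * s) ^ N" using main[OF s] False by (simp add: m_def)
      finally have "G s x * (q x * (1 - r / \<rho>)) \<le> K / (1 - \<rho> * s) ^ N" by (simp only: ac_simps)
      then have "G s x \<le> K / (1 - \<rho> * s) ^ N / (q x * (1 - r / \<rho>))"
        using qx r by (simp only: pos_le_divide_eq mult_pos_pos)
      then show ?thesis by (simp only: divide_divide_eq_left mult.commute)
    qed
    then show ?thesis by blast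
  qed
qed

text \<open>Keeping a single term of \<open>G = 1 + s F G\<close>, each edge of the path costs the
  factor \<open>w x x' / (2 \<rho>)\<close>, because \<open>s > 1 / (2 \<rho>)\<close>.\<close>

lemma growth_along_path:
  assumes "accessible V w x y"
  shows "\<exists>c>0. \<forall>s\<in>{1 / (2 * \<rho>)<..<1 / \<rho>}. c * G s y \<le> G s x"
  using assms
proof (induction rule: accessible_induct)
  case (refl x)
  then show ?case by (intro exI[of _ 1]) auto
next
  case (step x x')
  then obtain c where c: "0 < c" "\<And>s. s \<in> {1 / (2 * \<rho>)<..<1 / \<rho>} \<Longrightarrow> c * G s y \<le> G s x'" by blast
  have x': "x' \<in> V" using step.hyps(3) by (rule accessible_source)
  have "1 / (2 * \<rho>) * w x x' * c * G s y \<le> G s x" if s: "s \<in> {1 / (2 * \<rho>)<..<1 / \<rho>}" for s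
  proof -
    note s' = upper_half_subset[OF s]
    have "1 / (2 * \<rho>) * w x x' * c * G s y = 1 / (2 * \<rho>) * (w x x' * (c * G s y))" by simp
    also have "\<dots> \<le> s * (w x x' * G s x')"
      using s c(2)[OF s] step.hyps(2) rho_pos G_pos[OF s' x'] c(1) G_pos[OF s' accessible_target[OF step.hyps(3)]]
      by (intro mult_mono mult_left_mono) auto
    also have "\<dots> \<le> s * (\<Sum>y\<in>V. w x y * G s y)"
      using s' x' step.hyps(1) weight_G_nonneg[OF s'] finite_V
      by (intro mult_left_mono member_le_sum) simp_all
    also have "\<dots> \<le> G s x" using G_eq[OF s' step.hyps(1)] by simp
    finally show ?thesis .
  qed
  then show ?case using c(1) step.hyps(2) rho_pos
    by (intro exI[of _ "1 / (2 * \<rho>) * w x x' * c"]) auto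
qed

text \<open>Induction along the chain. An exit edge towards the next class carries its growth into
  the right side of the eigenvector identity, and the head class, having radius
  \<open>\<rho>\<close>, adds one power of \<open>1 / (1 - \<rho> s)\<close>. Comparison along paths
  then turns the weighted sum over the class into a bound at \<open>x\<close>.\<close>

lemma growth_lower_bound:
  assumes "reaches_chain x Ls"
  shows "\<exists>c>0. \<forall>s\<in>{1 / (2 * \<rho>)<..<1 / \<rho>}. c / (1 - \<rho> * s) ^ length Ls \<le> G s x"
  using assms
proof (induction Ls arbitrary: x)
  case Nil
  then show ?case by (simp add: reaches_chain_def basic_chain_def)
next
  case (Cons L Ls)
  let ?I = "{1 / (2 * \<rho>)<..<1 / \<rho>}"
  have L: "L \<in> basic_classes V w" and chain: "basic_chain V w (L # Ls)"
    using Cons.prems by (auto simp: reaches_chain_def basic_chain_Cons)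
  obtain a where a: "a \<in> L" "accessible V w x a" using Cons.prems by (auto simp: reaches_chain_def)
  have aV: "a \<in> V" and La: "L = access_class V w a" using basic_class_eq[OF L a(1)] by auto
  have C: "L \<subseteq> V" unfolding La by (rule access_class_subset)
  have finL: "finite L" using finite_subset[OF C finite_V] .
  have rad: "digraph_radius L w = \<rho>" using L by (simp add: basic_classes_def rho)
  obtain q where q': "\<forall>x\<in>L. 0 < q x" "\<forall>y\<in>L. (\<Sum>x\<in>L. q x * w x y) = \<rho> * q y"
    using class_perron_vector[OF aV La rad[symmetric]] by auto
  note q = bspec[OF q'(1)] bspec[OF q'(2)]
  have outer: "\<exists>\<beta>>0. \<forall>s\<in>?I. \<beta> / (1 - \<rho> * s) ^ length Ls
      \<le> (\<Sum>b\<in>L. q b * (1 + s * (\<Sum>z\<in>V - L. w b z * G s z)))"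
  proof (cases "Ls = []")
    \<comment> \<open>For the last class of the chain the constant 1 in the equation for
      \<open>G\<close> already provides the bound.\<close>
    case True
    have "q a \<le> (\<Sum>b\<in>L. q b * (1 + s * (\<Sum>z\<in>V - L. w b z * G s z)))" if "s \<in> ?I" for s
    proof -
      have "q a \<le> q a * (1 + s * (\<Sum>z\<in>V - L. w a z * G s z))"
        using q(1)[OF a(1)] outer_term_nonneg[OF C upper_half_subset[OF that] a(1)] by simp
      also have "\<dots> \<le> (\<Sum>b\<in>L. q b * (1 + s * (\<Sum>z\<in>V - L. w b z * G s z)))"
        using finL a(1) q(1) outer_term_nonneg[OF C upper_half_subset[OF that]]
        by (intro member_le_sum) (auto intro!: mult_nonneg_nonneg add_nonneg_nonneg simp: less_imp_le)
      finally show ?thesis .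
    qed
    then show ?thesis using True q(1)[OF a(1)] by (intro exI[of _ "q a"]) auto
  next
    case False
    then have ch: "L \<notin> set Ls" "class_access V w L (hd Ls)" "basic_chain V w Ls"
      using chain by (auto simp: basic_chain_Cons)
    then obtain b0 y where b0y: "b0 \<in> L" "y \<in> hd Ls" "accessible V w b0 y"
      by (auto simp: class_access_def)
    \<comment> \<open>Classes meeting in a vertex coincide, so \<open>y \<in> L\<close> would put
      \<open>L\<close> on the rest of the chain.\<close>
    have "y \<notin> L"
    proof
      assume "y \<in> L"
      then have "L = hd Ls"
        using basic_class_eq[OF L] basic_class_eq[OF basic_chain_hd[OF ch(3)] b0y(2)] by metis
      then show False using ch(1) False by simp
    qed
    then obtain b z where bz: "b \<in> L" "z \<in> V - L" "0 < w b z" "accessible V w z y"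
      using access_class_exit[OF b0y(3), of a] b0y(1) unfolding La by blast
    have "reaches_chain z Ls" using bz(4) b0y(2) ch(3) by (auto simp: reaches_chain_def)
    then obtain c where c: "0 < c" "\<And>s. s \<in> ?I \<Longrightarrow> c / (1 - \<rho> * s) ^ length Ls \<le> G s z"
      using Cons.IH by blast
    have "(q b / (2 * \<rho>) * w b z * c) / (1 - \<rho> * s) ^ length Ls
        \<le> (\<Sum>b\<in>L. q b * (1 + s * (\<Sum>z\<in>V - L. w b z * G s z)))" if s: "s \<in> ?I" for s
    proof -
      note s' = upper_half_subset[OF s]
      have qb: "0 < q b" using q(1) bz(1) by simp
      have "(q b / (2 * \<rho>) * w b z * c) / (1 - \<rho> * s) ^ length Ls
          = q b * (1 / (2 * \<rho>) * (w b z * (c / (1 - \<rho> * s) ^ length Ls)))" by simp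
      also have "\<dots> \<le> q b * (s * (w b z * G s z))"
        using qb s c(2)[OF s] c(1) bz(3) rho_pos subcritical[OF s'] G_pos[OF s', of z] bz(2)
        by (intro mult_left_mono mult_mono) auto
      also have "\<dots> \<le> q b * (s * (\<Sum>z\<in>V - L. w b z * G s z))"
        using qb s' bz subsetD[OF C] weight_G_nonneg[OF s'] finite_V
        by (intro mult_left_mono member_le_sum) simp_all
      also have "\<dots> \<le> q b * (1 + s * (\<Sum>z\<in>V - L. w b z * G s z))"
        using qb by simp
      also have "\<dots> \<le> (\<Sum>b\<in>L. q b * (1 + s * (\<Sum>z\<in>V - L. w b z * G s z)))"
        using finL bz(1) q(1) outer_term_nonneg[OF C s']
        by (intro member_le_sum) (auto intro!: mult_nonneg_nonneg add_nonneg_nonneg simp: less_imp_le)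
      finally show ?thesis .
    qed
    then show ?thesis using q(1)[OF bz(1)] bz(3) c(1) rho_pos
      by (intro exI[of _ "q b / (2 * \<rho>) * w b z * c"]) auto
  qed
  then obtain \<beta> where \<beta>: "0 < \<beta>" "\<And>s. s \<in> ?I \<Longrightarrow> \<beta> / (1 - \<rho> * s) ^ length Ls
      \<le> (\<Sum>b\<in>L. q b * (1 + s * (\<Sum>z\<in>V - L. w b z * G s z)))" by blast
  have "\<exists>c>0. \<forall>s\<in>?I. c * G s b \<le> G s x" if "b \<in> L" for b
    using that a(2) accessible_trans
    by (intro growth_along_path) (auto simp: La access_class_def)
  then obtain c where c: "\<And>b. b \<in> L \<Longrightarrow> 0 < c b" "\<And>b s. b \<in> L \<Longrightarrow> s \<in> ?I \<Longrightarrow> c b * G s b \<le> G s x"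
    by metis
  \<comment> \<open>From \<open>c b * G s b \<le> G s x\<close>, the eigenvector-weighted sum over
    \<open>L\<close> is at most \<open>K * G s x\<close>.\<close>
  define K where "K = (\<Sum>b\<in>L. q b / c b)"
  have K: "0 < K" unfolding K_def using finL a(1) q(1) c(1) by (intro sum_pos) auto
  have "\<beta> / K / (1 - \<rho> * s) ^ length (L # Ls) \<le> G s x" if s: "s \<in> ?I" for s
  proof -
    note s' = upper_half_subset[OF s] and sub = subcritical[OF upper_half_subset[OF s]]
    have "(\<Sum>b\<in>L. q b * G s b) \<le> (\<Sum>b\<in>L. q b / c b * G s x)"
    proof (rule sum_mono)
      fix b assume b: "b \<in> L"
      have "q b / c b * (c b * G s b) \<le> q b / c b * G s x"
        using c(2)[OF b s] q(1)[OF b] c(1)[OF b] by (intro mult_left_mono) auto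
      then show "q b * G s b \<le> q b / c b * G s x" using c(1)[OF b] by simp
    qed
    then have "(\<Sum>b\<in>L. q b * G s b) \<le> K * G s x" by (simp add: K_def sum_distrib_right)
    then have "(1 - \<rho> * s) * (\<Sum>b\<in>L. q b * G s b) \<le> (1 - \<rho> * s) * (K * G s x)"
      using sub by (intro mult_left_mono) auto
    then have "\<beta> / (1 - \<rho> * s) ^ length Ls \<le> (1 - \<rho> * s) * (K * G s x)"
      using \<beta>(2)[OF s] left_eigenvector_identity[OF C s' q(2)] by simp
    then show ?thesis using K sub by (simp add: field_simps)
  qed
  then show ?case using \<beta>(1) K by (intro exI[of _ "\<beta> / K"]) auto
qed

section \<open>Limits at the critical parameter\<close>

lemma limit_zero_if_bounded:
  assumes lim: "((\<lambda>s. (1 - \<rho> * s) ^ h * G s x) \<longlongrightarrow> l) critical" and "x \<in> V" "n < h"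
    and bound: "\<forall>s\<in>{0<..<1 / \<rho>}. G s x \<le> d / (1 - \<rho> * s) ^ n"
  shows "l = 0"
proof -
  have "((\<lambda>s. (1 - \<rho> * s) ^ (h - n) * d) \<longlongrightarrow> 0 ^ (h - n) * d) critical"
    by (intro tendsto_mult_right tendsto_power tendsto_gap)
  then have lim0: "((\<lambda>s. (1 - \<rho> * s) ^ (h - n) * d) \<longlongrightarrow> 0) critical"
    using assms(3) by (simp add: power_0_left)
  have ev: "(1 - \<rho> * s) ^ h * G s x \<le> (1 - \<rho> * s) ^ (h - n) * d" "0 \<le> (1 - \<rho> * s) ^ h * G s x"
    if s: "s \<in> {0<..<1 / \<rho>}" for s
  proof -
    note sub = subcritical[OF s]
    have h: "(1 - \<rho> * s) ^ h = (1 - \<rho> * s) ^ (h - n) * (1 - \<rho> * s) ^ n"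
      using assms(3) by (simp flip: power_add)
    have "G s x * (1 - \<rho> * s) ^ n \<le> d"
      using bspec[OF bound s] zero_less_power[OF sub(3)] by (simp only: pos_le_divide_eq)
    then have "(1 - \<rho> * s) ^ (h - n) * (G s x * (1 - \<rho> * s) ^ n) \<le> (1 - \<rho> * s) ^ (h - n) * d"
      using sub by (intro mult_left_mono) auto
    then show "(1 - \<rho> * s) ^ h * G s x \<le> (1 - \<rho> * s) ^ (h - n) * d"
      unfolding h by (simp only: ac_simps)
    show "0 \<le> (1 - \<rho> * s) ^ h * G s x" using sub G_pos[OF s assms(2)] by simp
  qed
  have "l \<le> 0"
    by (rule tendsto_le[OF critical_neq_bot lim0 lim]) (auto intro!: eventually_critical ev)
  moreover have "0 \<le> l"
    by (rule tendsto_lowerbound[OF lim _ critical_neq_bot]) (auto intro!: eventually_critical ev)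
  ultimately show ?thesis by simp
qed

text \<open>If \<open>n\<close> exceeded \<open>h\<close>, the scaled quantity would tend to 0
  although it stays above \<open>c\<close>; so \<open>n = h\<close>, and then the limit itself is at
  least \<open>c\<close>.\<close>

lemma limit_pos_if_growing:
  assumes lim: "((\<lambda>s. (1 - \<rho> * s) ^ h * G s x) \<longlongrightarrow> l) critical" and "0 < c" "h \<le> n"
    and bound: "\<forall>s\<in>{1 / (2 * \<rho>)<..<1 / \<rho>}. c / (1 - \<rho> * s) ^ n \<le> G s x"
  shows "n = h \<and> 0 < l"
proof -
  have "((\<lambda>s. (1 - \<rho> * s) ^ (n - h) * ((1 - \<rho> * s) ^ h * G s x)) \<longlongrightarrow> 0 ^ (n - h) * l) critical"
    by (intro tendsto_mult lim tendsto_power tendsto_gap)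
  moreover have "\<forall>\<^sub>F s in critical. c \<le> (1 - \<rho> * s) ^ (n - h) * ((1 - \<rho> * s) ^ h * G s x)"
  proof (rule eventually_critical_upper)
    fix s assume s: "s \<in> {1 / (2 * \<rho>)<..<1 / \<rho>}"
    note sub = subcritical[OF upper_half_subset[OF s]]
    have "c \<le> G s x * (1 - \<rho> * s) ^ n"
      using bspec[OF bound s] zero_less_power[OF sub(3)] by (simp only: pos_divide_le_eq)
    also have "\<dots> = (1 - \<rho> * s) ^ (n - h) * ((1 - \<rho> * s) ^ h * G s x)"
      using assms(3) by (simp add: ac_simps flip: power_add)
    finally show "c \<le> (1 - \<rho> * s) ^ (n - h) * ((1 - \<rho> * s) ^ h * G s x)" .
  qed
  ultimately have "c \<le> 0 ^ (n - h) * l"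
    by (intro tendsto_lowerbound[OF _ _ critical_neq_bot])
  then show ?thesis using assms(2,3) by (cases "n = h") (auto simp: power_0_left)
qed

lemma spanned_umbrella_eq:
  assumes "x0 \<in> V" "\<forall>y\<in>V. accessible V w x0 y"
  shows "spanned_umbrella V w x0 = {y \<in> V. \<exists>Ls. dominant_chain V w Ls \<and> reaches_chain y Ls}"
proof -
  have "accessible_from V w x0 = V" using assms by (auto simp: accessible_from_def)
  then show ?thesis
    by (auto simp: spanned_umbrella_def reaches_chain_def dominant_chain_def)
qed

lemma dominant_chain_exists:
  assumes "basic_chain V w Ls"
  obtains Ms where "dominant_chain V w Ms"
proof -
  have "finite (basic_classes V w)"
    unfolding basic_classes_def access_classes_eq using finite_V by auto
  then have "length Ms \<le> card (basic_classes V w)" if "basic_chain V w Ms" for Ms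
    using that card_mono[of "basic_classes V w" "set Ms"] distinct_card[of Ms]
    by (auto simp: basic_chain_def)
  then obtain Ms where "basic_chain V w Ms" "\<forall>Ns. basic_chain V w Ns \<longrightarrow> length Ns \<le> length Ms"
    using ex_has_greatest_nat[of "basic_chain V w" Ls length "Suc (card (basic_classes V w))"] assms
    by (auto simp: less_Suc_eq_le)
  then show ?thesis using that by (auto simp: dominant_chain_def)
qed

text \<open>The growth exponent of \<open>G\<close> at a vertex is the largest length of a chain of basic classes that it
  reaches; the scale \<open>h\<close> of the residual matrix is therefore the height.\<close>

lemma residual_support:
  assumes x0: "x0 \<in> V" "\<forall>y\<in>V. accessible V w x0 y"
    and h: "0 < h" and lim: "\<And>x. x \<in> V \<Longrightarrow> ((\<lambda>s. (1 - \<rho> * s) ^ h * G s x) \<longlongrightarrow> g x) critical"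
    and ne: "\<exists>x\<in>V. g x \<noteq> 0"
  shows "x \<in> spanned_umbrella V w x0 \<Longrightarrow> 0 < g x"
    "x \<in> V \<Longrightarrow> x \<notin> spanned_umbrella V w x0 \<Longrightarrow> g x = 0"
    "x0 \<in> spanned_umbrella V w x0"
proof -
  obtain x1 where x1: "x1 \<in> V" "g x1 \<noteq> 0" using ne by auto
  \<comment> \<open>The existence of a basic class comes from the residual matrix: with no chain at
    all the bound with exponent 0 applies, \<open>G\<close> stays bounded at \<open>x1\<close>, and
    \<open>g x1\<close> would vanish because \<open>h > 0\<close>.\<close>
  have "\<exists>Ls. basic_chain V w Ls"
  proof (rule ccontr)
    assume "\<nexists>Ls. basic_chain V w Ls"
    then have "\<exists>d. \<forall>s\<in>{0<..<1 / \<rho>}. G s x1 \<le> d / (1 - \<rho> * s) ^ 0"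
      by (intro growth_upper_bound x1) (auto simp: reaches_chain_def)
    then show False using limit_zero_if_bounded[OF lim[OF x1(1)] x1(1) h] x1(2) by blast
  qed
  then obtain Ls where Ls: "dominant_chain V w Ls" using dominant_chain_exists by blast
  define N where "N = length Ls"
  have max: "length Ms \<le> N" if "basic_chain V w Ms" for Ms
    using that Ls by (simp add: dominant_chain_def N_def)
  have chain: "basic_chain V w Ls" using Ls by (simp add: dominant_chain_def)
  have N: "0 < N" using chain by (simp add: basic_chain_def N_def)
  \<comment> \<open>Growth is of order at most \<open>N\<close> everywhere, while the limit at
    \<open>x1\<close> on the scale \<open>h\<close> is nonzero.\<close>
  have hN: "h \<le> N"
  proof (rule ccontr)
    assume "\<not> h \<le> N"
    moreover have "\<exists>d. \<forall>s\<in>{0<..<1 / \<rho>}. G s x1 \<le> d / (1 - \<rho> * s) ^ N"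
      by (intro growth_upper_bound x1) (auto simp: reaches_chain_def max)
    ultimately show False
      using limit_zero_if_bounded[OF lim[OF x1(1)] x1(1)] x1(2) by (metis not_le)
  qed
  obtain z where z: "z \<in> hd Ls" using basic_class_nonempty[OF basic_chain_hd[OF chain]] by auto
  have "z \<in> V" using basic_class_eq[OF basic_chain_hd[OF chain] z] by simp
  then have "reaches_chain x0 Ls" using x0 z chain by (auto simp: reaches_chain_def)
  then show x0U: "x0 \<in> spanned_umbrella V w x0"
    using Ls x0 by (auto simp: spanned_umbrella_eq[OF x0])
  \<comment> \<open>On the umbrella the lower bound has exponent \<open>N \<ge> h\<close>; a finite
    limit then forces \<open>N = h\<close> as well.\<close>
  have pos: "N = h \<and> 0 < g x" if U: "x \<in> spanned_umbrella V w x0" for x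
  proof -
    obtain Ms where Ms: "dominant_chain V w Ms" "reaches_chain x Ms" and x: "x \<in> V"
      using U by (auto simp: spanned_umbrella_eq[OF x0])
    have "length Ms = N"
      using Ms(1) chain max[of Ms] by (auto simp: dominant_chain_def N_def intro: antisym)
    then show ?thesis
      using growth_lower_bound[OF Ms(2)] limit_pos_if_growing[OF lim[OF x] _ hN] by auto
  qed
  show "0 < g x" if "x \<in> spanned_umbrella V w x0" using pos[OF that] by simp
  show "g x = 0" if x: "x \<in> V" "x \<notin> spanned_umbrella V w x0"
  proof -
    \<comment> \<open>Off the umbrella no chain of length \<open>N\<close> is reached, which leaves
      the growth exponent strictly below \<open>h\<close>.\<close>
    have "length Ms \<le> N - 1" if Ms: "reaches_chain x Ms" for Ms
    proof -
      have "\<not> dominant_chain V w Ms" using x Ms by (auto simp: spanned_umbrella_eq[OF x0])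
      moreover have "basic_chain V w Ms" using Ms by (simp add: reaches_chain_def)
      ultimately have "length Ms \<noteq> N" using max by (auto simp: dominant_chain_def)
      then show ?thesis using max[OF \<open>basic_chain V w Ms\<close>] by simp
    qed
    then obtain d where "\<forall>s\<in>{0<..<1 / \<rho>}. G s x \<le> d / (1 - \<rho> * s) ^ (N - 1)"
      using growth_upper_bound[OF x(1)] by metis
    moreover have "N - 1 < h" using pos[OF x0U] h by simp
    ultimately show ?thesis by (intro limit_zero_if_bounded[OF lim[OF x(1)] x(1)])
  qed
qed

text \<open>Multiply \<open>G = 1 + s F G\<close> by the \<open>h\<close>-th power of the gap and
  pass to the limit; the term 1 disappears because \<open>h > 0\<close>.\<close>

lemma residual_eigenvector:
  assumes h: "0 < h" and lim: "\<And>x. x \<in> V \<Longrightarrow> ((\<lambda>s. (1 - \<rho> * s) ^ h * G s x) \<longlongrightarrow> g x) critical"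
    and x: "x \<in> V"
  shows "(\<Sum>y\<in>V. w x y * g y) = \<rho> * g x"
proof -
  have "((\<lambda>s. (1 - \<rho> * s) ^ h + s * (\<Sum>y\<in>V. w x y * ((1 - \<rho> * s) ^ h * G s y)))
      \<longlongrightarrow> 0 ^ h + 1 / \<rho> * (\<Sum>y\<in>V. w x y * g y)) critical"
    by (intro tendsto_add tendsto_mult tendsto_sum tendsto_power tendsto_gap tendsto_ident_critical
        tendsto_const lim)
  moreover have "\<forall>\<^sub>F s in critical. (1 - \<rho> * s) ^ h + s * (\<Sum>y\<in>V. w x y * ((1 - \<rho> * s) ^ h * G s y))
      = (1 - \<rho> * s) ^ h * G s x"
    by (rule eventually_critical) (simp add: G_eq[OF _ x] algebra_simps sum_distrib_left)
  ultimately have "((\<lambda>s. (1 - \<rho> * s) ^ h * G s x) \<longlongrightarrow> 0 ^ h + 1 / \<rho> * (\<Sum>y\<in>V. w x y * g y)) critical"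
    by (rule Lim_transform_eventually)
  then have "g x = 0 ^ h + 1 / \<rho> * (\<Sum>y\<in>V. w x y * g y)"
    using tendsto_unique[OF critical_neq_bot lim[OF x]] by blast
  then show ?thesis using h rho_pos by (simp add: power_0_left field_simps)
qed

lemma path_gf_ratio_tendsto:
  assumes lim: "\<And>x. x \<in> V \<Longrightarrow> ((\<lambda>s. (1 - \<rho> * s) ^ h * G s x) \<longlongrightarrow> g x) critical"
    and "x \<in> V" "y \<in> V" "g x \<noteq> 0"
  shows "((\<lambda>s. G s y / G s x) \<longlongrightarrow> g y / g x) critical"
proof -
  have "((\<lambda>s. ((1 - \<rho> * s) ^ h * G s y) / ((1 - \<rho> * s) ^ h * G s x)) \<longlongrightarrow> g y / g x) critical"
    by (intro tendsto_divide lim assms)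
  moreover have "((1 - \<rho> * s) ^ h * G s y) / ((1 - \<rho> * s) ^ h * G s x) = G s y / G s x"
    if "s \<in> {0<..<1 / \<rho>}" for s
    using subcritical[OF that] by simp
  then have "\<forall>\<^sub>F s in critical. ((1 - \<rho> * s) ^ h * G s y) / ((1 - \<rho> * s) ^ h * G s x) = G s y / G s x"
    by (rule eventually_critical)
  ultimately show ?thesis by (rule Lim_transform_eventually)
qed

text \<open>A nonzero limit on a positive scale means that \<open>G\<close> diverges at
  \<open>x\<close>; this is what drives the mass of each single finite path to 0.\<close>

lemma path_gf_inverse_tendsto_0:
  assumes h: "0 < h" and lim: "((\<lambda>s. (1 - \<rho> * s) ^ h * G s x) \<longlongrightarrow> l) critical"
    and "l \<noteq> 0"
  shows "((\<lambda>s. 1 / G s x) \<longlongrightarrow> 0) critical"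
proof -
  have "((\<lambda>s. (1 - \<rho> * s) ^ h / ((1 - \<rho> * s) ^ h * G s x)) \<longlongrightarrow> 0 ^ h / l) critical"
    by (intro tendsto_divide tendsto_power tendsto_gap lim assms)
  moreover have "(1 - \<rho> * s) ^ h / ((1 - \<rho> * s) ^ h * G s x) = 1 / G s x"
    if "s \<in> {0<..<1 / \<rho>}" for s
    using subcritical[OF that] by simp
  then have "\<forall>\<^sub>F s in critical. (1 - \<rho> * s) ^ h / ((1 - \<rho> * s) ^ h * G s x) = 1 / G s x"
    by (rule eventually_critical)
  ultimately have "((\<lambda>s. 1 / G s x) \<longlongrightarrow> 0 ^ h / l) critical" by (rule Lim_transform_eventually)
  then show ?thesis using h by (simp add: power_0_left)
qed

end

section \<open>Sequence spaces over a finite alphabet\<close>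

text \<open>Cylinder sets of the product topology, indexed by a centre. Only the first
  \<open>n\<close> entries of the centre count and it may lie outside \<open>\<Omega>\<close>, so a
  list read with \<open>!\<close> can serve as well.\<close>

definition cell :: "(nat \<Rightarrow> 'b) set \<Rightarrow> nat \<Rightarrow> (nat \<Rightarrow> 'b) \<Rightarrow> (nat \<Rightarrow> 'b) set" where
  "cell \<Omega> n \<omega> = {\<omega>' \<in> \<Omega>. \<forall>i<n. \<omega>' i = \<omega> i}"

definition cells :: "(nat \<Rightarrow> 'b) set \<Rightarrow> nat \<Rightarrow> (nat \<Rightarrow> 'b) set set" where
  "cells \<Omega> n = cell \<Omega> n ` \<Omega>"

lemma cell_self: "\<omega> \<in> \<Omega> \<Longrightarrow> \<omega> \<in> cell \<Omega> n \<omega>"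
  by (simp add: cell_def)

lemma cell_subset: "cell \<Omega> n \<omega> \<subseteq> \<Omega>"
  by (auto simp: cell_def)

lemma cell_mono: "m \<le> n \<Longrightarrow> cell \<Omega> n \<omega> \<subseteq> cell \<Omega> m \<omega>"
  by (auto simp: cell_def)

lemma cell_eq: "\<omega>' \<in> cell \<Omega> n \<omega> \<Longrightarrow> cell \<Omega> n \<omega>' = cell \<Omega> n \<omega>"
  by (auto simp: cell_def)

lemma cell_0: "cell \<Omega> 0 \<omega> = \<Omega>"
  by (simp add: cell_def)

text \<open>Two cells with a common point are both centred at it, hence nested. The empty set
  accounts for disjoint cells.\<close>

lemma Int_stable_cells: "Int_stable (insert {} (\<Union>n. cells \<Omega> n))"
proof (rule Int_stableI)
  let ?E = "insert {} (\<Union>n. cells \<Omega> n)"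
  fix A B assume AB: "A \<in> ?E" "B \<in> ?E"
  show "A \<inter> B \<in> ?E"
  proof (cases "A \<inter> B = {}")
    case False
    then obtain \<omega> where w: "\<omega> \<in> A" "\<omega> \<in> B" by auto
    have ex: "\<exists>n. C = cell \<Omega> n \<omega>" if C: "C \<in> ?E" "\<omega> \<in> C" for C
    proof -
      obtain n a where "C = cell \<Omega> n a" using C by (auto simp: cells_def)
      then show ?thesis using cell_eq[of \<omega> \<Omega> n a] C(2) by metis
    qed
    obtain m n where mn: "A = cell \<Omega> m \<omega>" "B = cell \<Omega> n \<omega>"
      using ex[OF AB(1) w(1)] ex[OF AB(2) w(2)] by auto
    have "A \<inter> B = cell \<Omega> (max m n) \<omega>" unfolding mn by (auto simp: cell_def less_max_iff_disj)
    moreover have "\<omega> \<in> \<Omega>" using w(1) mn cell_subset by auto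
    ultimately show ?thesis by (auto simp: cells_def)
  qed simp
qed

text \<open>Serves twice: with a vertex set as alphabet for infinite paths, and with
  \<open>V\<close> extended by \<open>None\<close> for the space of all paths.\<close>

locale sequence_space =
  fixes D :: "'b set" and \<Omega> :: "(nat \<Rightarrow> 'b) set"
  assumes finite_D: "finite D" and in_D: "\<And>\<omega> i. \<omega> \<in> \<Omega> \<Longrightarrow> \<omega> i \<in> D"
begin

definition seq_topology :: "(nat \<Rightarrow> 'b) topology" where
  "seq_topology = subtopology (product_topology (\<lambda>_. discrete_topology D) UNIV) \<Omega>"

lemma topspace_seq: "topspace seq_topology = \<Omega>"
  using in_D by (auto simp: seq_topology_def)

lemma openin_cell:
  assumes "\<omega> \<in> \<Omega>"
  shows "openin seq_topology (cell \<Omega> n \<omega>)"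
proof -
  define U where "U i = (if i < n then {\<omega> i} else D)" for i :: nat
  have "{i \<in> UNIV. U i \<noteq> topspace (discrete_topology D)} \<subseteq> {..<n}" by (auto simp: U_def)
  then have "finite {i \<in> UNIV. U i \<noteq> topspace (discrete_topology D)}"
    by (rule finite_subset) simp
  then have "openin (product_topology (\<lambda>_. discrete_topology D) UNIV) (Pi\<^sub>E UNIV U)"
    using in_D[OF assms] by (subst openin_PiE_gen) (auto simp: U_def)
  moreover have "cell \<Omega> n \<omega> = Pi\<^sub>E UNIV U \<inter> \<Omega>"
    using in_D by (auto simp: cell_def U_def PiE_UNIV_domain Pi_def split: if_splits)
  ultimately show ?thesis by (auto simp: seq_topology_def openin_subtopology)
qed

text \<open>A basic open set of the product constrains finitely many coordinates; beyond the largest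
  of them any continuation is allowed.\<close>

lemma open_contains_cell:
  assumes "openin seq_topology A" "\<omega> \<in> A"
  shows "\<exists>n. cell \<Omega> n \<omega> \<subseteq> A"
proof -
  obtain T where T: "openin (product_topology (\<lambda>_. discrete_topology D) UNIV) T" "A = T \<inter> \<Omega>"
    using assms(1) by (auto simp: seq_topology_def openin_subtopology)
  then obtain U where U: "finite {i. U i \<noteq> D}" "\<omega> \<in> Pi\<^sub>E UNIV U" "Pi\<^sub>E UNIV U \<subseteq> T"
    using assms(2) unfolding openin_product_topology_alt by fastforce
  obtain n where n: "\<And>i. U i \<noteq> D \<Longrightarrow> i < n"
    using finite_nat_bounded[OF U(1)] by auto
  have "\<omega>' \<in> A" if w: "\<omega>' \<in> cell \<Omega> n \<omega>" for \<omega>'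
  proof -
    have "\<omega>' i \<in> U i" for i
    proof (cases "U i = D")
      case True
      then show ?thesis using w in_D by (auto simp: cell_def)
    next
      case False
      then show ?thesis using w n U(2) by (auto simp: cell_def PiE_iff)
    qed
    then show ?thesis using U(3) w T(2) by (auto simp: cell_def PiE_iff)
  qed
  then show ?thesis by blast
qed

lemma finite_cells: "finite (cells \<Omega> n)"
proof -
  have "cells \<Omega> n \<subseteq> (\<lambda>l. cell \<Omega> n (\<lambda>i. l ! i)) ` {l. set l \<subseteq> D \<and> length l = n}"
  proof
    fix C assume "C \<in> cells \<Omega> n"
    then obtain \<omega> where w: "\<omega> \<in> \<Omega>" "C = cell \<Omega> n \<omega>" by (auto simp: cells_def)
    have "C = cell \<Omega> n (\<lambda>i. map \<omega> [0..<n] ! i)" by (auto simp: cell_def w(2))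
    then show "C \<in> (\<lambda>l. cell \<Omega> n (\<lambda>i. l ! i)) ` {l. set l \<subseteq> D \<and> length l = n}"
      by (rule image_eqI) (auto simp: in_D[OF w(1)])
  qed
  then show ?thesis
    by (rule finite_subset) (intro finite_imageI finite_lists_length_eq finite_D)
qed

text \<open>There are only finitely many cells of each depth, so the cells inside an open set form a
  countable cover of it.\<close>

lemma open_in_sigma_cells:
  assumes "openin seq_topology A"
  shows "A \<in> sigma_sets \<Omega> (insert {} (\<Union>n. cells \<Omega> n))"
proof -
  let ?S = "{C \<in> (\<Union>n. cells \<Omega> n). C \<subseteq> A}"
  have "A = \<Union> ?S"
  proof
    show "A \<subseteq> \<Union> ?S"
    proof
      fix \<omega> assume w: "\<omega> \<in> A"
      then obtain n where "cell \<Omega> n \<omega> \<subseteq> A" using open_contains_cell[OF assms] by auto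
      moreover have "\<omega> \<in> \<Omega>" using w openin_subset[OF assms] topspace_seq by auto
      ultimately show "\<omega> \<in> \<Union> ?S" using cell_self by (fastforce simp: cells_def)
    qed
  qed auto
  moreover have "countable (\<Union>n. cells \<Omega> n)"
    by (rule countable_UN) (auto intro: countable_finite[OF finite_cells])
  then have "countable ?S"
    by (rule countable_subset[rotated]) auto
  then have "\<Union> ?S \<in> sigma_sets \<Omega> (insert {} (\<Union>n. cells \<Omega> n))"
    by (rule sigma_sets_UNION) auto
  ultimately show ?thesis by simp
qed

lemma cells_subset_Pow: "insert {} (\<Union>n. cells \<Omega> n) \<subseteq> Pow \<Omega>"
  using cell_subset by (auto simp: cells_def)

lemma sets_borel_of_seq: "sets (borel_of seq_topology) = sigma_sets \<Omega> (insert {} (\<Union>n. cells \<Omega> n))"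
proof -
  have "{A. openin seq_topology A} \<subseteq> Pow \<Omega>" using openin_subset[of seq_topology] topspace_seq by auto
  then have "sets (borel_of seq_topology) = sigma_sets \<Omega> {A. openin seq_topology A}"
    by (simp add: borel_of_def topspace_seq)
  also have "\<dots> = sigma_sets \<Omega> (insert {} (\<Union>n. cells \<Omega> n))"
  proof (rule sigma_sets_eqI)
    show "A \<in> sigma_sets \<Omega> (insert {} (\<Union>n. cells \<Omega> n))" if "A \<in> {A. openin seq_topology A}" for A
      using that by (intro open_in_sigma_cells) simp
    show "A \<in> sigma_sets \<Omega> {A. openin seq_topology A}" if "A \<in> insert {} (\<Union>n. cells \<Omega> n)" for A
      using that openin_cell by (intro sigma_sets.Basic) (auto simp: cells_def)
  qed
  finally show ?thesis .
qed

lemma space_borel_of_seq: "space (borel_of seq_topology) = \<Omega>"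
  using openin_subset[of seq_topology]
  by (simp add: borel_of_def topspace_seq space_measure_of_conv)

lemma borel_prob_eqI:
  assumes "borel_prob_on seq_topology M" "borel_prob_on seq_topology N"
    and "\<And>n \<omega>. \<omega> \<in> \<Omega> \<Longrightarrow> measure M (cell \<Omega> n \<omega>) = measure N (cell \<Omega> n \<omega>)"
  shows "M = N"
proof -
  interpret M: prob_space M using assms(1) by (simp add: borel_prob_on_def)
  interpret N: prob_space N using assms(2) by (simp add: borel_prob_on_def)
  have spM: "space M = \<Omega>" using assms(1) by (simp add: borel_prob_on_def topspace_seq)
  \<comment> \<open>\<open>\<Omega>\<close> itself must belong to the generator, as the cell of
    depth 0 around some point; such a point exists because a probability space is nonempty.\<close>
  then obtain \<omega> where w: "\<omega> \<in> \<Omega>" using M.not_empty by auto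
  show ?thesis
  proof (rule measure_eqI_generator_eq[where A = "\<lambda>_. \<Omega>", OF Int_stable_cells cells_subset_Pow])
    show "emeasure M A = emeasure N A" if "A \<in> insert {} (\<Union>n. cells \<Omega> n)" for A
      using that assms(3) by (auto simp: cells_def M.emeasure_eq_measure N.emeasure_eq_measure)
    show "range (\<lambda>_. \<Omega>) \<subseteq> insert {} (\<Union>n. cells \<Omega> n)"
      using w cell_0[of \<Omega> \<omega>] by (auto simp: cells_def)
  qed (use assms in \<open>auto simp: borel_prob_on_def sets_borel_of_seq\<close>)
qed

lemma measurable_cellsI:
  assumes "\<And>z. z \<in> space M \<Longrightarrow> f z \<in> \<Omega>"
    and "\<And>n \<omega>. \<omega> \<in> \<Omega> \<Longrightarrow> f -` cell \<Omega> n \<omega> \<inter> space M \<in> sets M"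
  shows "f \<in> measurable M (borel_of seq_topology)"
proof -
  have "f \<in> measurable M (sigma \<Omega> (insert {} (\<Union>n. cells \<Omega> n)))"
    using assms by (intro measurable_measure_of cells_subset_Pow) (auto simp: cells_def)
  moreover have "sets (borel_of seq_topology) = sets (sigma \<Omega> (insert {} (\<Union>n. cells \<Omega> n)))"
    using cells_subset_Pow by (simp add: sets_borel_of_seq)
  ultimately show ?thesis using measurable_cong_sets by blast
qed

section \<open>Weak convergence from convergence on cells\<close>

context
  fixes f :: "(nat \<Rightarrow> 'b) \<Rightarrow> real" and B :: real
  assumes cont: "continuous_map seq_topology euclideanreal f" and B: "\<And>\<omega>. \<omega> \<in> \<Omega> \<Longrightarrow> \<bar>f \<omega>\<bar> \<le> B"
begin

text \<open>By continuity the infima of \<open>f\<close> over the cells around a point increase to its value there.  Bounding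
  \<open>f\<close> below by these step functions replaces a uniform approximation, which would need compactness.\<close>

definition lower_step :: "nat \<Rightarrow> (nat \<Rightarrow> 'b) \<Rightarrow> real" where
  "lower_step n \<omega> = Inf (f ` cell \<Omega> n \<omega>)"

lemma lower_step_bounds:
  assumes "\<omega> \<in> \<Omega>"
  shows "lower_step n \<omega> \<le> f \<omega>" "\<bar>lower_step n \<omega>\<bar> \<le> B"
proof -
  have lb: "- B \<le> f \<omega>'" if "\<omega>' \<in> cell \<Omega> n \<omega>" for \<omega>'
    using that B[of \<omega>'] cell_subset[of \<Omega> n \<omega>] by auto
  have mem: "f \<omega> \<in> f ` cell \<Omega> n \<omega>" using cell_self[OF assms] by blast
  show le: "lower_step n \<omega> \<le> f \<omega>" unfolding lower_step_def
    by (rule cInf_lower[OF mem]) (auto intro!: bdd_belowI[of _ "- B"] lb)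
  have "- B \<le> lower_step n \<omega>" unfolding lower_step_def
    using mem by (intro cInf_greatest) (auto intro: lb)
  then show "\<bar>lower_step n \<omega>\<bar> \<le> B" using le B[OF assms] by linarith
qed

lemma lower_step_tendsto:
  assumes "\<omega> \<in> \<Omega>"
  shows "(\<lambda>n. lower_step n \<omega>) \<longlonglongrightarrow> f \<omega>"
proof (rule LIMSEQ_I)
  fix e :: real assume e: "0 < e"
  have "openin seq_topology {\<omega>' \<in> topspace seq_topology. f \<omega>' \<in> {f \<omega> - e / 2<..}}"
    using cont by (rule openin_continuous_map_preimage) simp
  then obtain n0 where n0: "cell \<Omega> n0 \<omega> \<subseteq> {\<omega>' \<in> topspace seq_topology. f \<omega>' \<in> {f \<omega> - e / 2<..}}"
    using open_contains_cell[of _ \<omega>] assms e topspace_seq by fastforce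
  have "norm (lower_step n \<omega> - f \<omega>) < e" if n: "n \<ge> n0" for n
  proof -
    have "f \<omega> - e / 2 \<le> lower_step n \<omega>" unfolding lower_step_def
    proof (rule cInf_greatest)
      show "f ` cell \<Omega> n \<omega> \<noteq> {}" using cell_self[OF assms] by blast
      fix y assume "y \<in> f ` cell \<Omega> n \<omega>"
      then show "f \<omega> - e / 2 \<le> y" using n0 cell_mono[OF n, of \<Omega> \<omega>] by fastforce
    qed
    then show ?thesis using lower_step_bounds(1)[OF assms, of n] e by simp
  qed
  then show "\<exists>n0. \<forall>n\<ge>n0. norm (lower_step n \<omega> - f \<omega>) < e" by blast
qed

text \<open>Exactly one cell of depth \<open>n\<close> contains a given point. Written this way, the
  integral of the step function is a finite combination of cell masses.\<close>

lemma lower_step_eq_sum: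
  assumes "\<omega> \<in> \<Omega>"
  shows "lower_step n \<omega> = (\<Sum>C\<in>cells \<Omega> n. Inf (f ` C) * indicator C \<omega>)"
proof -
  have "indicator C \<omega> = (if C = cell \<Omega> n \<omega> then 1 else (0::real))" if C: "C \<in> cells \<Omega> n" for C
  proof (cases "\<omega> \<in> C")
    case True
    obtain a where "C = cell \<Omega> n a" using C by (auto simp: cells_def)
    then have "C = cell \<Omega> n \<omega>" using cell_eq[of \<omega> \<Omega> n a] True by metis
    then show ?thesis using True by simp
  next
    case False
    then show ?thesis using cell_self[OF assms] by auto
  qed
  then have "(\<Sum>C\<in>cells \<Omega> n. Inf (f ` C) * indicator C \<omega>)
      = (\<Sum>C\<in>cells \<Omega> n. if C = cell \<Omega> n \<omega> then Inf (f ` C) else 0)"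
    by (intro sum.cong) auto
  also have "\<dots> = lower_step n \<omega>"
    using assms finite_cells by (auto simp: lower_step_def cells_def)
  finally show ?thesis by simp
qed

context
  fixes M :: "(nat \<Rightarrow> 'b) measure"
  assumes M: "borel_prob_on seq_topology M"
begin

lemma space_prob: "space M = \<Omega>"
  using M by (simp add: borel_prob_on_def topspace_seq)

lemma cell_measurable: "C \<in> cells \<Omega> n \<Longrightarrow> C \<in> sets M"
  using M by (auto simp: borel_prob_on_def sets_borel_of_seq intro!: sigma_sets.Basic)

lemma integrable_lower_step: "integrable M (lower_step n)"
    and integral_lower_step:
      "integral\<^sup>L M (lower_step n) = (\<Sum>C\<in>cells \<Omega> n. Inf (f ` C) * measure M C)"
proof -
  interpret prob_space M using M by (simp add: borel_prob_on_def)
  have int: "integrable M (\<lambda>\<omega>. Inf (f ` C) * indicator C \<omega>)" if "C \<in> cells \<Omega> n" for C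
    using cell_measurable[OF that] by (intro integrable_mult_right) (simp add: emeasure_eq_measure)
  have "integrable M (lower_step n)
      \<longleftrightarrow> integrable M (\<lambda>\<omega>. \<Sum>C\<in>cells \<Omega> n. Inf (f ` C) * indicator C \<omega>)"
    by (rule Bochner_Integration.integrable_cong) (auto simp: space_prob lower_step_eq_sum)
  then show "integrable M (lower_step n)" using int by simp
  have "integral\<^sup>L M (lower_step n) = (\<integral>\<omega>. (\<Sum>C\<in>cells \<Omega> n. Inf (f ` C) * indicator C \<omega>) \<partial>M)"
    by (rule Bochner_Integration.integral_cong) (auto simp: space_prob lower_step_eq_sum)
  also have "\<dots> = (\<Sum>C\<in>cells \<Omega> n. Inf (f ` C) * measure M C)"
    using int cell_measurable by (subst Bochner_Integration.integral_sum) auto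
  finally show "integral\<^sup>L M (lower_step n) = (\<Sum>C\<in>cells \<Omega> n. Inf (f ` C) * measure M C)" .
qed

lemma integrable_continuous: "integrable M f"
proof -
  interpret prob_space M using M by (simp add: borel_prob_on_def)
  have "f \<in> borel_measurable M"
  proof (rule borel_measurableI)
    fix S :: "real set" assume "open S"
    then have "openin seq_topology {\<omega> \<in> topspace seq_topology. f \<omega> \<in> S}"
      using cont by (intro openin_continuous_map_preimage) auto
    moreover have "f -` S \<inter> space M = {\<omega> \<in> topspace seq_topology. f \<omega> \<in> S}"
      by (auto simp: space_prob topspace_seq)
    ultimately show "f -` S \<inter> space M \<in> sets M"
      using M by (auto simp: borel_prob_on_def sets_borel_of_seq intro!: open_in_sigma_cells)
  qed
  then show ?thesis
    by (rule integrable_const_bound[rotated, where B = B]) (auto simp: space_prob B intro!: AE_I2)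
qed

lemma integral_lower_step_le: "integral\<^sup>L M (lower_step n) \<le> integral\<^sup>L M f"
  by (rule integral_mono[OF integrable_lower_step integrable_continuous])
    (auto simp: space_prob lower_step_bounds)

lemma integral_lower_step_tendsto: "(\<lambda>n. integral\<^sup>L M (lower_step n)) \<longlonglongrightarrow> integral\<^sup>L M f"
proof -
  interpret prob_space M using M by (simp add: borel_prob_on_def)
  show ?thesis
    by (rule integral_dominated_convergence[where w = "\<lambda>_. B"])
      (auto simp: space_prob lower_step_bounds lower_step_tendsto
        intro!: AE_I2 borel_measurable_integrable[OF integrable_lower_step]
          borel_measurable_integrable[OF integrable_continuous])
qed

end

text \<open>Choose a depth at which the step function already has integral above \<open>y\<close>
  under \<open>N\<close>. Its integral is a finite combination of cell masses, so it converges along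
  \<open>F\<close>, and eventually it lies below the integral of \<open>f\<close> under
  \<open>M s\<close>.\<close>

lemma eventually_integral_greater:
  assumes ev: "\<forall>\<^sub>F s in F. borel_prob_on seq_topology (M s)" and N: "borel_prob_on seq_topology N"
    and lim: "\<And>n \<omega>. \<omega> \<in> \<Omega> \<Longrightarrow>
      ((\<lambda>s. measure (M s) (cell \<Omega> n \<omega>)) \<longlongrightarrow> measure N (cell \<Omega> n \<omega>)) F"
    and y: "y < integral\<^sup>L N f"
  shows "\<forall>\<^sub>F s in F. y < integral\<^sup>L (M s) f"
proof -
  obtain n where n: "y < integral\<^sup>L N (lower_step n)"
    using order_tendstoD(1)[OF integral_lower_step_tendsto[OF N] y]
    by (auto simp: eventually_sequentially)
  have "((\<lambda>s. \<Sum>C\<in>cells \<Omega> n. Inf (f ` C) * measure (M s) C)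
      \<longlongrightarrow> (\<Sum>C\<in>cells \<Omega> n. Inf (f ` C) * measure N C)) F"
    using lim by (intro tendsto_sum tendsto_mult_left) (auto simp: cells_def)
  then have "\<forall>\<^sub>F s in F. y < (\<Sum>C\<in>cells \<Omega> n. Inf (f ` C) * measure (M s) C)"
    using n unfolding integral_lower_step[OF N] by (rule order_tendstoD(1))
  then show ?thesis
    using ev
  proof eventually_elim
    case (elim s)
    then show ?case
      using integral_lower_step_le[OF elim(2), of n] integral_lower_step[OF elim(2), of n] by simp
  qed
qed

end

text \<open>The one-sided estimate applied to \<open>f\<close> and to \<open>- f\<close> gives both
  halves of the limit.\<close>

lemma weakly_convergesI:
  assumes ev: "\<forall>\<^sub>F s in F. borel_prob_on seq_topology (M s)" and N: "borel_prob_on seq_topology N"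
    and lim: "\<And>n \<omega>. \<omega> \<in> \<Omega> \<Longrightarrow>
      ((\<lambda>s. measure (M s) (cell \<Omega> n \<omega>)) \<longlongrightarrow> measure N (cell \<Omega> n \<omega>)) F"
  shows "weakly_converges seq_topology M N F"
  unfolding weakly_converges_def
proof (intro conjI ev N allI impI)
  fix f assume f: "continuous_map seq_topology euclideanreal f \<and> bounded (f ` topspace seq_topology)"
  then obtain B where B: "\<And>\<omega>. \<omega> \<in> \<Omega> \<Longrightarrow> \<bar>f \<omega>\<bar> \<le> B"
    by (auto simp: bounded_iff topspace_seq)
  have cont: "continuous_map seq_topology euclideanreal f" "continuous_map seq_topology euclideanreal (\<lambda>\<omega>. - f \<omega>)"
    using f by (auto intro: continuous_map_minus)
  show "((\<lambda>s. integral\<^sup>L (M s) f) \<longlongrightarrow> integral\<^sup>L N f) F"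
  proof (rule order_tendstoI)
    fix y assume "y < integral\<^sup>L N f"
    then show "\<forall>\<^sub>F s in F. y < integral\<^sup>L (M s) f"
      by (intro eventually_integral_greater[OF cont(1) _ ev N]) (auto intro: B lim)
  next
    fix y assume "integral\<^sup>L N f < y"
    then have "- y < integral\<^sup>L N (\<lambda>\<omega>. - f \<omega>)" by simp
    then have "\<forall>\<^sub>F s in F. - y < integral\<^sup>L (M s) (\<lambda>\<omega>. - f \<omega>)"
      by (intro eventually_integral_greater[OF cont(2) _ ev N]) (auto intro: B lim)
    then show "\<forall>\<^sub>F s in F. integral\<^sup>L (M s) f < y" by simp
  qed
qed

end

section \<open>Markov chains on finite digraphs\<close>

lemma infinite_path_topology_eq:
  "infinite_path_topology V w x = sequence_space.seq_topology V (infinite_paths V w x)"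
  if "finite V"
proof -
  interpret sequence_space V "infinite_paths V w x"
    using that by unfold_locales (auto simp: infinite_paths_def)
  show ?thesis by (simp add: infinite_path_topology_def seq_topology_def)
qed

lemma cylinder_eq_cell: "cylinder V w x u = cell (infinite_paths V w x) (length u) (\<lambda>i. u ! i)"
  by (simp add: cylinder_def cell_def)

lemma finite_path_nth:
  assumes "u \<in> finite_paths V w x"
  shows "u ! 0 = x" "length u = Suc (path_length u)" "last u = u ! path_length u"
    "i \<le> path_length u \<Longrightarrow> u ! i \<in> V" "i < path_length u \<Longrightarrow> 0 < w (u ! i) (u ! Suc i)"
proof -
  have u: "u \<noteq> []" "hd u = x" "set u \<subseteq> V" "successively (\<lambda>y z. 0 < w y z) u"
    using assms by (auto simp: finite_paths_def)
  show "u ! 0 = x" using u by (simp add: hd_conv_nth)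
  show len: "length u = Suc (path_length u)" using u by (simp add: path_length_def)
  show "last u = u ! path_length u" using u by (simp add: last_conv_nth path_length_def)
  show "u ! i \<in> V" if "i \<le> path_length u"
    using u(3) nth_mem[of i u] that len by auto
  show "0 < w (u ! i) (u ! Suc i)" if "i < path_length u"
    using u(4) that len by (simp add: successively_conv_nth)
qed

text \<open>The chain is driven by independent random maps: \<open>Z (n, y)\<close> is the successor that the chain
  chooses if it sits at \<open>y\<close> at time \<open>n\<close>.  A prefix of the trajectory involves distinct indices, so its
  probability is a product.\<close>

definition trajectory :: "'a \<Rightarrow> (nat \<times> 'a \<Rightarrow> 'a) \<Rightarrow> nat \<Rightarrow> 'a" where
  "trajectory x Z = rec_nat x (\<lambda>n y. Z (n, y))"

lemma trajectory_simps [simp]: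
  "trajectory x Z 0 = x" "trajectory x Z (Suc n) = Z (n, trajectory x Z n)"
  by (simp_all add: trajectory_def)

lemma trajectory_prefix_iff:
  assumes "v 0 = x"
  shows "(\<forall>i<Suc m. trajectory x Z i = v i) \<longleftrightarrow> (\<forall>i<m. Z (i, v i) = v (Suc i))"
proof (induction m)
  case 0
  then show ?case using assms by simp
next
  case (Suc m)
  then show ?case by (auto simp: less_Suc_eq)
qed

locale finite_markov_chain =
  fixes U :: "'a set" and w q :: "'a \<Rightarrow> 'a \<Rightarrow> real" and x :: 'a
  assumes finite_U: "finite U" and x: "x \<in> U"
    and q_nonneg: "\<And>y z. y \<in> U \<Longrightarrow> z \<in> U \<Longrightarrow> 0 \<le> q y z"
    and q_sum: "\<And>y. y \<in> U \<Longrightarrow> (\<Sum>z\<in>U. q y z) = 1"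
    and q_support: "\<And>y z. y \<in> U \<Longrightarrow> z \<in> U \<Longrightarrow> q y z \<noteq> 0 \<Longrightarrow> 0 < w y z"
begin

sublocale sequence_space U "infinite_paths U w x"
  using finite_U by unfold_locales (auto simp: infinite_paths_def)

text \<open>Each step is drawn from the successors only, not from all of \<open>U\<close>: every
  trajectory is then an infinite path, without an exceptional null set. The assumption
  \<open>q_support\<close> ensures that no mass is lost.\<close>

definition succs :: "'a \<Rightarrow> 'a set" where
  "succs y = {z \<in> U. 0 < w y z}"

definition step :: "nat \<times> 'a \<Rightarrow> 'a measure" where
  "step i = point_measure (succs (snd i)) (\<lambda>z. ennreal (q (snd i) z))"

definition driver :: "(nat \<times> 'a \<Rightarrow> 'a) measure" where
  "driver = Pi\<^sub>M (UNIV \<times> U) step"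

definition chain :: "(nat \<Rightarrow> 'a) measure" where
  "chain = distr driver (borel_of seq_topology) (trajectory x)"

lemma prob_step:
  assumes i: "i \<in> UNIV \<times> U"
  shows "prob_space (step i)"
  unfolding step_def
proof (rule prob_space_point_measure)
  show "finite (succs (snd i))" using finite_U by (simp add: succs_def)
  show "0 \<le> ennreal (q (snd i) z)" for z by simp
  have "(\<Sum>z\<in>succs (snd i). q (snd i) z) = (\<Sum>z\<in>U. q (snd i) z)"
    using i finite_U q_support by (intro sum.mono_neutral_left) (auto simp: succs_def intro: q_support)
  also have "\<dots> = 1" using i q_sum by auto
  finally show "(\<Sum>z\<in>succs (snd i). ennreal (q (snd i) z)) = 1"
    using i q_nonneg by (subst sum_ennreal) (auto simp: succs_def)
qed

lemma prob_driver: "prob_space driver"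
  unfolding driver_def by (rule prob_space_PiM[OF prob_step])

lemma space_step: "space (step i) = succs (snd i)" and sets_step: "sets (step i) = Pow (succs (snd i))"
  by (simp_all add: step_def space_point_measure sets_point_measure)

lemma driver_value: "Z \<in> space driver \<Longrightarrow> y \<in> U \<Longrightarrow> Z (n, y) \<in> succs y"
  by (auto simp: driver_def space_PiM space_step dest: PiE_mem[of _ _ _ "(n, y)"])

lemma trajectory_in_paths:
  assumes "Z \<in> space driver"
  shows "trajectory x Z \<in> infinite_paths U w x"
proof -
  have U: "trajectory x Z i \<in> U" for i
    by (induction i) (use x driver_value[OF assms] in \<open>auto simp: succs_def\<close>)
  then show ?thesis
    using driver_value[OF assms U] by (auto simp: infinite_paths_def succs_def)
qed

lemma trajectory_cell:
  assumes v: "v 0 = x" "\<And>i. i \<le> m \<Longrightarrow> v i \<in> U" "\<And>i. i < m \<Longrightarrow> 0 < w (v i) (v (Suc i))"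
  defines "A \<equiv> trajectory x -` cell (infinite_paths U w x) (Suc m) v \<inter> space driver"
  shows "A \<in> sets driver" "emeasure driver A = ennreal (\<Prod>i<m. q (v i) (v (Suc i)))"
proof -
  \<comment> \<open>The coordinates of the driver that the prefix \<open>v\<close> inspects; the
    times keep them distinct even when \<open>v\<close> repeats a vertex.\<close>
  define J where "J = (\<lambda>i. (i, v i)) ` {..<m}"
  define E where "E = (\<lambda>j :: nat \<times> 'a. {v (Suc (fst j))})"
  have J: "J \<subseteq> UNIV \<times> U" "finite J" using v(2) by (auto simp: J_def)
  have E: "E j \<in> sets (step j)" if "j \<in> J" for j
    using that v by (auto simp: J_def E_def sets_step succs_def)
  have A: "A = prod_emb (UNIV \<times> U) step J (Pi\<^sub>E J E)"
  proof (rule Set.set_eqI)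
    fix Z
    have "Z \<in> A \<longleftrightarrow> Z \<in> space driver \<and> (\<forall>i<Suc m. trajectory x Z i = v i)"
      using trajectory_in_paths by (auto simp: A_def cell_def)
    also have "\<dots> \<longleftrightarrow> Z \<in> space driver \<and> (\<forall>i<m. Z (i, v i) = v (Suc i))"
      using trajectory_prefix_iff[of v, OF v(1)] by simp
    also have "\<dots> \<longleftrightarrow> Z \<in> prod_emb (UNIV \<times> U) step J (Pi\<^sub>E J E)"
      by (auto simp: prod_emb_iff driver_def space_PiM PiE_iff J_def E_def extensional_def
          restrict_def)
    finally show "Z \<in> A \<longleftrightarrow> Z \<in> prod_emb (UNIV \<times> U) step J (Pi\<^sub>E J E)" .
  qed
  show "A \<in> sets driver"
    unfolding A driver_def using J E by (intro sets_PiM_I) auto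
  have "emeasure driver A = (\<Prod>j\<in>J. emeasure (step j) (E j))"
    unfolding A driver_def by (rule emeasure_PiM_emb[OF prob_step J E])
  also have "\<dots> = (\<Prod>i<m. emeasure (step (i, v i)) (E (i, v i)))"
    unfolding J_def by (subst prod.reindex) (auto simp: inj_on_def)
  also have "\<dots> = (\<Prod>i<m. ennreal (q (v i) (v (Suc i))))"
  proof (rule prod.cong)
    fix i assume i: "i \<in> {..<m}"
    have "emeasure (step (i, v i)) {v (Suc i)} = (\<Sum>z\<in>{v (Suc i)}. ennreal (q (v i) z))"
      unfolding step_def snd_conv using i v finite_U
      by (intro emeasure_point_measure_finite) (auto simp: succs_def)
    then show "emeasure (step (i, v i)) (E (i, v i)) = ennreal (q (v i) (v (Suc i)))"
      by (simp add: E_def)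
  qed simp
  also have "\<dots> = ennreal (\<Prod>i<m. q (v i) (v (Suc i)))"
    using v(2) q_nonneg by (intro prod_ennreal) auto
  finally show "emeasure driver A = ennreal (\<Prod>i<m. q (v i) (v (Suc i)))" .
qed

lemma trajectory_measurable: "trajectory x \<in> measurable driver (borel_of seq_topology)"
proof (rule measurable_cellsI[OF trajectory_in_paths])
  fix n \<omega> assume w: "\<omega> \<in> infinite_paths U w x"
  show "trajectory x -` cell (infinite_paths U w x) n \<omega> \<inter> space driver \<in> sets driver"
  proof (cases n)
    case 0
    have "trajectory x -` cell (infinite_paths U w x) 0 \<omega> \<inter> space driver = space driver"
      using trajectory_in_paths by (auto simp: cell_0)
    then show ?thesis using 0 by simp
  next
    case (Suc m)
    then show ?thesis using trajectory_cell(1)[of \<omega> m] w by (auto simp: infinite_paths_def)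
  qed
qed

lemma borel_prob_chain: "borel_prob_on (infinite_path_topology U w x) chain"
  unfolding infinite_path_topology_eq[OF finite_U] borel_prob_on_def chain_def
  using prob_space.prob_space_distr[OF prob_driver trajectory_measurable]
  by (simp add: space_borel_of_seq topspace_seq)

lemma measure_chain_cylinder:
  assumes u: "u \<in> finite_paths U w x"
  shows "measure chain (cylinder U w x u) = (\<Prod>i<path_length u. q (u ! i) (u ! Suc i))"
proof -
  note nth = finite_path_nth[OF u]
  have "openin seq_topology (cylinder U w x u)"
  \<comment> \<open>A cell is known to be open when its centre is one of the sequences; a nonempty
    cylinder is recentred at one of its own paths.\<close>
  proof (cases "cylinder U w x u = {}")
    case False
    then obtain \<omega> where w: "\<omega> \<in> cylinder U w x u" by auto
    then have "cylinder U w x u = cell (infinite_paths U w x) (length u) \<omega>"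
      by (auto simp: cylinder_def cell_def)
    moreover have "\<omega> \<in> infinite_paths U w x" using w by (simp add: cylinder_def)
    ultimately show ?thesis by (simp add: openin_cell)
  qed simp
  then have "cylinder U w x u \<in> sets (borel_of seq_topology)"
    by (simp add: sets_borel_of_seq open_in_sigma_cells)
  then have "measure chain (cylinder U w x u)
      = measure driver (trajectory x -` cylinder U w x u \<inter> space driver)"
    unfolding chain_def by (rule measure_distr[OF trajectory_measurable])
  also have "\<dots> = (\<Prod>i<path_length u. q (u ! i) (u ! Suc i))"
    unfolding cylinder_eq_cell nth(2)
    using trajectory_cell(2)[of "\<lambda>i. u ! i" "path_length u"] nth q_nonneg
    by (simp add: measure_def) (auto intro!: enn2real_ennreal prod_nonneg)
  finally show ?thesis .
qed

end

section \<open>Path weights and Boltzmann distributions\<close>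

lemma path_length_Cons: "u \<noteq> [] \<Longrightarrow> path_length (x # u) = Suc (path_length u)"
  by (cases u) (simp_all add: path_length_def)

lemma path_weight_single: "path_weight w [x] = 1"
  by (simp add: path_weight_def path_length_def)

lemma path_weight_Cons:
  "u \<noteq> [] \<Longrightarrow> path_weight w (x # u) = w x (hd u) * path_weight w u"
  unfolding path_weight_def path_length_Cons
  by (subst prod.lessThan_Suc_shift) (simp add: hd_conv_nth)

lemma finite_paths_hd: "u \<in> finite_paths V w x \<Longrightarrow> hd u = x"
  by (simp add: finite_paths_def)

lemma finite_paths_last: "u \<in> finite_paths V w x \<Longrightarrow> last u \<in> V"
  unfolding finite_paths_def using last_in_set by fastforce

lemma path_weight_nonneg: "u \<in> finite_paths V w x \<Longrightarrow> 0 \<le> path_weight w u"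
  unfolding path_weight_def using finite_path_nth(5) by (intro prod_nonneg less_imp_le ballI) simp

lemma finite_paths_length_0: "x \<in> V \<Longrightarrow> {u \<in> finite_paths V w x. path_length u = 0} = {[x]}"
proof (rule Set.set_eqI)
  fix u assume "x \<in> V"
  then show "u \<in> {u \<in> finite_paths V w x. path_length u = 0} \<longleftrightarrow> u \<in> {[x]}"
    by (cases u) (auto simp: finite_paths_def path_length_def)
qed

lemma finite_paths_length_Suc:
  assumes "x \<in> V"
  shows "{u \<in> finite_paths V w x. path_length u = Suc k}
    = (\<Union>y\<in>{y \<in> V. 0 < w x y}. (#) x ` {u \<in> finite_paths V w y. path_length u = k})"
proof (rule Set.set_eqI)
  fix u
  show "u \<in> {u \<in> finite_paths V w x. path_length u = Suc k} \<longleftrightarrow>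
    u \<in> (\<Union>y\<in>{y \<in> V. 0 < w x y}. (#) x ` {u \<in> finite_paths V w y. path_length u = k})"
  proof (cases u)
    case Nil
    then show ?thesis by (auto simp: finite_paths_def)
  next
    case (Cons a v)
    have "v \<in> finite_paths V w y \<Longrightarrow> v \<noteq> [] \<and> y \<in> V" for y
      by (auto simp: finite_paths_def)
    then show ?thesis
      using assms unfolding Cons
      by (cases "v = []") (auto simp: finite_paths_Cons_iff path_length_Cons path_length_def[of "[a]"])
  qed
qed

text \<open>Expand \<open>F^(k+1) 1\<close> along the first edge: pairs of weight 0 are no edges and
  contribute nothing. Finiteness is carried along because the sums are meaningful only over finite
  sets.\<close>

lemma paths_of_length:
  assumes "weighted_digraph V w" "x \<in> V"
  shows "finite {u \<in> finite_paths V w x. path_length u = k}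
    \<and> (\<Sum>u\<in>{u \<in> finite_paths V w x. path_length u = k}. path_weight w u) = path_total V w k x"
  using assms(2)
proof (induction k arbitrary: x)
  case 0
  then show ?case by (simp add: finite_paths_length_0 path_weight_single)
next
  case (Suc k)
  let ?P = "\<lambda>y. {u \<in> finite_paths V w y. path_length u = k}"
  let ?Y = "{y \<in> V. 0 < w x y}"
  have fin: "finite V" using assms(1) by (simp add: weighted_digraph_def)
  have finP: "finite (?P y)" if "y \<in> ?Y" for y using Suc.IH[of y] that by simp
  have weight: "path_weight w (x # u) = w x y * path_weight w u" if "u \<in> ?P y" for y u
    using that finite_paths_not_Nil[of u V w y] finite_paths_hd[of u V w y]
    by (simp add: path_weight_Cons)
  have "(\<Sum>u\<in>(\<Union>y\<in>?Y. (#) x ` ?P y). path_weight w u) = (\<Sum>y\<in>?Y. \<Sum>u\<in>(#) x ` ?P y. path_weight w u)"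
  proof (rule sum.UNION_disjoint)
    show "finite ?Y" using fin by simp
    show "\<forall>y\<in>?Y. finite ((#) x ` ?P y)" using finP by simp
    show "\<forall>y\<in>?Y. \<forall>z\<in>?Y. y \<noteq> z \<longrightarrow> (#) x ` ?P y \<inter> (#) x ` ?P z = {}"
      by (auto simp: finite_paths_def)
  qed
  also have "\<dots> = (\<Sum>y\<in>?Y. \<Sum>u\<in>?P y. w x y * path_weight w u)"
  proof (rule sum.cong[OF refl])
    fix y assume "y \<in> ?Y"
    have "(\<Sum>u\<in>(#) x ` ?P y. path_weight w u) = (\<Sum>u\<in>?P y. path_weight w (x # u))"
      by (subst sum.reindex) simp_all
    also have "\<dots> = (\<Sum>u\<in>?P y. w x y * path_weight w u)"
      by (rule sum.cong[OF refl]) (rule weight)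
    finally show "(\<Sum>u\<in>(#) x ` ?P y. path_weight w u) = (\<Sum>u\<in>?P y. w x y * path_weight w u)" .
  qed
  also have "\<dots> = (\<Sum>y\<in>?Y. w x y * path_total V w k y)"
    using Suc.IH by (intro sum.cong) (simp_all flip: sum_distrib_left)
  also have "\<dots> = path_total V w (Suc k) x"
    unfolding path_total_Suc using fin assms(1) Suc.prems
    by (intro sum.mono_neutral_left) (force simp: weighted_digraph_def)+
  finally show ?case
    using fin finP by (simp add: finite_paths_length_Suc[OF Suc.prems])
qed

text \<open>All terms are nonnegative, so sums over large finite sets of paths are squeezed between
  sums over all paths shorter than some \<open>K\<close>, which are partial sums of the power
  series, and the full series.\<close>

lemma has_sum_path_gf:
  assumes wd: "weighted_digraph V w" and x: "x \<in> V" and s: "0 \<le> s" "s * digraph_radius V w < 1"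
  shows "((\<lambda>u. path_weight w u * s ^ path_length u) has_sum path_gf V w s x) (finite_paths V w x)"
proof -
  let ?f = "\<lambda>u. path_weight w u * s ^ path_length u"
  let ?P = "\<lambda>K. {u \<in> finite_paths V w x. path_length u < K}"
  have fin: "finite V" using wd by (simp add: weighted_digraph_def)
  have f0: "0 \<le> ?f u" if "u \<in> finite_paths V w x" for u
    using path_weight_nonneg[OF that] s by simp
  have P: "finite (?P K) \<and> sum ?f (?P K) = (\<Sum>k<K. path_total V w k x * s ^ k)" for K
  proof (induction K)
    case (Suc K)
    have split: "?P (Suc K) = ?P K \<union> {u \<in> finite_paths V w x. path_length u = K}"
      by auto
    have "sum ?f {u \<in> finite_paths V w x. path_length u = K} = path_total V w K x * s ^ K"
      using paths_of_length[OF wd x, of K] by (simp flip: sum_distrib_right)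
    then show ?case
      using Suc paths_of_length[OF wd x, of K] unfolding split by (subst sum.union_disjoint) auto
  qed simp
  have sm: "summable (\<lambda>k. path_total V w k x * s ^ k)"
    by (rule path_total_summable[OF fin x s])
  have sums: "(\<lambda>K. sum ?f (?P K)) \<longlonglongrightarrow> path_gf V w s x"
    using summable_LIMSEQ[OF sm] by (simp add: P path_gf_def)
  have upper: "sum ?f F \<le> path_gf V w s x" if F: "finite F" "F \<subseteq> finite_paths V w x" for F
  proof -
    \<comment> \<open>For empty \<open>F\<close> the inclusion is trivial, whatever the value of
      \<open>Max\<close> there.\<close>
    have "F \<subseteq> ?P (Suc (Max (path_length ` F)))"
      using F by (auto simp: less_Suc_eq_le)
    then have "sum ?f F \<le> sum ?f (?P (Suc (Max (path_length ` F))))"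
      using P f0 by (intro sum_mono2) auto
    also have "\<dots> \<le> path_gf V w s x"
      unfolding conjunct2[OF P] path_gf_def
      using sm path_total_nonneg[OF wd x] s by (intro sum_le_suminf) auto
    finally show ?thesis .
  qed
  show ?thesis
    unfolding has_sum_def
  proof (rule order_tendstoI)
    fix a assume "a < path_gf V w s x"
    then obtain K where K: "a < sum ?f (?P K)"
      using order_tendstoD(1)[OF sums] by (auto simp: eventually_sequentially)
    show "\<forall>\<^sub>F F in finite_subsets_at_top (finite_paths V w x). a < sum ?f F"
      unfolding eventually_finite_subsets_at_top
    proof (intro exI[of _ "?P K"] conjI allI impI)
      fix F assume F: "finite F \<and> ?P K \<subseteq> F \<and> F \<subseteq> finite_paths V w x"
      then have "sum ?f (?P K) \<le> sum ?f F" using f0 by (intro sum_mono2) auto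
      then show "a < sum ?f F" using K by simp
    qed (use P in auto)
  next
    fix a assume a: "path_gf V w s x < a"
    show "\<forall>\<^sub>F F in finite_subsets_at_top (finite_paths V w x). sum ?f F < a"
      using upper a by (intro eventually_finite_subsets_at_top_weakI) fastforce
  qed
qed

lemma nn_integral_has_sum:
  fixes f :: "'b \<Rightarrow> real"
  assumes "(f has_sum S) A" "\<And>x. x \<in> A \<Longrightarrow> 0 \<le> f x"
  shows "(\<integral>\<^sup>+x. ennreal (f x) \<partial>count_space A) = ennreal S"
proof -
  have "Infinite_Sum.abs_summable_on f A"
    using assms has_sum_imp_summable summable_on_iff_abs_summable_on_real by blast
  then have "Infinite_Set_Sum.abs_summable_on f A" by (rule iffD1[OF abs_summable_equivalent])
  then show ?thesis
    using assms nn_integral_conv_infsetsum[of f A] infsetsum_infsum[of f A] infsumI[OF assms(1)] by simp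
qed

section \<open>Finite and infinite paths as sequences over one alphabet\<close>

definition all_paths :: "'a set \<Rightarrow> ('a \<Rightarrow> 'a \<Rightarrow> real) \<Rightarrow> 'a \<Rightarrow> (nat \<Rightarrow> 'a option) set" where
  "all_paths V w x = pad_path ` finite_paths V w x \<union> embed_path ` infinite_paths V w x"

lemma sequence_space_all_paths:
  assumes "finite V"
  shows "sequence_space (insert None (Some ` V)) (all_paths V w x)"
proof
  show "finite (insert None (Some ` V))" using assms by simp
  fix \<omega> i assume "\<omega> \<in> all_paths V w x"
  then show "\<omega> i \<in> insert None (Some ` V)"
  proof (unfold all_paths_def, elim UnE imageE)
    fix u assume u: "\<omega> = pad_path u" "u \<in> finite_paths V w x"
    then show ?thesis using nth_mem[of i u]
      by (auto simp: pad_path_def finite_paths_def intro!: imageI)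
  qed (auto simp: embed_path_def infinite_paths_def)
qed

lemma path_topology_eq:
  assumes "finite V"
  shows "path_topology V w x
    = sequence_space.seq_topology (insert None (Some ` V)) (all_paths V w x)"
proof -
  interpret sequence_space "insert None (Some ` V)" "all_paths V w x"
    by (rule sequence_space_all_paths[OF assms])
  show ?thesis unfolding seq_topology_def by (simp only: path_topology_def all_paths_def)
qed

lemma pad_path_inject: "pad_path u = pad_path v \<Longrightarrow> u = v"
proof (rule nth_equalityI)
  assume eq: "pad_path u = pad_path v"
  have len: "n < length u \<longleftrightarrow> n < length v" for n
    using fun_cong[OF eq, of n] by (auto simp: pad_path_def split: if_splits)
  then show "length u = length v" by (metis linorder_neqE_nat less_irrefl)
  show "u ! i = v ! i" if "i < length u" for i
    using fun_cong[OF eq, of i] that len[of i] by (simp add: pad_path_def)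
qed

text \<open>An extension of \<open>v\<close> is a path from \<open>last v\<close> glued to
  \<open>v\<close>; \<open>butlast\<close> removes the joining vertex, which \<open>z\<close>
  supplies again. Weight and length therefore split exactly.\<close>

lemma path_extensions:
  assumes v: "v \<in> finite_paths V w x"
  shows "{u \<in> finite_paths V w x. \<exists>t. u = v @ t} = (\<lambda>z. butlast v @ z) ` finite_paths V w (last v)"
    and "z \<in> finite_paths V w (last v) \<Longrightarrow>
      path_weight w (butlast v @ z) = path_weight w v * path_weight w z \<and>
      path_length (butlast v @ z) = path_length v + path_length z"
proof -
  have v': "v \<noteq> []" "hd v = x" "set v \<subseteq> V" "successively (\<lambda>y z. 0 < w y z) v"
    using v by (auto simp: finite_paths_def)
  then obtain b where b: "v = b @ [last v]" by (metis append_butlast_last_id)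
  then have bl: "butlast v = b" by (metis butlast_snoc)
  show "{u \<in> finite_paths V w x. \<exists>t. u = v @ t} = (\<lambda>z. butlast v @ z) ` finite_paths V w (last v)"
  proof (intro subset_antisym subsetI)
    fix u assume "u \<in> {u \<in> finite_paths V w x. \<exists>t. u = v @ t}"
    then obtain t where t: "u = v @ t" "u \<in> finite_paths V w x" by auto
    then have u: "u = b @ (last v # t)" using b by (metis append.assoc append_Cons append_Nil)
    then have "last v # t \<in> finite_paths V w (last v)"
      using t(2) by (auto simp: finite_paths_def successively_append_iff)
    then show "u \<in> (\<lambda>z. butlast v @ z) ` finite_paths V w (last v)"
      unfolding bl u by (rule imageI)
  next
    fix u assume "u \<in> (\<lambda>z. butlast v @ z) ` finite_paths V w (last v)"
    then obtain z where z: "z \<in> finite_paths V w (last v)" "u = b @ z" using bl by auto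
    then obtain t where t: "z = last v # t" by (cases z) (auto simp: finite_paths_def)
    then have u: "u = v @ t" using b z(2) by (metis append.assoc append_Cons append_Nil)
    have "successively (\<lambda>y z. 0 < w y z) (b @ last v # t)"
    proof -
      have "successively (\<lambda>y z. 0 < w y z) (b @ [last v])" using v'(4) b by simp
      then show ?thesis using z(1) unfolding t by (auto simp: finite_paths_def successively_append_iff)
    qed
    moreover have "b @ last v # t = v @ t" using u z(2) t by simp
    ultimately have "successively (\<lambda>y z. 0 < w y z) (v @ t)" by simp
    then have "u \<in> finite_paths V w x"
      using z v' u t by (auto simp: finite_paths_def)
    then show "u \<in> {u \<in> finite_paths V w x. \<exists>t. u = v @ t}" using u by auto
  qed
  show "path_weight w (butlast v @ z) = path_weight w v * path_weight w z \<and>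
      path_length (butlast v @ z) = path_length v + path_length z"
    if "z \<in> finite_paths V w (last v)"
    using that v'(1)
  proof (induction v)
    case (Cons a v)
    have z: "z \<noteq> []" "hd z = last (a # v)" using Cons.prems by (auto simp: finite_paths_def)
    show ?case
    proof (cases "v = []")
      case True
      then show ?thesis by (simp add: path_weight_single path_length_def)
    next
      case False
      then have IH: "path_weight w (butlast v @ z) = path_weight w v * path_weight w z"
        "path_length (butlast v @ z) = path_length v + path_length z"
        using Cons by auto
      have "hd (butlast v @ z) = hd v"
        using z(2) False by (cases v) auto
      then show ?thesis using False IH z by (simp add: path_weight_Cons path_length_Cons)
    qed
  qed simp
qed

section \<open>Cocycle measures\<close>

lemma accessible_last: "u \<in> finite_paths V w x \<Longrightarrow> accessible V w x (last u)"
  by (auto simp: accessible_def)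

text \<open>The cocycle rule makes the diagonal value idempotent, and positivity leaves only
  1.\<close>

lemma complete_cocycle_diag:
  assumes "complete_cocycle_measure V w r \<Gamma> \<mu>" "x \<in> V"
  shows "\<Gamma> x x = 1"
proof -
  have acc: "accessible V w x x" using assms(2) by (rule accessible_refl)
  then have "\<Gamma> x x = \<Gamma> x x * \<Gamma> x x" "0 < \<Gamma> x x"
    using assms(1) unfolding complete_cocycle_measure_def cocycle_measure_def cocycle_def
    by metis+
  then show ?thesis by simp
qed

text \<open>The values of \<open>\<Gamma>\<close> along consecutive edges multiply to the value
  between the ends; the diagonal value 1 settles the path of length 0.\<close>

lemma cocycle_kernel_product:
  assumes cocycle: "\<And>x y z. accessible V w x y \<Longrightarrow> accessible V w y z \<Longrightarrow> \<Gamma> x z = \<Gamma> x y * \<Gamma> y z"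
    and diag: "\<And>x. x \<in> V \<Longrightarrow> \<Gamma> x x = 1"
    and "u \<in> finite_paths V w x"
  shows "(\<Prod>i<path_length u. cocycle_kernel w r \<Gamma> (u ! i) (u ! Suc i))
    = inverse r ^ path_length u * path_weight w u * \<Gamma> x (last u)"
  using assms(3)
proof (induction u arbitrary: x)
  case Nil
  then show ?case by (simp add: finite_paths_def)
next
  case (Cons a u)
  show ?case
  proof (cases "u = []")
    case True
    then show ?thesis
      using Cons.prems diag[of x] by (auto simp: finite_paths_Cons_iff path_length_def path_weight_single)
  next
    case False
    then obtain y where u: "u \<in> finite_paths V w y" "0 < w x y" "x \<in> V" "a = x"
      using Cons.prems by (auto simp: finite_paths_Cons_iff)
    have y: "hd u = y" "y \<in> V" "u ! 0 = y"
      using u(1) False by (auto simp: finite_paths_def hd_conv_nth)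
    have "\<Gamma> x (last u) = \<Gamma> x y * \<Gamma> y (last u)"
      using accessible_edge[of x V y w, OF u(3) y(2) u(2)] accessible_last[OF u(1)] by (rule cocycle)
    then show ?thesis
      using Cons.IH[OF u(1)] False u(4) y
      by (simp add: path_length_Cons path_weight_Cons prod.lessThan_Suc_shift cocycle_kernel_def
          del: prod.lessThan_Suc)
  qed
qed

lemma infinite_path_prefix:
  assumes "\<omega> \<in> infinite_paths V w x" "0 < n"
  shows "map \<omega> [0..<n] \<in> finite_paths V w x"
  using assms by (auto simp: finite_paths_def infinite_paths_def successively_conv_nth hd_map)

text \<open>The mass of a cylinder is a product of kernel values, in which the rate and the cocycle
  no longer appear separately; equal kernels thus give equal masses on a generating family stable
  under intersection.\<close>

lemma complete_cocycle_measure_unique: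
  assumes fin: "finite V"
    and \<mu>: "complete_cocycle_measure V w r \<Gamma> \<mu>" and \<mu>': "complete_cocycle_measure V w r' \<Gamma>' \<mu>'"
    and kernel: "\<And>x y. x \<in> V \<Longrightarrow> y \<in> V \<Longrightarrow> cocycle_kernel w r' \<Gamma>' x y = cocycle_kernel w r \<Gamma> x y"
    and x: "x \<in> V"
  shows "\<mu>' x = \<mu> x"
proof -
  interpret sequence_space V "infinite_paths V w x"
    using fin by unfold_locales (auto simp: infinite_paths_def)
  have cyl: "measure (\<nu> x) (cylinder V w x u) = (\<Prod>i<path_length u. cocycle_kernel w t \<Delta> (u ! i) (u ! Suc i))"
    if \<nu>: "complete_cocycle_measure V w t \<Delta> \<nu>" and u: "u \<in> finite_paths V w x" for t \<Delta> \<nu> u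
  proof -
    have "\<Delta> a c = \<Delta> a b * \<Delta> b c" if "accessible V w a b" "accessible V w b c" for a b c
      using \<nu> that unfolding complete_cocycle_measure_def cocycle_measure_def cocycle_def by metis
    then have "(\<Prod>i<path_length u. cocycle_kernel w t \<Delta> (u ! i) (u ! Suc i))
        = inverse t ^ path_length u * path_weight w u * \<Delta> x (last u)"
      by (rule cocycle_kernel_product[OF _ complete_cocycle_diag[OF \<nu>] u])
    then show ?thesis
      using \<nu> x u by (simp add: complete_cocycle_measure_def cocycle_measure_def)
  qed
  have "borel_prob_on (infinite_path_topology V w x) (\<nu> x)"
    if "complete_cocycle_measure V w t \<Delta> \<nu>" for t \<Delta> \<nu>
    using that x by (auto simp: complete_cocycle_measure_def cocycle_measure_def)
  note prob = this[OF \<mu>', unfolded infinite_path_topology_eq[OF fin]]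
    this[OF \<mu>, unfolded infinite_path_topology_eq[OF fin]]
  show ?thesis
  proof (rule borel_prob_eqI[OF prob])
    fix n \<omega> assume w: "\<omega> \<in> infinite_paths V w x"
    show "measure (\<mu>' x) (cell (infinite_paths V w x) n \<omega>) = measure (\<mu> x) (cell (infinite_paths V w x) n \<omega>)"
    \<comment> \<open>Depth 0 is the whole space and corresponds to no path, as paths have at least
      one vertex.\<close>
    proof (cases "n = 0")
      case True
      have "measure (\<nu> x) (infinite_paths V w x) = 1" if "borel_prob_on seq_topology (\<nu> x)" for \<nu> :: "'a \<Rightarrow> (nat \<Rightarrow> 'a) measure"
        using that prob_space.prob_space[of "\<nu> x"] by (simp add: borel_prob_on_def topspace_seq)
      then show ?thesis using True prob by (simp add: cell_0)
    next
      case False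
      let ?u = "map \<omega> [0..<n]"
      have u: "?u \<in> finite_paths V w x" using infinite_path_prefix[OF w] False by simp
      have cell: "cell (infinite_paths V w x) n \<omega> = cylinder V w x ?u"
        by (auto simp: cell_def cylinder_def)
      have "(\<Prod>i<path_length ?u. cocycle_kernel w r' \<Gamma>' (?u ! i) (?u ! Suc i))
          = (\<Prod>i<path_length ?u. cocycle_kernel w r \<Gamma> (?u ! i) (?u ! Suc i))"
        using finite_path_nth(4)[OF u] by (intro prod.cong refl kernel) auto
      then show ?thesis
        unfolding cell cyl[OF \<mu> u] cyl[OF \<mu>' u] .
    qed
  qed
qed


section \<open>Convergence of Boltzmann distributions\<close>

lemma finite_path_take:
  assumes "u \<in> finite_paths V w x" "0 < n"
  shows "take n u \<in> finite_paths V w x"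
proof -
  have "successively (\<lambda>y z. 0 < w y z) (take n u @ drop n u)"
    using assms(1) by (simp add: finite_paths_def)
  then show ?thesis
    using assms set_take_subset[of n u]
    by (auto simp: finite_paths_def successively_append_iff simp del: append_take_drop_id)
qed

text \<open>A finite path with fewer than \<open>n\<close> vertices shows its end within the first
  \<open>n\<close> symbols; every other element shows \<open>n\<close> vertices there, and these
  form a finite path of length \<open>n - 1\<close>.\<close>

lemma all_paths_cases:
  assumes "\<omega> \<in> all_paths V w x" "0 < n"
  obtains (short) u where "u \<in> finite_paths V w x" "length u < n" "\<omega> = pad_path u"
    | (long) v where "v \<in> finite_paths V w x" "length v = n"
        "cell (all_paths V w x) n \<omega> = cell (all_paths V w x) n (pad_path v)"
proof -
  have cell: "cell (all_paths V w x) n \<omega> = cell (all_paths V w x) n (pad_path v)"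
    if "\<And>i. i < n \<Longrightarrow> \<omega> i = pad_path v i" for v
    using that by (auto simp: cell_def)
  from assms(1) consider u where "u \<in> finite_paths V w x" "\<omega> = pad_path u"
    | \<eta> where "\<eta> \<in> infinite_paths V w x" "\<omega> = embed_path \<eta>"
    by (auto simp: all_paths_def)
  then show thesis
  proof cases
    case 1
    show thesis
    proof (cases "length u < n")
      case False
      show thesis
        by (rule long[OF finite_path_take[OF 1(1) assms(2)] _ cell])
          (use False 1(2) in \<open>auto simp: pad_path_def\<close>)
    qed (use 1 short in simp)
  next
    case 2
    show thesis
      by (rule long[OF infinite_path_prefix[OF 2(1) assms(2)] _ cell])
        (use 2(2) in \<open>auto simp: pad_path_def embed_path_def\<close>)
  qed
qed

lemma pad_path_in_long_cell:
  assumes "u \<in> finite_paths V w x"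
  shows "pad_path u \<in> cell (all_paths V w x) (length v) (pad_path v) \<longleftrightarrow> (\<exists>t. u = v @ t)"
proof
  assume "pad_path u \<in> cell (all_paths V w x) (length v) (pad_path v)"
  then have eq: "pad_path u i = Some (v ! i)" if "i < length v" for i
    using that by (simp add: cell_def pad_path_def)
  have lt: "i < length u \<and> u ! i = v ! i" if "i < length v" for i
    using eq[OF that] by (auto simp: pad_path_def split: if_splits)
  then have "length v \<le> length u" by (metis leI less_irrefl)
  then have "take (length v) u = v" using lt by (intro nth_equalityI) auto
  then show "\<exists>t. u = v @ t" by (metis append_take_drop_id)
next
  assume "\<exists>t. u = v @ t"
  then show "pad_path u \<in> cell (all_paths V w x) (length v) (pad_path v)"
    using assms by (auto simp: cell_def all_paths_def pad_path_def nth_append)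
qed

text \<open>The first \<open>n\<close> symbols include position \<open>length u\<close>, where
  \<open>None\<close> marks the end of the path; so nothing is left free.\<close>

lemma short_cell:
  assumes "u \<in> finite_paths V w x" "length u < n"
  shows "cell (all_paths V w x) n (pad_path u) = {pad_path u}"
proof (intro equalityI subsetI)
  fix \<omega> assume w: "\<omega> \<in> cell (all_paths V w x) n (pad_path u)"
  then have agree: "\<omega> i = pad_path u i" if "i < n" for i using that by (simp add: cell_def)
  have none: "\<omega> (length u) = None" using agree[OF assms(2)] by (simp add: pad_path_def)
  then obtain v where v: "\<omega> = pad_path v"
    using w by (auto simp: cell_def all_paths_def embed_path_def)
  have "length v \<le> length u" using none by (auto simp: v pad_path_def split: if_splits)
  moreover have "i < length v" if "i < length u" for i
    using agree[of i] that assms(2) by (auto simp: v pad_path_def split: if_splits)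
  then have "length u \<le> length v" by (metis leI less_irrefl)
  ultimately have len: "length v = length u" by simp
  have "v ! i = u ! i" if "i < length u" for i
    using agree[of i] that assms(2) len by (simp add: v pad_path_def)
  then have "v = u" using len by (intro nth_equalityI) auto
  then show "\<omega> \<in> {pad_path u}" using v by simp
qed (use assms in \<open>auto simp: cell_def all_paths_def\<close>)

context positive_digraph
begin

context
  fixes s :: real and x :: 'a
  assumes s: "s \<in> {0<..<1 / \<rho>}" and x: "x \<in> V"
begin

abbreviation boltzmann_weight :: "'a list \<Rightarrow> real" where
  "boltzmann_weight u \<equiv> path_weight w u * s ^ path_length u"

lemma has_sum_boltzmann_weight: "(boltzmann_weight has_sum G s x) (finite_paths V w x)"
  using subcritical[OF s] by (intro has_sum_path_gf[OF wd x]) auto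

lemma boltzmann_partition_eq: "boltzmann_partition V w x s = G s x"
  unfolding boltzmann_partition_def by (rule infsumI[OF has_sum_boltzmann_weight])

lemma boltzmann_weight_nonneg: "u \<in> finite_paths V w x \<Longrightarrow> 0 \<le> boltzmann_weight u"
  using path_weight_nonneg subcritical(1)[OF s] by (metis mult_nonneg_nonneg zero_le_power less_imp_le)

lemma emeasure_boltzmann:
  assumes A: "A \<in> sets (borel_of (path_topology V w x))"
    and S: "(boltzmann_weight has_sum S) {u \<in> finite_paths V w x. pad_path u \<in> A}"
  shows "emeasure (boltzmann V w x s) A = ennreal (S / G s x)"
proof -
  interpret sequence_space "insert None (Some ` V)" "all_paths V w x"
    by (rule sequence_space_all_paths[OF finite_V])
  let ?P = "finite_paths V w x"
  let ?B = "{u \<in> ?P. pad_path u \<in> A}"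
  let ?f = "\<lambda>u. boltzmann_weight u / G s x"
  let ?D = "density (count_space ?P) (\<lambda>u. ennreal (?f u))"
  have meas: "pad_path \<in> measurable ?D (borel_of (path_topology V w x))"
    by (simp add: path_topology_eq[OF finite_V] space_borel_of_seq) (simp add: all_paths_def)
  have "emeasure (boltzmann V w x s) A = emeasure ?D (pad_path -` A \<inter> space ?D)"
    unfolding boltzmann_def boltzmann_partition_eq by (rule emeasure_distr[OF meas A])
  also have "pad_path -` A \<inter> space ?D = ?B" by auto
  also have "emeasure ?D ?B = (\<integral>\<^sup>+u. ennreal (?f u) * indicator ?B u \<partial>count_space ?P)"
    by (rule emeasure_density) auto
  also have "\<dots> = (\<integral>\<^sup>+u. ennreal (?f u * indicator ?B u) \<partial>count_space ?P)"
    by (intro nn_integral_cong) (auto split: split_indicator)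
  also have "\<dots> = ennreal (S / G s x)"
  proof (rule nn_integral_has_sum)
    have "(?f has_sum S / G s x) ?B"
      using has_sum_cmult_left[OF S, of "inverse (G s x)"] by (simp add: divide_inverse)
    then show "((\<lambda>u. ?f u * indicator ?B u) has_sum S / G s x) ?P"
      by (rule iffD1[OF has_sum_cong_neutral, rotated -1]) auto
    show "0 \<le> ?f u * indicator ?B u" if "u \<in> ?P" for u
      using boltzmann_weight_nonneg[OF that] G_pos[OF s x] by (intro mult_nonneg_nonneg) simp_all
  qed
  finally show ?thesis .
qed

lemma borel_prob_boltzmann: "borel_prob_on (path_topology V w x) (boltzmann V w x s)"
proof -
  interpret sequence_space "insert None (Some ` V)" "all_paths V w x"
    by (rule sequence_space_all_paths[OF finite_V])
  have space: "space (boltzmann V w x s) = all_paths V w x"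
    by (simp add: boltzmann_def path_topology_eq[OF finite_V] space_borel_of_seq)
  have "emeasure (boltzmann V w x s) (all_paths V w x) = ennreal (G s x / G s x)"
  proof (rule emeasure_boltzmann)
    have "openin seq_topology (all_paths V w x)" using openin_topspace[of seq_topology] by (simp add: topspace_seq)
    then show "all_paths V w x \<in> sets (borel_of (path_topology V w x))"
      by (simp add: path_topology_eq[OF finite_V] sets_borel_of_seq open_in_sigma_cells)
    have "{u \<in> finite_paths V w x. pad_path u \<in> all_paths V w x} = finite_paths V w x"
      by (auto simp: all_paths_def)
    then show "(boltzmann_weight has_sum G s x) {u \<in> finite_paths V w x. pad_path u \<in> all_paths V w x}"
      using has_sum_boltzmann_weight by simp
  qed
  then have "prob_space (boltzmann V w x s)"
    using G_pos[OF s x] by (intro prob_spaceI) (simp add: space)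
  then show ?thesis
    by (simp add: borel_prob_on_def space path_topology_eq[OF finite_V] topspace_seq)
      (simp add: boltzmann_def path_topology_eq[OF finite_V])
qed

lemma cell_in_borel: "\<omega> \<in> all_paths V w x \<Longrightarrow>
    cell (all_paths V w x) n \<omega> \<in> sets (borel_of (path_topology V w x))"
proof -
  interpret sequence_space "insert None (Some ` V)" "all_paths V w x"
    by (rule sequence_space_all_paths[OF finite_V])
  show "\<omega> \<in> all_paths V w x \<Longrightarrow> ?thesis"
    by (simp add: path_topology_eq[OF finite_V] sets_borel_of_seq open_in_sigma_cells openin_cell)
qed

lemma boltzmann_short_cell:
  assumes u: "u \<in> finite_paths V w x" "length u < n"
  shows "measure (boltzmann V w x s) (cell (all_paths V w x) n (pad_path u)) = boltzmann_weight u / G s x"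
proof -
  have "{v \<in> finite_paths V w x. pad_path v \<in> cell (all_paths V w x) n (pad_path u)} = {u}"
    using u(1) unfolding short_cell[OF u] by (auto dest: pad_path_inject)
  moreover have "(boltzmann_weight has_sum boltzmann_weight u) {u}"
    using has_sum_finite[of "{u}" boltzmann_weight] by simp
  ultimately have "(boltzmann_weight has_sum boltzmann_weight u)
      {v \<in> finite_paths V w x. pad_path v \<in> cell (all_paths V w x) n (pad_path u)}" by simp
  from emeasure_boltzmann[OF cell_in_borel this] u(1)
  have "emeasure (boltzmann V w x s) (cell (all_paths V w x) n (pad_path u)) = ennreal (boltzmann_weight u / G s x)"
    by (simp add: all_paths_def)
  then show ?thesis
    using boltzmann_weight_nonneg[OF u(1)] G_pos[OF s x] by (simp add: measure_def)
qed

text \<open>The finite paths in this cell are the extensions of \<open>v\<close>, whose weights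
  split into that of \<open>v\<close> and that of a path from \<open>last v\<close>; summing the
  latter yields \<open>G\<close> at \<open>last v\<close>.\<close>

lemma boltzmann_long_cell:
  assumes v: "v \<in> finite_paths V w x"
  shows "measure (boltzmann V w x s) (cell (all_paths V w x) (length v) (pad_path v))
    = boltzmann_weight v * G s (last v) / G s x"
proof -
  have last: "last v \<in> V" using v by (rule finite_paths_last)
  have eq: "boltzmann_weight v * boltzmann_weight z = (boltzmann_weight \<circ> (\<lambda>z. butlast v @ z)) z"
    if "z \<in> finite_paths V w (last v)" for z
    using path_extensions(2)[OF v that] by (simp add: power_add)
  have "((\<lambda>z. boltzmann_weight v * boltzmann_weight z) has_sum boltzmann_weight v * G s (last v))
      (finite_paths V w (last v))"
    using subcritical[OF s] by (intro has_sum_cmult_right has_sum_path_gf[OF wd last]) auto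
  from iffD1[OF has_sum_cong[OF eq] this]
  have "((boltzmann_weight \<circ> (\<lambda>z. butlast v @ z)) has_sum boltzmann_weight v * G s (last v))
      (finite_paths V w (last v))" .
  then have "(boltzmann_weight has_sum boltzmann_weight v * G s (last v))
      ((\<lambda>z. butlast v @ z) ` finite_paths V w (last v))"
    by (subst has_sum_reindex) (auto simp: inj_on_def)
  moreover have "(\<lambda>z. butlast v @ z) ` finite_paths V w (last v)
      = {u \<in> finite_paths V w x. pad_path u \<in> cell (all_paths V w x) (length v) (pad_path v)}"
    unfolding path_extensions(1)[OF v, symmetric]
    by (rule Collect_cong, rule conj_cong[OF refl], rule pad_path_in_long_cell[symmetric])
  ultimately have "(boltzmann_weight has_sum boltzmann_weight v * G s (last v))
      {u \<in> finite_paths V w x. pad_path u \<in> cell (all_paths V w x) (length v) (pad_path v)}" by simp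
  from emeasure_boltzmann[OF cell_in_borel this] v
  have "emeasure (boltzmann V w x s) (cell (all_paths V w x) (length v) (pad_path v))
      = ennreal (boltzmann_weight v * G s (last v) / G s x)"
    by (simp add: all_paths_def)
  moreover have "0 \<le> boltzmann_weight v * G s (last v) / G s x"
    using boltzmann_weight_nonneg[OF v] G_pos[OF s x] G_pos[OF s last] by simp
  ultimately show ?thesis by (simp add: measure_def)
qed

end

end

text \<open>Retains of the residual matrix only the limits \<open>g\<close> and the scale
  \<open>h\<close>. The support of \<open>g\<close> stands in for the umbrella, with which it is
  identified in the final proof.\<close>

locale residual_digraph = positive_digraph V w \<rho> for V :: "'a set" and w and \<rho> +
  fixes h :: nat and g :: "'a \<Rightarrow> real" and x0 :: 'a
  assumes h_pos: "0 < h"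
    and residual_limit: "\<And>x. x \<in> V \<Longrightarrow> ((\<lambda>s. (1 - \<rho> * s) ^ h * G s x) \<longlongrightarrow> g x) critical"
    and x0: "x0 \<in> V" "0 < g x0"
begin

definition support :: "'a set" where
  "support = {x \<in> V. 0 < g x}"

abbreviation ratio :: "'a \<Rightarrow> 'a \<Rightarrow> real" where
  "ratio \<equiv> \<lambda>x y. g y / g x"

lemma finite_support: "finite support"
  using finite_V by (simp add: support_def)

lemma support_subset: "support \<subseteq> V"
  by (auto simp: support_def)

lemma support_pos: "x \<in> support \<Longrightarrow> 0 < g x"
  by (simp add: support_def)

lemma x0_support: "x0 \<in> support"
  using x0 by (simp add: support_def)

lemma g_nonneg:
  assumes "x \<in> V"
  shows "0 \<le> g x"
proof (rule tendsto_lowerbound[OF residual_limit[OF assms] _ critical_neq_bot])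
  show "\<forall>\<^sub>F s in critical. 0 \<le> (1 - \<rho> * s) ^ h * G s x"
  proof (rule eventually_critical)
    fix s assume s: "s \<in> {0<..<1 / \<rho>}"
    show "0 \<le> (1 - \<rho> * s) ^ h * G s x"
      using subcritical(3)[OF s] G_pos[OF s assms] by simp
  qed
qed

lemma g_eigen: "x \<in> V \<Longrightarrow> (\<Sum>y\<in>V. w x y * g y) = \<rho> * g x"
  by (rule residual_eigenvector[OF h_pos residual_limit])

text \<open>By \<open>F g = \<rho> g\<close>, a positive term \<open>w x y * g y\<close> makes
  \<open>g x\<close> positive. Consequently a path that ends in the support lies in it
  entirely.\<close>

lemma support_predecessor:
  assumes "x \<in> V" "y \<in> support" "0 < w x y"
  shows "x \<in> support"
proof -
  have "0 < w x y * g y" using assms support_pos by simp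
  also have "\<dots> \<le> (\<Sum>y\<in>V. w x y * g y)"
    using assms support_subset weight_nonneg g_nonneg finite_V
    by (intro member_le_sum) (auto intro!: mult_nonneg_nonneg)
  also have "\<dots> = \<rho> * g x" by (rule g_eigen[OF assms(1)])
  finally show ?thesis using assms(1) rho_pos by (simp add: support_def zero_less_mult_iff)
qed

lemma finite_path_in_support:
  "u \<in> finite_paths V w x \<Longrightarrow> last u \<in> support \<Longrightarrow> u \<in> finite_paths support w x"
proof (induction u arbitrary: x)
  case (Cons a u)
  show ?case
  proof (cases "u = []")
    case True
    then show ?thesis using Cons.prems by (simp add: finite_paths_Cons_iff)
  next
    case False
    then obtain z where z: "u \<in> finite_paths V w z" "0 < w x z" "x \<in> V" "a = x"
      using Cons.prems(1) by (auto simp: finite_paths_Cons_iff)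
    have u: "u \<in> finite_paths support w z" using Cons.IH[OF z(1)] Cons.prems(2) False by simp
    then have "z \<in> support" using False by (auto simp: finite_paths_def)
    then have "x \<in> support" using support_predecessor z by simp
    then show ?thesis using u z by (auto simp: finite_paths_Cons_iff)
  qed
qed (simp add: finite_paths_def)

lemma kernel_chain:
  assumes "x \<in> support"
  shows "finite_markov_chain support w (cocycle_kernel w \<rho> ratio) x"
proof
  show "finite support" by (rule finite_support)
  show "x \<in> support" by (rule assms)
  show "0 \<le> cocycle_kernel w \<rho> ratio y z" if "y \<in> support" "z \<in> support" for y z
  proof -
    have "0 \<le> w y z" using that support_subset by (intro weight_nonneg) auto
    then show ?thesis
      using support_pos[OF that(1)] support_pos[OF that(2)] rho_pos by (simp add: cocycle_kernel_def)
  qed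
  show "(\<Sum>z\<in>support. cocycle_kernel w \<rho> ratio y z) = 1" if y: "y \<in> support" for y
  proof -
    \<comment> \<open>The sum may run over \<open>V\<close> since \<open>g\<close> vanishes off the
      support, and then the eigenvector equation applies.\<close>
    have "(\<Sum>z\<in>support. w y z * g z) = (\<Sum>z\<in>V. w y z * g z)"
      using finite_V support_subset g_nonneg
      by (intro sum.mono_neutral_left) (force simp: support_def)+
    also have "\<dots> = \<rho> * g y" using y support_subset by (intro g_eigen) auto
    finally have "(\<Sum>z\<in>support. w y z * g z) / (\<rho> * g y) = 1"
      using support_pos[OF y] rho_pos by simp
    moreover have "(\<Sum>z\<in>support. cocycle_kernel w \<rho> ratio y z)
        = (\<Sum>z\<in>support. w y z * g z) / (\<rho> * g y)"
      unfolding sum_divide_distrib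
      by (rule sum.cong) (simp_all add: cocycle_kernel_def divide_inverse)
    ultimately show ?thesis by (simp only:)
  qed
  show "0 < w y z" if "y \<in> support" "z \<in> support" "cocycle_kernel w \<rho> ratio y z \<noteq> 0" for y z
    using that support_subset weight_nonneg[of y z] by (force simp: cocycle_kernel_def)
qed

definition limit_measure :: "'a \<Rightarrow> (nat \<Rightarrow> 'a) measure" where
  "limit_measure x = finite_markov_chain.chain support w (cocycle_kernel w \<rho> ratio) x"

lemma complete_cocycle_limit_measure: "complete_cocycle_measure support w \<rho> ratio limit_measure"
  unfolding complete_cocycle_measure_def cocycle_measure_def
proof (intro conjI ballI rho_pos)
  have pos: "0 < g x \<and> 0 < g y" if "accessible support w x y" for x y
    using that accessible_source accessible_target support_pos by metis
  then show "\<forall>x y. accessible support w x y \<longrightarrow> 0 < ratio x y" by simp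
  have mult: "ratio x z = ratio x y * ratio y z" if "accessible support w x y" "accessible support w y z" for x y z
    using pos[OF that(1)] by simp
  show "cocycle support w ratio"
    unfolding cocycle_def using pos mult by (auto simp: less_imp_le)
  fix x assume x: "x \<in> support"
  interpret finite_markov_chain support w "cocycle_kernel w \<rho> ratio" x
    by (rule kernel_chain[OF x])
  show "borel_prob_on (infinite_path_topology support w x) (limit_measure x)"
    unfolding limit_measure_def by (rule borel_prob_chain)
  fix u assume u: "u \<in> finite_paths support w x"
  have diag: "ratio y y = 1" if "y \<in> support" for y using support_pos[OF that] by simp
  show "measure (limit_measure x) (cylinder support w x u)
      = inverse \<rho> ^ path_length u * path_weight w u * ratio x (last u)"
    unfolding limit_measure_def measure_chain_cylinder[OF u]
    by (rule cocycle_kernel_product[OF mult diag u])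
qed

lemma embed_path_in_all_paths:
  "\<eta> \<in> infinite_paths support w x \<Longrightarrow> embed_path \<eta> \<in> all_paths V w x"
  unfolding all_paths_def using support_subset by (intro UnI2 imageI) (auto simp: infinite_paths_def)

lemma limit_measure_basics:
  assumes "x \<in> support"
  shows "prob_space (limit_measure x)" "space (limit_measure x) = infinite_paths support w x"
    "\<eta> \<in> infinite_paths support w x \<Longrightarrow> cell (infinite_paths support w x) n \<eta> \<in> sets (limit_measure x)"
proof -
  interpret finite_markov_chain support w "cocycle_kernel w \<rho> ratio" x
    by (rule kernel_chain[OF assms])
  note b = borel_prob_chain[unfolded infinite_path_topology_eq[OF finite_support] borel_prob_on_def,
      folded limit_measure_def]
  show "prob_space (limit_measure x)" "space (limit_measure x) = infinite_paths support w x"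
    using b by (simp_all add: topspace_seq)
  show "cell (infinite_paths support w x) n \<eta> \<in> sets (limit_measure x)"
    if "\<eta> \<in> infinite_paths support w x"
    using b that by (simp add: sets_borel_of_seq open_in_sigma_cells openin_cell)
qed

lemma embed_path_measurable:
  assumes x: "x \<in> support"
  shows "embed_path \<in> measurable (limit_measure x) (borel_of (path_topology V w x))"
proof -
  interpret sequence_space "insert None (Some ` V)" "all_paths V w x"
    by (rule sequence_space_all_paths[OF finite_V])
  let ?I = "infinite_paths support w x"
  note basics = limit_measure_basics[OF x]
  show ?thesis
    unfolding path_topology_eq[OF finite_V]
  proof (rule measurable_cellsI)
    show "embed_path \<eta> \<in> all_paths V w x" if "\<eta> \<in> space (limit_measure x)" for \<eta>
      using that embed_path_in_all_paths by (simp add: basics)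
    fix n \<omega> assume "\<omega> \<in> all_paths V w x"
    show "embed_path -` cell (all_paths V w x) n \<omega> \<inter> space (limit_measure x) \<in> sets (limit_measure x)"
    \<comment> \<open>The preimage of a cell is either empty or the cell of the same depth around
      any of its points.\<close>
    proof (cases "embed_path -` cell (all_paths V w x) n \<omega> \<inter> ?I = {}")
      case False
      then obtain \<eta> where \<eta>: "\<eta> \<in> ?I" "embed_path \<eta> \<in> cell (all_paths V w x) n \<omega>" by auto
      have "embed_path -` cell (all_paths V w x) n \<omega> \<inter> ?I = cell ?I n \<eta>"
      proof -
        have "\<omega> i = Some (\<eta> i)" if "i < n" for i
          using \<eta>(2) that by (simp add: cell_def embed_path_def)
        then show ?thesis
          using embed_path_in_all_paths[of _ x] by (auto simp: cell_def embed_path_def)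
      qed
      then show ?thesis using basics(3)[OF \<eta>(1)] by (simp add: basics(2))
    qed (simp add: basics(2))
  qed
qed

lemma measure_on_all_paths_cell:
  assumes x: "x \<in> support" and "\<omega> \<in> all_paths V w x"
  shows "measure (on_all_paths V w x (limit_measure x)) (cell (all_paths V w x) n \<omega>)
    = measure (limit_measure x) {\<eta> \<in> infinite_paths support w x. \<forall>i<n. \<omega> i = Some (\<eta> i)}"
proof -
  interpret sequence_space "insert None (Some ` V)" "all_paths V w x"
    by (rule sequence_space_all_paths[OF finite_V])
  have "cell (all_paths V w x) n \<omega> \<in> sets (borel_of (path_topology V w x))"
    using assms(2) by (simp add: path_topology_eq[OF finite_V] sets_borel_of_seq open_in_sigma_cells openin_cell)
  then have "measure (on_all_paths V w x (limit_measure x)) (cell (all_paths V w x) n \<omega>)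
      = measure (limit_measure x) (embed_path -` cell (all_paths V w x) n \<omega> \<inter> space (limit_measure x))"
    unfolding on_all_paths_def by (rule measure_distr[OF embed_path_measurable[OF x]])
  also have "embed_path -` cell (all_paths V w x) n \<omega> \<inter> space (limit_measure x)
      = {\<eta> \<in> infinite_paths support w x. \<forall>i<n. \<omega> i = Some (\<eta> i)}"
    unfolding limit_measure_basics(2)[OF x] using embed_path_in_all_paths
    by (fastforce simp: cell_def embed_path_def)
  finally show ?thesis .
qed

text \<open>A path that ends in the support lies inside it and the cylinder formula applies.
  Otherwise both sides are 0: no infinite path in the support follows \<open>v\<close>, and
  \<open>g\<close> vanishes at \<open>last v\<close>.\<close>

lemma limit_measure_prefix:
  assumes v: "v \<in> finite_paths V w x0"
  shows "measure (limit_measure x0) {\<eta> \<in> infinite_paths support w x0. \<forall>i<length v. pad_path v i = Some (\<eta> i)}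
    = path_weight w v * (1 / \<rho>) ^ path_length v * (g (last v) / g x0)"
proof -
  have eq: "{\<eta> \<in> infinite_paths support w x0. \<forall>i<length v. pad_path v i = Some (\<eta> i)}
      = cylinder support w x0 v"
    by (auto simp: cylinder_def pad_path_def)
  show ?thesis
  proof (cases "last v \<in> support")
    case True
    then have "v \<in> finite_paths support w x0" by (rule finite_path_in_support[OF v])
    then show ?thesis
      unfolding eq using complete_cocycle_limit_measure x0_support
      by (simp add: complete_cocycle_measure_def cocycle_measure_def divide_inverse)
  next
    case False
    have lastV: "last v \<in> V" using v by (rule finite_paths_last)
    then have "g (last v) = 0" using False g_nonneg by (force simp: support_def)
    moreover have "cylinder support w x0 v = {}"
    proof -
      have "\<eta> (path_length v) \<notin> support" if "\<eta> \<in> cylinder support w x0 v" for \<eta>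
        using that False finite_path_nth(2,3)[OF v] by (simp add: cylinder_def)
      then show ?thesis by (fastforce simp: cylinder_def infinite_paths_def)
    qed
    ultimately show ?thesis unfolding eq by simp
  qed
qed

lemma boltzmann_weakly_converges:
  "weakly_converges (path_topology V w x0) (\<lambda>s. boltzmann V w x0 s)
    (on_all_paths V w x0 (limit_measure x0)) critical"
proof -
  interpret sequence_space "insert None (Some ` V)" "all_paths V w x0"
    by (rule sequence_space_all_paths[OF finite_V])
  let ?\<Omega> = "all_paths V w x0" and ?N = "on_all_paths V w x0 (limit_measure x0)"
  note top = path_topology_eq[OF finite_V, of w x0]
  note gf_ratio = path_gf_ratio_tendsto[where g = g, OF residual_limit x0(1)]
  have "prob_space ?N" unfolding on_all_paths_def
    by (rule prob_space.prob_space_distr[OF limit_measure_basics(1)[OF x0_support]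
          embed_path_measurable[OF x0_support]])
  then have N: "borel_prob_on seq_topology ?N"
    by (simp add: borel_prob_on_def on_all_paths_def top space_borel_of_seq topspace_seq)
  have ev: "\<forall>\<^sub>F s in critical. borel_prob_on seq_topology (boltzmann V w x0 s)"
    by (rule eventually_critical) (rule borel_prob_boltzmann[OF _ x0(1), unfolded top])
  have "((\<lambda>s. measure (boltzmann V w x0 s) (cell ?\<Omega> n \<omega>)) \<longlongrightarrow> measure ?N (cell ?\<Omega> n \<omega>)) critical"
    if \<omega>: "\<omega> \<in> ?\<Omega>" for n \<omega>
  proof (cases "n = 0")
    case True
    have one: "measure M (cell ?\<Omega> n \<omega>) = 1" if "borel_prob_on seq_topology M" for M
      using that prob_space.prob_space[of M] True by (simp add: cell_0 borel_prob_on_def topspace_seq)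
    have "\<forall>\<^sub>F s in critical. measure ?N (cell ?\<Omega> n \<omega>) = measure (boltzmann V w x0 s) (cell ?\<Omega> n \<omega>)"
      using ev by (rule eventually_mono) (simp add: one N)
    then show ?thesis by (rule Lim_transform_eventually[OF tendsto_const])
  next
    case False
    then have "0 < n" by simp
    with \<omega> show ?thesis
    proof (cases rule: all_paths_cases)
      case (short u)
      \<comment> \<open>The short path shows \<open>None\<close> within the first \<open>n\<close>
        symbols, which an infinite path never does; so the limit mass is 0, matched by the
        divergence of \<open>G\<close> at \<open>x0\<close>.\<close>
      have empty: "{\<eta> \<in> infinite_paths support w x0. \<forall>i<n. \<omega> i = Some (\<eta> i)} = {}"
        using short(2,3) by (auto simp: pad_path_def)
      have zero: "measure ?N (cell ?\<Omega> n \<omega>) = 0"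
        unfolding measure_on_all_paths_cell[OF x0_support \<omega>] empty by simp
      have "((\<lambda>s. path_weight w u * s ^ path_length u * (1 / G s x0))
          \<longlongrightarrow> path_weight w u * (1 / \<rho>) ^ path_length u * 0) critical"
        using x0(2) by (intro tendsto_mult tendsto_const tendsto_power tendsto_ident_critical
            path_gf_inverse_tendsto_0[OF h_pos residual_limit[OF x0(1)]]) simp
      moreover have "\<forall>\<^sub>F s in critical. path_weight w u * s ^ path_length u * (1 / G s x0)
          = measure (boltzmann V w x0 s) (cell ?\<Omega> n \<omega>)"
        unfolding short(3)
        by (rule eventually_critical) (simp add: boltzmann_short_cell[OF _ x0(1) short(1,2)])
      ultimately show ?thesis unfolding zero mult_zero_right by (rule Lim_transform_eventually)
    next
      case (long v)
      have "pad_path v \<in> ?\<Omega>" using long(1) by (simp add: all_paths_def)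
      from measure_on_all_paths_cell[OF x0_support this, of n]
      have limit: "measure ?N (cell ?\<Omega> n \<omega>)
          = path_weight w v * (1 / \<rho>) ^ path_length v * (g (last v) / g x0)"
        unfolding long(3) using limit_measure_prefix[OF long(1)] long(2) by simp
      have "((\<lambda>s. path_weight w v * s ^ path_length v * (G s (last v) / G s x0))
          \<longlongrightarrow> path_weight w v * (1 / \<rho>) ^ path_length v * (g (last v) / g x0)) critical"
        using x0(2) finite_paths_last[OF long(1)]
        by (intro tendsto_mult tendsto_const tendsto_power tendsto_ident_critical gf_ratio) simp_all
      moreover have "\<forall>\<^sub>F s in critical. path_weight w v * s ^ path_length v * (G s (last v) / G s x0)
          = measure (boltzmann V w x0 s) (cell ?\<Omega> n \<omega>)"
        unfolding long(3)
        by (rule eventually_critical)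
          (simp add: boltzmann_long_cell[OF _ x0(1) long(1), unfolded long(2)])
      ultimately show ?thesis unfolding limit by (rule Lim_transform_eventually)
    qed
  qed
  then show ?thesis unfolding top by (rule weakly_convergesI[OF ev N])
qed

end

text \<open>The entries are nonnegative, so a nonzero entry cannot be cancelled in its row
  sum.\<close>

lemma residual_row_total_nonzero:
  assumes "finite V" "is_residual_matrix V w \<Theta>"
  shows "\<exists>x\<in>V. row_total V \<Theta> x \<noteq> 0"
proof -
  let ?n = "card V"
  have \<Theta>: "\<Theta> \<in> carrier_mat ?n ?n" "\<Theta> \<noteq> 0\<^sub>m ?n ?n" and pos: "\<And>i j. i < ?n \<Longrightarrow> j < ?n \<Longrightarrow> 0 \<le> \<Theta> $$ (i, j)"
    using assms(2) by (auto simp: is_residual_matrix_def)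
  have "\<exists>i<?n. \<exists>j<?n. \<Theta> $$ (i, j) \<noteq> 0"
  proof (rule ccontr)
    assume "\<not> ?thesis"
    then have "\<Theta> = 0\<^sub>m ?n ?n" using \<Theta>(1) by (intro eq_matI) auto
    then show False using \<Theta>(2) by simp
  qed
  then obtain i j where ij: "i < ?n" "j < ?n" "\<Theta> $$ (i, j) \<noteq> 0" by auto
  have "0 < \<Theta> $$ (i, j)" using pos[OF ij(1,2)] ij(3) by simp
  also have "\<dots> \<le> (\<Sum>j<?n. \<Theta> $$ (i, j))"
    using pos ij by (intro member_le_sum) auto
  also have "\<dots> = row_total V \<Theta> (from_nat_into V i)"
    using \<Theta>(1) ij(1) by (simp add: row_total_def to_nat_on_from_nat_into_card[OF assms(1)]
        scalar_prod_def atLeast0LessThan)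
  finally show ?thesis using from_nat_into_mem[OF assms(1) ij(1)] by force
qed

text \<open>The middle conjunct of the conclusion justifies speaking of the cocycle measure with
  this kernel: any other complete one on \<open>U\<close> agrees with it, whatever rate and cocycle
  present it.\<close>

theorem theorem5p2:
  fixes V U :: "'a set" and w \<Gamma> :: "'a \<Rightarrow> 'a \<Rightarrow> real" and x0 :: 'a
    and \<rho> :: real and \<Theta> :: "real Matrix.mat"
  assumes "weighted_digraph V w"
    and "\<rho> = digraph_radius V w" and "0 < \<rho>"
    and "is_residual_matrix V w \<Theta>"
    and "x0 \<in> V" and "\<forall>y\<in>V. accessible V w x0 y"
    and "U = spanned_umbrella V w x0"
    and "\<Gamma> = (\<lambda>x y. row_total V \<Theta> y / row_total V \<Theta> x)"
  shows "\<exists>\<theta>. complete_cocycle_measure U w \<rho> \<Gamma> \<theta> \<and>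
    (\<forall>r \<Gamma>' \<theta>'. complete_cocycle_measure U w r \<Gamma>' \<theta>' \<and>
        (\<forall>x\<in>U. \<forall>y\<in>U. cocycle_kernel w r \<Gamma>' x y = cocycle_kernel w \<rho> \<Gamma> x y) \<longrightarrow>
        (\<forall>x\<in>U. \<theta>' x = \<theta> x)) \<and>
    weakly_converges (path_topology V w x0)
      (\<lambda>s. boltzmann V w x0 s) (on_all_paths V w x0 (\<theta> x0))
      (at (1 / \<rho>) within {0<..<1 / \<rho>})"
proof -
  define g where "g = row_total V \<Theta>"
  interpret positive_digraph V w \<rho>
    using assms(1-3) by unfold_locales
  obtain h where h: "0 < h"
    and lim: "\<And>x. x \<in> V \<Longrightarrow> ((\<lambda>s. (1 - \<rho> * s) ^ h * G s x) \<longlongrightarrow> g x) critical"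
    using residual_row_total_tendsto[OF finite_V _ assms(4)] assms(2,3) by (auto simp: g_def)
  have nonzero: "\<exists>x\<in>V. g x \<noteq> 0"
    unfolding g_def by (rule residual_row_total_nonzero[OF finite_V assms(4)])
  have supp: "0 < g x" if "x \<in> U" for x
    using that unfolding assms(7) by (rule residual_support(1)[OF assms(5,6) h lim nonzero, rotated])
  have supp_zero: "g x = 0" if "x \<in> V" "x \<notin> U" for x
    using that unfolding assms(7) by (rule residual_support(2)[OF assms(5,6) h lim nonzero, rotated])
  have x0U: "x0 \<in> U"
    unfolding assms(7) by (rule residual_support(3)[OF assms(5,6) h lim nonzero])
  interpret residual_digraph V w \<rho> h g x0
    using h lim assms(5) supp[OF x0U] by unfold_locales
  \<comment> \<open>Identifies the umbrella, defined through dominant chains, with the set where the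
    residual row sums are positive.\<close>
  have U: "U = support"
  proof (intro equalityI subsetI)
    fix x assume x: "x \<in> U"
    then have "x \<in> V" by (simp add: assms(7) spanned_umbrella_eq[OF assms(5,6)])
    then show "x \<in> support" using supp[OF x] by (simp add: support_def)
  next
    fix x assume "x \<in> support"
    then show "x \<in> U" using supp_zero[of x] by (auto simp: support_def)
  qed
  have \<Gamma>_eq: "\<Gamma> = (\<lambda>x y. g y / g x)" by (simp add: assms(8) g_def)
  note complete = complete_cocycle_limit_measure[folded U \<Gamma>_eq]
  show ?thesis
  proof (intro exI[of _ limit_measure] conjI complete boltzmann_weakly_converges allI impI ballI)
    fix r \<Gamma>' \<theta>' x
    assume "complete_cocycle_measure U w r \<Gamma>' \<theta>' \<and>
        (\<forall>x\<in>U. \<forall>y\<in>U. cocycle_kernel w r \<Gamma>' x y = cocycle_kernel w \<rho> \<Gamma> x y)" and "x \<in> U"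
    then show "\<theta>' x = limit_measure x"
      using complete_cocycle_measure_unique[OF finite_support[folded U] complete] by metis
  qed
qed

end
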